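(* Let $N\ge1$ and $\tau\in\mathbb C$ with $\mathrm{Im}\,\tau>0$. Let $R^{\mathrm B}$ be the Baxter–Belavin elliptic $R$-matrix, $R^{\mathrm{ACF}}$ the elliptic Arutyunov–Chekhov–Frolov $R$-matrix, $\bar R$ the twist matrix and $g(z,u)$ the IRF-Vertex transformation matrix, all defined in the context. Then, as identities of meromorphic functions of $\hbar,z,z_1,z_2,u_1,\dots,u_N$ with values in $\mathrm{Mat}(N,\mathbb C)^{\otimes 2}$, $$R^{\mathrm B}_{12}(\hbar,z_1-z_2)=g_1(z_1+\hbar,u)\,g_2(z_2,u)\,R^{\mathrm{ACF}}_{12}(\hbar,z_1,z_2|\,u)\,g_2^{-1}(z_2+\hbar,u)\,g_1^{-1}(z_1,u)$$ and $$\bar R_{12}(\hbar,z|\,u)=g_1^{-1}(z+\hbar,u+\hbar^{(2)})\,g_1(z,u).$$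
   Context: Theta functions with characteristics: $\theta\left[{a\atop b}\right](z|\tau)=\sum_{j\in\mathbb Z}\exp\left(\pi\imath\tau(j+a)^2+2\pi\imath(j+a)(z+b)\right)$; $\vartheta(z)=\theta\left[{1/2\atop 1/2}\right](z|\tau)$. Kronecker function $\phi(\eta,z)=\dfrac{\vartheta'(0)\vartheta(\eta+z)}{\vartheta(\eta)\vartheta(z)}$; first Eisenstein function $E_1(z)=\vartheta'(z)/\vartheta(z)$. $E_{ij}$ is the standard matrix-unit basis of $\mathrm{Mat}(N,\mathbb C)$, $u=(u_1,\dots,u_N)$, $u_{ij}=u_i-u_j$. All matrix indices run over $1,\dots,N$. Baxter–Belavin $R$-matrix: let $Q_{kl}=\delta_{kl}e^{2\pi\imath k/N}$, $\Lambda_{kl}=1$ if $k-l+1\equiv0\bmod N$ and $0$ otherwise, $T_a=e^{\pi\imath a_1a_2/N}Q^{a_1}\Lambda^{a_2}$ for $a=(a_1,a_2)$, and $\varphi^\hbar_a(z)=e^{2\pi\imath a_2z/N}\,\phi\!\left(z,\frac{\hbar+a_1+a_2\tau}{N}\right)$. Then $$R^{\mathrm B}_{12}(\hbar,z)=\frac1N\sum_{a\in\mathbb Z_N\times\mathbb Z_N}\varphi^\hbar_a(z)\,T_a\otimes T_{-a},$$ where each $a$ is represented by a pair of integers and $-a=(-a_1,-a_2)$ (each summand does not depend on the choice of representative). ACF $R$-matrix: $$R^{\mathrm{ACF}}_{12}(\hbar,z_1,z_2|\,u)=\sum_{i\ne j}E_{ii}\otimes E_{jj}\,\phi(\hbar,-u_{ij})+\sum_{i\ne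 j}E_{ij}\otimes E_{ji}\,\phi(z_1-z_2,-u_{ij})-\sum_{i\ne j}E_{ij}\otimes E_{jj}\,\phi(z_1+\hbar,-u_{ij})+\sum_{i\ne j}E_{jj}\otimes E_{ij}\,\phi(z_2,-u_{ij})+\bigl(E_1(\hbar)+E_1(z_1-z_2)+E_1(z_2)-E_1(z_1+\hbar)\bigr)\sum_iE_{ii}\otimes E_{ii}.$$ Twist matrix $\bar R_{12}(\hbar,z|\,u)$, defined by $$\frac{\vartheta'(0)}{\vartheta(\hbar)}\,\bar R_{12}(\hbar,z|\,u)=\sum_{i\ne j}E_{ii}\otimes E_{jj}\,\phi(\hbar,-u_{ij})-\sum_{i\ne j}E_{ij}\otimes E_{jj}\,\phi(z+\hbar,-u_{ij})-\phi(z+\hbar,-\hbar)\sum_iE_{ii}\otimes E_{ii}.$$ IRF-Vertex transformation matrix $g(z,u)\in\mathrm{Mat}(N,\mathbb C)$: $$g_{ij}(z,u)=\theta\left[{\frac12-\frac iN\atop \frac N2}\right]\!\Bigl(z+Nu_j-\sum_{m=1}^Nu_m\Big|\,N\tau\Bigr)\,\frac{1}{\prod_{k\ne j}\vartheta(u_k-u_j)}.$$ Notation: $g_1=g\otimes1$, $g_2=1\otimes g$; and the shift $\hbar^{(2)}$ means $g_1^{-1}(z,u+\hbar^{(2)})=\sum_{k=1}^N g^{-1}(z,u+\hbar e_k)\otimes E_{kk}$, where $e_k$ is the $k$-th standard basis vector, i.e. $u_k\mapsto u_k+\hbar$. *)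

theory Defs
  imports "HOL-Analysis.Analysis"
begin

definition theta_char :: "complex \<Rightarrow> complex \<Rightarrow> complex \<Rightarrow> complex \<Rightarrow> complex" where
  "theta_char a b z \<tau> =
     (\<Sum>\<^sub>\<infinity>j\<in>(UNIV :: int set).
        exp (pi * \<i> * \<tau> * (of_int j + a)^2 + 2 * pi * \<i> * (of_int j + a) * (z + b)))"

definition vtheta :: "complex \<Rightarrow> complex \<Rightarrow> complex" where
  "vtheta \<tau> z = theta_char (1/2) (1/2) z \<tau>"

definition kronecker_phi :: "complex \<Rightarrow> complex \<Rightarrow> complex \<Rightarrow> complex" where
  "kronecker_phi \<tau> \<eta> z = deriv (vtheta \<tau>) 0 * vtheta \<tau> (\<eta> + z) / (vtheta \<tau> \<eta> * vtheta \<tau> z)"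

definition eisenstein_E1 :: "complex \<Rightarrow> complex \<Rightarrow> complex" where
  "eisenstein_E1 \<tau> z = deriv (vtheta \<tau>) z / vtheta \<tau> z"

text \<open>
  \<open>Mat(N,\<complex>)\<close> is rendered as \<open>complex^'n^'n\<close> with \<open>N = CARD('n)\<close>, and its tensor square as
  matrices indexed by pairs.  Formulas that use the numerical value of a matrix index take a
  labelling \<open>\<nu> :: 'n \<Rightarrow> nat\<close>, intended to be a bijection onto \<open>{1..N}\<close>.  The library's \<open>*\<close> on
  vectors and matrices is componentwise and is not used here; the matrix product is \<open>**\<close>.
\<close>

definition cscale :: "complex \<Rightarrow> complex^'m^'k \<Rightarrow> complex^'m^'k" (infixr "*\<^sub>M" 72) where
  "c *\<^sub>M A = (\<chi> i j. c * A $ i $ j)"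

definition mat_unit :: "'n \<Rightarrow> 'n \<Rightarrow> complex^'n^'n" where
  "mat_unit i j = (\<chi> k l. if k = i \<and> l = j then 1 else 0)"

definition tensor :: "complex^'n^'n \<Rightarrow> complex^'n^'n \<Rightarrow> complex^('n \<times> 'n)^('n \<times> 'n)"
  (infixl "\<otimes>\<^sub>M" 74) where
  "A \<otimes>\<^sub>M B = (\<chi> p q. A $ fst p $ fst q * B $ snd p $ snd q)"

definition leg1 :: "complex^'n^'n \<Rightarrow> complex^('n \<times> 'n)^('n \<times> 'n)" where
  "leg1 A = A \<otimes>\<^sub>M mat 1"

definition leg2 :: "complex^'n^'n \<Rightarrow> complex^('n \<times> 'n)^('n \<times> 'n)" where
  "leg2 A = mat 1 \<otimes>\<^sub>M A"

primrec mat_pow :: "complex^'n^'n \<Rightarrow> nat \<Rightarrow> complex^'n^'n" where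
  "mat_pow A 0 = mat 1"
| "mat_pow A (Suc k) = A ** mat_pow A k"

definition mat_powi :: "complex^'n^'n \<Rightarrow> int \<Rightarrow> complex^'n^'n" where
  "mat_powi A k = (if k \<ge> 0 then mat_pow A (nat k) else mat_pow (matrix_inv A) (nat (- k)))"

definition Q_mat :: "('n::finite \<Rightarrow> nat) \<Rightarrow> complex^'n^'n" where
  "Q_mat \<nu> = (\<chi> k l. if k = l then exp (2 * pi * \<i> * of_nat (\<nu> k) / of_nat CARD('n)) else 0)"

definition Lambda_mat :: "('n::finite \<Rightarrow> nat) \<Rightarrow> complex^'n^'n" where
  "Lambda_mat \<nu> = (\<chi> k l. if (int (\<nu> k) - int (\<nu> l) + 1) mod int CARD('n) = 0 then 1 else 0)"

definition T_mat :: "('n::finite \<Rightarrow> nat) \<Rightarrow> int \<Rightarrow> int \<Rightarrow> complex^'n^'n" where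
  "T_mat \<nu> a1 a2 =
     exp (pi * \<i> * of_int a1 * of_int a2 / of_nat CARD('n)) *\<^sub>M
       (mat_powi (Q_mat \<nu>) a1 ** mat_powi (Lambda_mat \<nu>) a2)"

definition phi_char :: "nat \<Rightarrow> complex \<Rightarrow> complex \<Rightarrow> int \<Rightarrow> int \<Rightarrow> complex \<Rightarrow> complex" where
  "phi_char N \<tau> h a1 a2 z =
     exp (2 * pi * \<i> * of_int a2 * z / of_nat N) *
       kronecker_phi \<tau> z ((h + of_int a1 + of_int a2 * \<tau>) / of_nat N)"

text \<open>The summand is \<open>N\<close>-periodic in \<open>a1\<close> and \<open>a2\<close>; the representatives \<open>0, \<dots>, N-1\<close> are used.\<close>

definition R_BB :: "complex \<Rightarrow> ('n::finite \<Rightarrow> nat) \<Rightarrow> complex \<Rightarrow> complex \<Rightarrow>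
    complex^('n \<times> 'n)^('n \<times> 'n)" where
  "R_BB \<tau> \<nu> h z =
     (1 / of_nat CARD('n)) *\<^sub>M
       (\<Sum>a1 = 0..<int CARD('n). \<Sum>a2 = 0..<int CARD('n).
          phi_char CARD('n) \<tau> h a1 a2 z *\<^sub>M (T_mat \<nu> a1 a2 \<otimes>\<^sub>M T_mat \<nu> (- a1) (- a2)))"

definition R_ACF :: "complex \<Rightarrow> complex \<Rightarrow> complex \<Rightarrow> complex \<Rightarrow> complex^'n \<Rightarrow>
    complex^('n::finite \<times> 'n)^('n \<times> 'n)" where
  "R_ACF \<tau> h z1 z2 u =
       (\<Sum>(i, j) | i \<noteq> j. kronecker_phi \<tau> h (- (u $ i - u $ j)) *\<^sub>M
          (mat_unit i i \<otimes>\<^sub>M mat_unit j j))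
     + (\<Sum>(i, j) | i \<noteq> j. kronecker_phi \<tau> (z1 - z2) (- (u $ i - u $ j)) *\<^sub>M
          (mat_unit i j \<otimes>\<^sub>M mat_unit j i))
     - (\<Sum>(i, j) | i \<noteq> j. kronecker_phi \<tau> (z1 + h) (- (u $ i - u $ j)) *\<^sub>M
          (mat_unit i j \<otimes>\<^sub>M mat_unit j j))
     + (\<Sum>(i, j) | i \<noteq> j. kronecker_phi \<tau> z2 (- (u $ i - u $ j)) *\<^sub>M
          (mat_unit j j \<otimes>\<^sub>M mat_unit i j))
     + (eisenstein_E1 \<tau> h + eisenstein_E1 \<tau> (z1 - z2) + eisenstein_E1 \<tau> z2
          - eisenstein_E1 \<tau> (z1 + h)) *\<^sub>M
          (\<Sum>i\<in>UNIV. mat_unit i i \<otimes>\<^sub>M mat_unit i i)"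

definition R_bar :: "complex \<Rightarrow> complex \<Rightarrow> complex \<Rightarrow> complex^'n \<Rightarrow>
    complex^('n::finite \<times> 'n)^('n \<times> 'n)" where
  "R_bar \<tau> h z u =
     (vtheta \<tau> h / deriv (vtheta \<tau>) 0) *\<^sub>M
      ((\<Sum>(i, j) | i \<noteq> j. kronecker_phi \<tau> h (- (u $ i - u $ j)) *\<^sub>M
          (mat_unit i i \<otimes>\<^sub>M mat_unit j j))
     - (\<Sum>(i, j) | i \<noteq> j. kronecker_phi \<tau> (z + h) (- (u $ i - u $ j)) *\<^sub>M
          (mat_unit i j \<otimes>\<^sub>M mat_unit j j))
     - kronecker_phi \<tau> (z + h) (- h) *\<^sub>M
          (\<Sum>i\<in>UNIV. mat_unit i i \<otimes>\<^sub>M mat_unit i i))"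

definition g_mat :: "complex \<Rightarrow> ('n::finite \<Rightarrow> nat) \<Rightarrow> complex \<Rightarrow> complex^'n \<Rightarrow> complex^'n^'n" where
  "g_mat \<tau> \<nu> z u =
     (\<chi> i j. theta_char (1/2 - of_nat (\<nu> i) / of_nat CARD('n)) (of_nat CARD('n) / 2)
                (z + of_nat CARD('n) * u $ j - (\<Sum>m\<in>UNIV. u $ m)) (of_nat CARD('n) * \<tau>)
              / (\<Prod>k\<in>UNIV - {j}. vtheta \<tau> (u $ k - u $ j)))"

text \<open>The inverse of \<open>g(z, u)\<close> on the first tensor factor, with the dynamical shift \<open>u\<^sub>k \<mapsto> u\<^sub>k + h\<close>
  governed by the second factor.\<close>

definition g_inv1_shift2 :: "complex \<Rightarrow> ('n::finite \<Rightarrow> nat) \<Rightarrow> complex \<Rightarrow> complex \<Rightarrow> complex^'n \<Rightarrow>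
    complex^('n \<times> 'n)^('n \<times> 'n)" where
  "g_inv1_shift2 \<tau> \<nu> h z u =
     (\<Sum>k\<in>UNIV. matrix_inv (g_mat \<tau> \<nu> z (u + axis k h)) \<otimes>\<^sub>M mat_unit k k)"

text \<open>
  An identity of meromorphic functions is stated as equality at every point of the common domain,
  i.e. wherever no theta function occurring in a denominator vanishes and the matrices to be
  inverted are invertible.  As division by zero and inverses of singular matrices take
  conventional or unspecified values, these domains have to be explicit; they are claimed to be open
  and dense, so that the equalities determine the meromorphic functions.
\<close>

definition u_regular :: "complex \<Rightarrow> complex^'n \<Rightarrow> bool" where
  "u_regular \<tau> u \<longleftrightarrow> (\<forall>i j. i \<noteq> j \<longrightarrow> vtheta \<tau> (u $ i - u $ j) \<noteq> 0)"

definition dom_vertex :: "complex \<Rightarrow> ('n::finite \<Rightarrow> nat) \<Rightarrow>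
    (complex \<times> complex \<times> complex \<times> (complex^'n)) set" where
  "dom_vertex \<tau> \<nu> = {(h, z1, z2, u).
     vtheta \<tau> h \<noteq> 0 \<and> vtheta \<tau> (z1 - z2) \<noteq> 0 \<and> vtheta \<tau> (z1 + h) \<noteq> 0 \<and> vtheta \<tau> z2 \<noteq> 0 \<and>
     (\<forall>a1\<in>{0..<int CARD('n)}. \<forall>a2\<in>{0..<int CARD('n)}.
        vtheta \<tau> ((h + of_int a1 + of_int a2 * \<tau>) / of_nat CARD('n)) \<noteq> 0) \<and>
     u_regular \<tau> u \<and>
     invertible (g_mat \<tau> \<nu> (z2 + h) u) \<and> invertible (g_mat \<tau> \<nu> z1 u)}"

definition dom_twist :: "complex \<Rightarrow> ('n::finite \<Rightarrow> nat) \<Rightarrow>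
    (complex \<times> complex \<times> (complex^'n)) set" where
  "dom_twist \<tau> \<nu> = {(h, z, u).
     vtheta \<tau> h \<noteq> 0 \<and> vtheta \<tau> (z + h) \<noteq> 0 \<and> u_regular \<tau> u \<and>
     (\<forall>k. u_regular \<tau> (u + axis k h) \<and> invertible (g_mat \<tau> \<nu> (z + h) (u + axis k h)))}"

end

theory Submission
  imports Defs "HOL-Complex_Analysis.Complex_Analysis"
begin

text \<open>
  Two entire functions with proportional multipliers under \<open>v \<mapsto> v + 1\<close> and \<open>v \<mapsto> v + \<tau>\<close> have, if
  the zeros of the denominator are simple and common, an entire quotient that is an exponential by
  Liouville's theorem, hence zero unless its multipliers are those of \<open>e\<^bsup>2\<pi>ikv\<^esup>\<close>. Comparing \<open>\<vartheta>\<close> with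
  Jacobi's product in this way shows that its zeros are exactly the lattice points, and simple. The
  same principle yields Lagrange interpolation of \<open>\<theta>\<^sub>i(z + N v - \<Sum> u\<^sub>m)\<close> at the nodes \<open>u\<^sub>k\<close>.
  Interpolation at the nodes with \<open>u\<^sub>k\<close> shifted by \<open>h\<close>, evaluated at \<open>u\<^sub>k\<close>, is the twist identity, and it
  gives the invertibility of \<open>g(z, u)\<close> for regular \<open>u\<close> and \<open>\<vartheta>(z) \<noteq> 0\<close>.

  The first identity is equivalent to
  \<open>R\<^sup>B g\<^sub>1(z\<^sub>1) g\<^sub>2(z\<^sub>2 + h) = g\<^sub>1(z\<^sub>1 + h) g\<^sub>2(z\<^sub>2) R\<^sup>A\<^sup>C\<^sup>F\<close>. On the columns \<open>e\<^sub>k \<otimes> e\<^sub>l\<close> with \<open>k \<noteq> l\<close> the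
  denominators of \<open>g\<close> cancel and a theta identity in \<open>v = u\<^sub>k - u\<^sub>l\<close> remains, which again follows from the
  quotient principle. Its derivative at \<open>v = 0\<close>, combined with the derivative of the interpolation
  formula at the node \<open>u\<^sub>k\<close>, gives the columns \<open>e\<^sub>k \<otimes> e\<^sub>k\<close>.
\<close>

text \<open>No count of zeros and no dimension formula for theta functions is used. Each identity is
  turned into an entire F that vanishes on the zeros of an explicit product G, where F and G have
  the same multipliers up to one constant: \<open>exp (2 * pi * \<i> * h)\<close> for the R-matrix
  identity, \<open>exp (- (2 * pi * \<i> * z))\<close> for interpolation. A nonzero quotient would
  put h or z into the lattice \<int> + \<int>\<tau>, and this is what the nonvanishing of
  \<open>vtheta \<tau> h\<close> and \<open>vtheta \<tau> z\<close> excludes. Simple zeros of G need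
  genericity: inequivalent nodes, or x - y off the lattice. The latter restriction is lifted by
  continuity.

  The determinant of g is not factorised either. A row vector annihilating g gives a combination of
  theta functions vanishing at N nodes, hence everywhere by interpolation, and these functions are
  independent as eigenfunctions of a translation.

  In a column with both indices k, the two differentiated interpolation formulas contain the same
  logarithmic derivative of the product over the other nodes. It enters with opposite signs and
  cancels, which is why only values of E1 remain on the diagonal of the ACF matrix.\<close>

no_notation fps_nth (infixl "$" 75)

section \<open>Theta functions with characteristics\<close>

definition theta_term :: "complex \<Rightarrow> complex \<Rightarrow> complex \<Rightarrow> complex \<Rightarrow> int \<Rightarrow> complex" where
  "theta_term a b \<tau> z j = exp (pi * \<i> * \<tau> * (of_int j + a)^2 + 2 * pi * \<i> * (of_int j + a) * (z + b))"

lemma theta_char_eq: "theta_char a b z \<tau> = (\<Sum>\<^sub>\<infinity>j. theta_term a b \<tau> z j)"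
  by (simp add: theta_char_def theta_term_def)

text \<open>Linear decay is enough as a majorant of the theta series; it splits at 0 into two
  geometric series of ratio \<open>exp (-1)\<close>.\<close>

lemma summable_on_exp_neg_abs_int: "(\<lambda>j::int. exp (K - real_of_int \<bar>j\<bar>)) summable_on UNIV"
proof -
  have s: "(\<lambda>n::nat. exp (- real n)) summable_on UNIV"
  proof -
    have "(\<lambda>n::nat. exp (-1::real) ^ n) summable_on UNIV"
      by (rule summable_on_UNIV_nonneg_real_iff[THEN iffD2]) (auto intro!: summable_geometric)
    then show ?thesis by (simp flip: exp_of_nat_mult)
  qed
  have p: "(\<lambda>j::int. exp (- real_of_int \<bar>j\<bar>)) summable_on range int"
    by (subst summable_on_reindex) (auto simp: o_def s)
  have "(\<lambda>j::int. exp (- real_of_int \<bar>j\<bar>)) summable_on range (\<lambda>n. - int n)"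
    by (subst summable_on_reindex) (auto simp: o_def s inj_on_def)
  with p have "(\<lambda>j::int. exp (- real_of_int \<bar>j\<bar>)) summable_on (range int \<union> range (\<lambda>n. - int n))"
    by (rule summable_on_union)
  moreover have "range int \<union> range (\<lambda>n. - int n) = UNIV"
    by (auto simp: image_iff) (metis int_cases2)
  ultimately have "(\<lambda>j::int. exp (- real_of_int \<bar>j\<bar>)) summable_on UNIV" by simp
  then have "(\<lambda>j::int. exp K * exp (- real_of_int \<bar>j\<bar>)) summable_on UNIV"
    by (rule summable_on_cmult_right)
  then show ?thesis by (simp add: exp_diff exp_minus field_simps)
qed

text \<open>The real part of the exponent is quadratic in j with leading coefficient -pi Im \<tau> <
  0, so it lies below a line of any slope. The bound is uniform on a disc, as the M-test
  requires.\<close>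

lemma theta_term_bound:
  assumes "Im \<tau> > 0"
  obtains K where "\<And>j z. norm z \<le> r \<Longrightarrow> norm (theta_term a b \<tau> z j) \<le> exp (K - real_of_int \<bar>j\<bar>)"
proof -
  \<comment> \<open>In the real part of the exponent, \<open>-A\<close> is the coefficient of
    \<open>j^2\<close>, while \<open>B\<close> and \<open>C\<close> bound those of \<open>j\<close>
    and of 1.\<close>
  define A where "A = pi * Im \<tau>"
  define B where "B = 2 * pi * (norm \<tau> * norm a + (r + norm b))"
  define C where "C = pi * (norm \<tau> * norm a ^ 2) + 2 * pi * (norm a * (r + norm b))"
  have A: "A > 0" using assms by (simp add: A_def)
  show ?thesis
  \<comment> \<open>\<open>(B+1)^2 / (4*A)\<close> is the maximum of
    \<open>- A * t^2 + (B+1) * t\<close>; the 1 added to \<open>B\<close> pays for the linear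
    decay.\<close>
  proof (rule that[of "(B+1)^2 / (4*A) + C"])
    fix j :: int and z :: complex assume z: "norm z \<le> r"
    define c1 where "c1 = 2 * pi * \<i> * (\<tau> * a + (z + b))"
    define c0 where "c0 = pi * \<i> * \<tau> * a^2 + 2 * pi * \<i> * a * (z + b)"
    have zb: "norm (z + b) \<le> r + norm b" using z norm_triangle_ineq[of z b] by linarith
    have "norm c1 \<le> B"
      unfolding c1_def B_def
      by (auto simp: norm_mult intro!: mult_left_mono order.trans[OF norm_triangle_ineq] add_mono zb)
    then have c1: "\<bar>Re c1\<bar> \<le> B" using abs_Re_le_cmod[of c1] by linarith
    have "norm c0 \<le> C"
      unfolding c0_def C_def
      by (rule order.trans[OF norm_triangle_ineq])
         (auto simp: norm_mult norm_power intro!: mult_left_mono add_mono zb)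
    then have c0: "Re c0 \<le> C" using complex_Re_le_cmod[of c0] by linarith
    have eq: "pi * \<i> * \<tau> * (of_int j + a)^2 + 2 * pi * \<i> * (of_int j + a) * (z + b) =
       pi * \<i> * \<tau> * of_int (j^2) + of_int j * c1 + c0"
      by (simp add: c1_def c0_def algebra_simps power2_eq_square)
    have re: "Re (pi * \<i> * \<tau> * (of_int j + a)^2 + 2 * pi * \<i> * (of_int j + a) * (z + b)) =
       - A * real_of_int \<bar>j\<bar>^2 + real_of_int j * Re c1 + Re c0"
      unfolding eq by (simp add: A_def del: of_int_power) 
    have "real_of_int j * Re c1 \<le> real_of_int \<bar>j\<bar> * B"
      using order.trans[OF abs_ge_self mult_left_mono[OF c1, of "\<bar>real_of_int j\<bar>", folded abs_mult]]
      by simp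
    moreover have "- A * real_of_int \<bar>j\<bar>^2 + real_of_int \<bar>j\<bar> * B \<le> (B+1)^2/(4*A) - real_of_int \<bar>j\<bar>"
    proof -
      have "0 \<le> (2 * A * real_of_int \<bar>j\<bar> - (B+1))^2" by simp
      then have "0 \<le> (2 * A * real_of_int \<bar>j\<bar> - (B+1))^2 / (4*A)" using A by simp
      also have "\<dots> = A * real_of_int \<bar>j\<bar>^2 - real_of_int \<bar>j\<bar> * (B+1) + (B+1)^2/(4*A)"
        using A by (simp add: field_simps power2_eq_square)
      finally show ?thesis by (simp add: algebra_simps)
    qed
    ultimately show "norm (theta_term a b \<tau> z j) \<le> exp ((B+1)^2/(4*A) + C - real_of_int \<bar>j\<bar>)"
      unfolding theta_term_def norm_exp_eq_Re re using c0 by simp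
  qed
qed

lemma theta_term_abs_summable:
  assumes "Im \<tau> > 0"
  shows "(\<lambda>j. norm (theta_term a b \<tau> z j)) summable_on UNIV"
proof -
  obtain K where K: "\<And>j w. norm w \<le> norm z \<Longrightarrow> norm (theta_term a b \<tau> w j) \<le> exp (K - real_of_int \<bar>j\<bar>)"
    using theta_term_bound[OF assms] by metis
  show ?thesis
    by (rule summable_on_comparison_test[OF summable_on_exp_neg_abs_int[of K]]) (use K in auto)
qed

lemma theta_term_summable:
  assumes "Im \<tau> > 0"
  shows "theta_term a b \<tau> z summable_on UNIV"
  using abs_summable_summable[OF theta_term_abs_summable[OF assms]] .

lemma theta_char_holomorphic_UNIV:
  assumes "Im \<tau> > 0"
  shows "(\<lambda>z. theta_char a b z \<tau>) holomorphic_on UNIV"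
proof -
  have "(\<lambda>z. theta_char a b z \<tau>) holomorphic_on ball 0 r" for r :: real
  proof -
    obtain K where K: "\<And>j w. norm w \<le> r \<Longrightarrow> norm (theta_term a b \<tau> w j) \<le> exp (K - real_of_int \<bar>j\<bar>)"
      using theta_term_bound[OF assms] by metis
    have u: "uniform_limit (cball 0 r) (\<lambda>X z. \<Sum>j\<in>X. theta_term a b \<tau> z j)
        (\<lambda>z. \<Sum>\<^sub>\<infinity>j. theta_term a b \<tau> z j) (finite_subsets_at_top UNIV)"
      by (rule Weierstrass_m_test_general[OF _ summable_on_exp_neg_abs_int[of K]]) (use K in auto)
    have "(\<lambda>z. \<Sum>\<^sub>\<infinity>j. theta_term a b \<tau> z j) holomorphic_on ball 0 r"
      by (rule holomorphic_uniform_limit[OF _ u])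
         (auto intro!: always_eventually continuous_intros holomorphic_intros simp: theta_term_def)
    then show ?thesis by (simp add: theta_char_eq)
  qed
  then have "(\<lambda>z. theta_char a b z \<tau>) field_differentiable at z" for z
    by (rule holomorphic_on_imp_differentiable_at[of _ "ball 0 (norm z + 1)"]) auto
  then show ?thesis by (auto simp: holomorphic_on_def field_differentiable_at_within)
qed

text \<open>Completing the square in the exponent. The factor s may be any complex number:
  \<open>btheta\<close> uses s = n/N with modulus N\<tau>, where the change of characteristic
  becomes a shift of the label.\<close>

lemma theta_char_add_tau:
  "theta_char a b (z + s * \<tau>) \<tau> =
     exp (- (pi * \<i> * \<tau> * s^2) - 2 * pi * \<i> * s * (z + b)) * theta_char (a + s) b z \<tau>"
  unfolding theta_char_eq theta_term_def
  by (simp flip: infsum_cmult_right' exp_add) (simp add: algebra_simps power2_eq_square)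

lemma theta_char_a_add_int: "theta_char (a + of_int m) b z \<tau> = theta_char a b z \<tau>"
proof -
  have "bij_betw (\<lambda>j::int. j + m) UNIV UNIV"
    by (rule bij_betw_byWitness[where f' = "\<lambda>j. j - m"]) auto
  note bij = this
  have "theta_term (a + of_int m) b \<tau> z j = theta_term a b \<tau> z (j + m)" for j
    by (simp add: theta_term_def add_ac)
  with infsum_reindex_bij_betw[OF bij, of "theta_term a b \<tau> z"]
  show ?thesis by (simp add: theta_char_eq)
qed

lemma exp_2pi_of_int [simp]: "exp (2 * pi * \<i> * of_int n) = 1"
  using exp_integer_2pi[of "of_int n"] by (simp add: mult_ac)

lemma theta_char_add_int:
  "theta_char a b (z + of_int m) \<tau> = exp (2 * pi * \<i> * a * of_int m) * theta_char a b z \<tau>"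
proof -
  have "exp (pi * \<i> * \<tau> * (of_int j + a)\<^sup>2 + 2 * pi * \<i> * (of_int j + a) * (z + of_int m + b)) =
     exp (2 * pi * \<i> * of_int (j * m)) * (exp (2 * pi * \<i> * a * of_int m) * theta_term a b \<tau> z j)" for j
    unfolding theta_term_def exp_add[symmetric] by (simp add: algebra_simps)
  then show ?thesis
    by (simp only: theta_char_eq theta_term_def[of _ _ _ "z + of_int m"] exp_2pi_of_int mult_1
        infsum_cmult_right')
qed

lemma vtheta_minus: "vtheta \<tau> (- z) = - vtheta \<tau> z"
proof -
  \<comment> \<open>The reflection sends j + 1/2 to its negative. The characteristic b = 1/2 then
    contributes \<open>exp (- pi * \<i> * (2 * j + 1))\<close>, which is -1.\<close>
  have b: "bij_betw (\<lambda>j::int. - 1 - j) UNIV UNIV"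
    by (rule bij_betw_byWitness[where f' = "\<lambda>j. - 1 - j"]) auto
  have *: "theta_term (1/2) (1/2) \<tau> (- z) (- 1 - j) = - theta_term (1/2) (1/2) \<tau> z j" for j
  proof -
    have "theta_term (1/2) (1/2) \<tau> (- z) (- 1 - j) =
       theta_term (1/2) (1/2) \<tau> z j * (exp (- (pi * \<i>)) * exp (2 * pi * \<i> * of_int (- j)))"
      unfolding theta_term_def exp_add[symmetric]
      by (rule arg_cong[where f=exp]) (simp add: algebra_simps power2_eq_square)
    also have "\<dots> = - theta_term (1/2) (1/2) \<tau> z j"
      unfolding exp_2pi_of_int by (simp add: exp_minus)
    finally show ?thesis .
  qed
  show ?thesis
    using infsum_reindex_bij_betw[OF b, of "theta_term (1/2) (1/2) \<tau> (-z)"]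
    unfolding vtheta_def theta_char_eq * by (simp add: infsum_uminus)
qed

section \<open>Roots of unity and non-vanishing of the theta series\<close>

lemma exp_roots_of_unity_eq_1_iff:
  assumes "M > 0"
  shows "exp (2 * pi * \<i> * of_int j / of_nat M) = 1 \<longleftrightarrow> int M dvd j"
proof
  assume "exp (2 * pi * \<i> * of_int j / of_nat M) = 1"
  then obtain n :: int where "2 * pi * real_of_int j / real M = of_int (2 * n) * pi"
    by (auto simp: exp_eq_1)
  then have "real_of_int j = of_int (n * int M)"
    using assms by (simp add: field_simps)
  then have "j = n * int M" by (simp only: of_int_eq_iff)
  then show "int M dvd j" by simp
next
  assume "int M dvd j"
  then obtain n where "j = int M * n" by (auto simp: dvd_def)
  then have "2 * pi * \<i> * of_int j / of_nat M = 2 * pi * \<i> * of_int n"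
    using assms by simp
  then show "exp (2 * pi * \<i> * of_int j / of_nat M) = 1" by (simp only: exp_2pi_of_int)
qed

lemma sum_exp_roots_of_unity:
  assumes "M > 0"
  shows "(\<Sum>k<M. exp (2 * pi * \<i> * of_int j * of_nat k / of_nat M)) = (if int M dvd j then of_nat M else 0)"
proof -
  define w where "w = exp (2 * pi * \<i> * of_int j / of_nat M)"
  have *: "exp (2 * pi * \<i> * of_int j * of_nat k / of_nat M) = w ^ k" for k
    unfolding w_def exp_of_nat_mult[symmetric] by (rule arg_cong[where f=exp]) simp
  have "w ^ M = 1"
    unfolding *[symmetric] using assms exp_2pi_of_int[of j] by simp
  then show ?thesis
    using exp_roots_of_unity_eq_1_iff[OF assms, of j]
    unfolding * w_def[symmetric] by (auto simp: sum_gp_strict)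
qed

text \<open>If the function were zero, averaging its values at k/M for k < M would isolate the terms
  whose index is divisible by M. For large M these are the nonzero term j = 0 and a tail that is too
  small to cancel it.\<close>

lemma theta_char_not_identically_0:
  assumes "Im \<tau> > 0"
  obtains z where "theta_char a b z \<tau> \<noteq> 0"
proof (rule ccontr)
  assume "\<not> thesis"
  then have 0: "theta_char a b z \<tau> = 0" for z using that by blast
  let ?t = "theta_term a b \<tau> 0"
  have pos: "norm (?t 0) > 0" by (simp add: theta_term_def)
  from summable_on_iff_abs_summable_on_complex theta_term_abs_summable[OF assms, of a b 0]
  have sm: "(\<lambda>j. norm (?t j)) summable_on UNIV" by simp
  obtain S where S: "finite S" "(\<Sum>\<^sub>\<infinity>j\<in>-S. norm (?t j)) < norm (?t 0)"
  proof -
    have "((\<lambda>F. \<Sum>\<^sub>\<infinity>j\<in>-F. norm (?t j)) \<longlongrightarrow> 0) (finite_subsets_at_top UNIV)"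
    proof -
      have "((\<lambda>F. (\<Sum>\<^sub>\<infinity>j. norm (?t j)) - sum (\<lambda>j. norm (?t j)) F) \<longlongrightarrow>
          (\<Sum>\<^sub>\<infinity>j. norm (?t j)) - (\<Sum>\<^sub>\<infinity>j. norm (?t j))) (finite_subsets_at_top UNIV)"
        by (intro tendsto_intros infsum_tendsto sm)
      moreover have "eventually (\<lambda>F. (\<Sum>\<^sub>\<infinity>j. norm (?t j)) - sum (\<lambda>j. norm (?t j)) F =
          (\<Sum>\<^sub>\<infinity>j\<in>-F. norm (?t j))) (finite_subsets_at_top UNIV)"
      proof (rule eventually_finite_subsets_at_top_weakI)
        fix F :: "int set" assume "finite F"
        then show "(\<Sum>\<^sub>\<infinity>j. norm (?t j)) - sum (\<lambda>j. norm (?t j)) F = (\<Sum>\<^sub>\<infinity>j\<in>-F. norm (?t j))"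
          using infsum_Diff[OF sm, of F] by (simp add: Compl_eq_Diff_UNIV)
      qed
      ultimately show ?thesis by (simp add: filterlim_cong)
    qed
    from order_tendstoD(2)[OF this pos] show ?thesis
      by (auto simp: eventually_finite_subsets_at_top intro: that)
  qed
  \<comment> \<open>M exceeds every index in S in absolute value, so each nonzero multiple of M lies
    outside S.\<close>
  obtain M :: nat where M: "M > 0" "\<And>j. j \<in> S \<Longrightarrow> \<bar>j\<bar> < int M"
  proof -
    have "finite ((\<lambda>j. nat \<bar>j\<bar>) ` S)" using S by simp
    then obtain m where "\<And>j. j \<in> S \<Longrightarrow> nat \<bar>j\<bar> \<le> m"
      by (metis finite_nat_set_iff_bounded_le imageI)
    then show ?thesis by (intro that[of "Suc m"]) force+
  qed
  let ?I = "{j. int M dvd j}"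
  note avg = sum_exp_roots_of_unity[OF M(1)]
  have hs: "((\<lambda>j. exp (2 * pi * \<i> * of_int j * of_nat k / of_nat M) * ?t j) has_sum 0) UNIV" for k
  proof -
    have "(theta_term a b \<tau> (of_nat k / of_nat M) has_sum 0) UNIV"
      using has_sum_infsum[OF theta_term_summable[OF assms, of a b "of_nat k / of_nat M"]] 0
      by (simp add: theta_char_eq)
    \<comment> \<open>The prefactor removes the phase due to the characteristic a and leaves the
      pure character \<open>exp (2 * pi * \<i> * j * k / M)\<close>.\<close>
    then have "((\<lambda>j. exp (- 2 * pi * \<i> * a * of_nat k / of_nat M) * theta_term a b \<tau> (of_nat k / of_nat M) j)
        has_sum (exp (- 2 * pi * \<i> * a * of_nat k / of_nat M) * 0)) UNIV"
      by (rule has_sum_cmult_right)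
    moreover have "exp (- 2 * pi * \<i> * a * of_nat k / of_nat M) * theta_term a b \<tau> (of_nat k / of_nat M) j =
       exp (2 * pi * \<i> * of_int j * of_nat k / of_nat M) * ?t j" for j
      unfolding theta_term_def exp_add[symmetric]
      by (rule arg_cong[where f=exp]) (simp add: algebra_simps add_divide_distrib)
    ultimately show ?thesis by simp
  qed
  have "((\<lambda>j. \<Sum>k<L. exp (2 * pi * \<i> * of_int j * of_nat k / of_nat M) * ?t j) has_sum 0) UNIV" for L
  proof (induction L)
    case (Suc m)
    from has_sum_add[OF this hs[of m]] show ?case by (simp add: distrib_right)
  qed simp
  from this[of M] have "((\<lambda>j. (if int M dvd j then of_nat M else 0) * ?t j) has_sum 0) UNIV"
    unfolding sum_distrib_right[symmetric] avg .
  then have "((\<lambda>j. of_nat M * ?t j) has_sum 0) ?I"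
    by (elim has_sum_cong_neutral[THEN iffD1, rotated 3]) auto
  then have "((\<lambda>j. inverse (of_nat M) * (of_nat M * ?t j)) has_sum inverse (of_nat M) * 0) ?I"
    by (rule has_sum_cmult_right)
  then have hs0: "(?t has_sum 0) ?I" using M(1) by (simp flip: mult.assoc)
  have "(?t has_sum (0 - ?t 0)) (?I - {0})"
    using has_sum_Diff[OF hs0, of "{0}"] has_sum_finite[of "{0}" ?t] by auto
  from infsumI[OF this] have "norm (0 - ?t 0) \<le> (\<Sum>\<^sub>\<infinity>j\<in>?I - {0}. norm (?t j))"
    using norm_infsum_bound[OF summable_on_subset_banach[OF sm, of "?I - {0}"]] by simp
  also have "\<dots> \<le> (\<Sum>\<^sub>\<infinity>j\<in>-S. norm (?t j))"
  proof (rule infsum_mono2)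
    show "(\<lambda>j. norm (?t j)) summable_on ?I - {0}" "(\<lambda>j. norm (?t j)) summable_on - S"
      using sm by (auto intro: summable_on_subset_banach)
    show "?I - {0} \<subseteq> -S" using M(2) by (force dest: dvd_imp_le_int)
  qed auto
  finally show False using S(2) by simp
qed

section \<open>Quasi-periodic entire functions\<close>

text \<open>On an open set of zeros the derivative would vanish as well.\<close>

lemma dense_nonzero_of_simple_zeros:
  fixes G :: "complex \<Rightarrow> complex"
  assumes hol: "G holomorphic_on UNIV" and simple: "\<And>v. G v = 0 \<Longrightarrow> deriv G v \<noteq> 0"
  shows "closure {v. G v \<noteq> 0} = UNIV"
proof (rule ccontr)
  assume "closure {v. G v \<noteq> 0} \<noteq> UNIV"
  then have ne: "- closure {v. G v \<noteq> 0} \<noteq> {}" and op: "open (- closure {v. G v \<noteq> 0})" by auto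
  then obtain v where v: "v \<in> - closure {v. G v \<noteq> 0}" by blast
  have z: "G w = 0" if "w \<in> - closure {v. G v \<noteq> 0}" for w
    using that closure_subset[of "{v. G v \<noteq> 0}"] by blast
  have "(G has_field_derivative 0) (at v)"
    by (rule has_field_derivative_transform_within_open[OF DERIV_const op v]) (rule z[symmetric])
  from DERIV_imp_deriv[OF this] show False using simple[OF z[OF v]] by simp
qed

lemma continuous_eq_on_dense:
  fixes A B :: "'a::topological_space \<Rightarrow> 'b::t2_space"
  assumes "continuous_on UNIV A" "continuous_on UNIV B" "closure S = UNIV"
    and "\<And>v. v \<in> S \<Longrightarrow> A v = B v"
  shows "A v = B v"
proof -
  have "closed {v. A v = B v}" by (rule closed_Collect_eq) (use assms in auto)
  then have "closure S \<subseteq> {v. A v = B v}" by (intro closure_minimal) (use assms in auto)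
  with assms show ?thesis by auto
qed

lemma entire_quotient:
  fixes F G :: "complex \<Rightarrow> complex"
  assumes F: "F holomorphic_on UNIV" and G: "G holomorphic_on UNIV"
    and zeros: "\<And>v. G v = 0 \<Longrightarrow> F v = 0" and simple: "\<And>v. G v = 0 \<Longrightarrow> deriv G v \<noteq> 0"
  obtains H where "H holomorphic_on UNIV" "\<And>v. F v = G v * H v"
proof -
  \<comment> \<open>The value at a zero of G is the one given by l'Hopital's rule.\<close>
  define H where "H v = (if G v = 0 then deriv F v / deriv G v else F v / G v)" for v
  have "H analytic_on UNIV"
    unfolding analytic_on_def
  proof
    fix a
    show "\<exists>e>0. H holomorphic_on ball a e"
    proof (cases "G a = 0")
      case False
      have "open {v. G v \<noteq> 0}"
        using open_Collect_neq[OF holomorphic_on_imp_continuous_on[OF G] continuous_on_const, of 0] by simp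
      then obtain e where e: "e > 0" "ball a e \<subseteq> {v. G v \<noteq> 0}"
        using False openE[of "{v. G v \<noteq> 0}" a] by blast
      have "(\<lambda>v. F v / G v) holomorphic_on ball a e"
        using e by (intro holomorphic_intros) (auto intro: holomorphic_on_subset[OF F] holomorphic_on_subset[OF G])
      then have "H holomorphic_on ball a e"
        by (rule holomorphic_transform) (use e in \<open>auto simp: H_def\<close>)
      with e show ?thesis by blast
    next
      case True
      \<comment> \<open>The difference quotients of F and G at a are entire by
        \<open>pole_lemma\<close>, and since both functions vanish at a, their ratio is H near
        a.\<close>
      define F1 where "F1 = (\<lambda>z. if z = a then deriv F a else (F z - F a) / (z - a))"
      define G1 where "G1 = (\<lambda>z. if z = a then deriv G a else (G z - G a) / (z - a))"
      have F1: "F1 holomorphic_on UNIV" and G1: "G1 holomorphic_on UNIV"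
        unfolding F1_def G1_def by (auto intro!: pole_lemma F G)
      have "open {v. G1 v \<noteq> 0}"
        using open_Collect_neq[OF holomorphic_on_imp_continuous_on[OF G1] continuous_on_const, of 0] by simp
      moreover have "G1 a \<noteq> 0" using simple True by (simp add: G1_def)
      ultimately obtain e where e: "e > 0" "ball a e \<subseteq> {v. G1 v \<noteq> 0}"
        using openE[of "{v. G1 v \<noteq> 0}" a] by blast
      have "(\<lambda>v. F1 v / G1 v) holomorphic_on ball a e"
        using e by (intro holomorphic_intros) (auto intro: holomorphic_on_subset[OF F1] holomorphic_on_subset[OF G1])
      moreover have "F1 v / G1 v = H v" if "v \<in> ball a e" for v
      proof -
        from that e have "G1 v \<noteq> 0" by auto
        then show ?thesis using True zeros[OF True] by (auto simp: F1_def G1_def H_def)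
      qed
      ultimately have "H holomorphic_on ball a e" by (rule holomorphic_transform)
      with e show ?thesis by blast
    qed
  qed
  then have "H holomorphic_on UNIV" by (simp add: analytic_imp_holomorphic)
  moreover have "F v = G v * H v" for v using zeros by (auto simp: H_def)
  ultimately show ?thesis by (rule that)
qed

text \<open>Used with the modulus of a function whose multipliers have modulus 1, and with the 0/1
  indicator of the non-zeros of a quasi-periodic function.\<close>

lemma int_quasi_invariant:
  fixes f :: "complex \<Rightarrow> real"
  assumes "\<And>v. f (v + w) = f v"
  shows "f (v + of_int n * w) = f v"
proof (induction n rule: int_induct[where k = 0])
  case (step1 i)
  then show ?case using assms[of "v + of_int i * w"] by (simp add: algebra_simps)
next
  case (step2 i)
  then show ?case using assms[of "v + of_int (i - 1) * w"] by (simp add: algebra_simps)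
qed simp

text \<open>The summand \<open>of_int m * 1\<close> has the shape that
  \<open>int_quasi_invariant\<close> rewrites for the period 1.\<close>

lemma lattice_decomposition:
  assumes "Im \<tau> > 0"
  obtains m n :: int and s t :: real where "v = of_real s + of_real t * \<tau> + of_int m * 1 + of_int n * \<tau>"
    "0 \<le> s" "s \<le> 1" "0 \<le> t" "t \<le> 1"
proof -
  define t where "t = Im v / Im \<tau>"
  define s where "s = Re v - t * Re \<tau>"
  have v: "v = of_real s + of_real t * \<tau>"
    using assms by (simp add: complex_eq_iff s_def t_def)
  show ?thesis
  proof (rule that)
    show "v = of_real (frac s) + of_real (frac t) * \<tau> + of_int \<lfloor>s\<rfloor> * 1 + of_int \<lfloor>t\<rfloor> * \<tau>"
      unfolding frac_def using v by (simp add: algebra_simps)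
  qed (use frac_lt_1[of s] frac_lt_1[of t] in auto)
qed

text \<open>After multiplication by a suitable exponential, both multipliers have modulus 1, so that
  Liouville's theorem applies.\<close>

lemma entire_quasiperiodic:
  assumes \<tau>: "Im \<tau> > 0" and H: "H holomorphic_on UNIV"
    and H1: "\<And>v. H (v + 1) = H v" and H\<tau>: "\<And>v. H (v + \<tau>) = \<beta> * H v" and \<beta>: "\<beta> \<noteq> 0"
  obtains c and k :: int where "\<And>v. H v = c * exp (2 * pi * \<i> * of_int k * v)"
    "c = 0 \<or> \<beta> = exp (2 * pi * \<i> * of_int k * \<tau>)"
proof -
  \<comment> \<open>With \<mu> real, \<open>exp (\<i> * \<mu> * v)\<close> keeps its modulus under v
    + 1, and under v + \<tau> it gains the modulus \<open>exp (- \<mu> * Im \<tau>)\<close>, which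
    is the inverse of that of \<beta>.\<close>
  define \<mu> where "\<mu> = ln (norm \<beta>) / Im \<tau>"
  define K where "K v = exp (\<i> * \<mu> * v) * H v" for v
  have K: "K holomorphic_on UNIV" unfolding K_def by (intro holomorphic_intros H)
  have K1: "norm (K (v + 1)) = norm (K v)" for v
    by (simp add: K_def norm_mult H1 distrib_left exp_add)
  have "norm (exp (\<i> * \<mu> * \<tau>)) * norm \<beta> = 1"
    using \<tau> \<beta> by (simp add: norm_exp_eq_Re \<mu>_def exp_minus)
  then have K\<tau>: "norm (K (v + \<tau>)) = norm (K v)" for v
    by (simp add: K_def norm_mult H\<tau> distrib_left exp_add mult_ac)
  have "bounded (range K)"
  proof -
    let ?P = "(\<lambda>(s::real, t::real). of_real s + of_real t * \<tau>) ` ({0..1} \<times> {0..1})"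
    have "compact ?P"
      unfolding case_prod_beta by (intro compact_continuous_image compact_Times compact_Icc continuous_intros)
    then have "compact (K ` ?P)"
      by (rule compact_continuous_image[rotated]) (auto intro: holomorphic_on_imp_continuous_on holomorphic_on_subset[OF K])
    then obtain B where B: "\<And>x. x \<in> ?P \<Longrightarrow> norm (K x) \<le> B"
      by (meson bounded_iff compact_imp_bounded imageI)
    have "norm (K v) \<le> B" for v
    proof -
      obtain m n :: int and s t :: real
        where st: "v = of_real s + of_real t * \<tau> + of_int m * 1 + of_int n * \<tau>"
          "0 \<le> s" "s \<le> 1" "0 \<le> t" "t \<le> 1"
        using lattice_decomposition[OF \<tau>] by metis
      have "norm (K v) = norm (K (of_real s + of_real t * \<tau>))"
        unfolding st(1) int_quasi_invariant[of "\<lambda>v. norm (K v)", OF K\<tau>]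
          int_quasi_invariant[of "\<lambda>v. norm (K v)", OF K1] ..
      also have "\<dots> \<le> B" by (rule B) (use st in force)
      finally show ?thesis .
    qed
    then show ?thesis by (auto simp: bounded_iff)
  qed
  then have "K constant_on UNIV" by (rule Liouville_theorem[OF K])
  then obtain c where c: "\<And>v. K v = c" by (auto simp: constant_on_def)
  have Hc: "H v = c * exp (- (\<i> * \<mu> * v))" for v
    using c[of v] by (simp add: K_def exp_minus field_simps)
  show ?thesis
  proof (cases "c = 0")
    case True
    then show ?thesis using Hc that[of 0 0] by simp
  next
    case False
    \<comment> \<open>The exact period 1, as opposed to that of the modulus, makes \<mu> an integer
      multiple of 2 pi.\<close>
    have "exp (- (\<i> * \<mu>)) = 1" using H1[of 0] False by (simp add: Hc)
    then obtain n :: int where "- \<mu> = of_int (2 * n) * pi" by (auto simp: exp_eq_1)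
    then have "\<mu> = - (of_int (2 * n) * pi)" by linarith
    then have \<mu>: "\<mu> = 2 * pi * of_int (- n)" by simp
    have *: "- (\<i> * \<mu> * v) = 2 * pi * \<i> * of_int n * v" for v unfolding \<mu> by simp
    show ?thesis
    proof (rule that)
      show "H v = c * exp (2 * pi * \<i> * of_int n * v)" for v unfolding Hc * ..
      have "exp (2 * pi * \<i> * of_int n * \<tau>) = \<beta>"
        using H\<tau>[of 0] False unfolding Hc * by simp
      then show "c = 0 \<or> \<beta> = exp (2 * pi * \<i> * of_int n * \<tau>)" by simp
    qed
  qed
qed

text \<open>The multipliers p and q may depend on v since they cancel in F / G; only the constant
  \<beta> survives. The laws of the quotient are first obtained off the zeros of G and extend by
  density.\<close>

lemma quasiperiodic_ratio:
  assumes \<tau>: "Im \<tau> > 0"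
    and F: "F holomorphic_on UNIV" and G: "G holomorphic_on UNIV"
    and zeros: "\<And>v. G v = 0 \<Longrightarrow> F v = 0" and simple: "\<And>v. G v = 0 \<Longrightarrow> deriv G v \<noteq> 0"
    and F1: "\<And>v. F (v + 1) = p v * F v" and G1: "\<And>v. G (v + 1) = p v * G v"
    and F\<tau>: "\<And>v. F (v + \<tau>) = \<beta> * (q v * F v)" and G\<tau>: "\<And>v. G (v + \<tau>) = q v * G v"
    and nz: "\<And>v. p v \<noteq> 0" "\<And>v. q v \<noteq> 0" "\<beta> \<noteq> 0"
  obtains c and k :: int where "\<And>v. F v = G v * (c * exp (2 * pi * \<i> * of_int k * v))"
    "c = 0 \<or> \<beta> = exp (2 * pi * \<i> * of_int k * \<tau>)"
proof -
  obtain H where H: "H holomorphic_on UNIV" and FH: "\<And>v. F v = G v * H v"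
    using entire_quotient[OF F G zeros simple] by blast
  note dense = dense_nonzero_of_simple_zeros[OF G simple]
  have cont: "continuous_on UNIV (\<lambda>v. H (v + w))" for w
    by (rule continuous_on_compose2[OF holomorphic_on_imp_continuous_on[OF H]]) (auto intro!: continuous_intros)
  have H1: "H (v + 1) = H v" for v
  proof (rule continuous_eq_on_dense[where A = "\<lambda>v. H (v + 1)" and B = H, OF _ _ dense])
    show "continuous_on UNIV (\<lambda>v. H (v + 1))" "continuous_on UNIV H" using cont[of 1] cont[of 0] by auto
    fix v assume "v \<in> {v. G v \<noteq> 0}"
    then show "H (v + 1) = H v" using F1[of v] G1[of v] nz(1)[of v] FH by auto
  qed
  have H\<tau>: "H (v + \<tau>) = \<beta> * H v" for v
  proof (rule continuous_eq_on_dense[where A = "\<lambda>v. H (v + \<tau>)" and B = "\<lambda>v. \<beta> * H v", OF _ _ dense])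
    show "continuous_on UNIV (\<lambda>v. H (v + \<tau>))" "continuous_on UNIV (\<lambda>v. \<beta> * H v)"
      using cont[of \<tau>] cont[of 0] by (auto intro!: continuous_intros)
    fix v assume "v \<in> {v. G v \<noteq> 0}"
    then show "H (v + \<tau>) = \<beta> * H v" using F\<tau>[of v] G\<tau>[of v] nz(2)[of v] FH by auto
  qed
  show ?thesis
  proof (rule entire_quasiperiodic[OF \<tau> H H1 H\<tau> nz(3)])
    fix c and k :: int
    assume "\<And>v. H v = c * exp (2 * pi * \<i> * of_int k * v)"
      and "c = 0 \<or> \<beta> = exp (2 * pi * \<i> * of_int k * \<tau>)"
    then show ?thesis by (intro that[of c k]) (simp_all only: FH)
  qed
qed

section \<open>The zeros of the odd theta function\<close>

text \<open>The q-Pochhammer symbol (qX; q) with infinitely many factors; the exponents start at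
  1.\<close>

definition qprod :: "complex \<Rightarrow> complex \<Rightarrow> complex" where
  "qprod q X = (\<Prod>n. 1 - q ^ Suc n * X)"

context
  fixes q :: complex
  assumes q: "q \<noteq> 0" "norm q < 1"
begin

text \<open>The zeros are the negative powers of q. Their reciprocals form a geometric series, so
  genus 0 suffices, and the theory of Weierstrass products gives convergence, holomorphy and the
  zero set together.\<close>

interpretation wp: weierstrass_product "\<lambda>n. inverse (q ^ Suc n)" "\<lambda>_. 0"
proof
  show "inverse (q ^ Suc n) \<noteq> 0" for n using q by simp
  have "(\<lambda>n. q ^ Suc n) \<longlonglongrightarrow> 0"
    using LIMSEQ_power_zero[OF q(2)] by (rule LIMSEQ_Suc)
  then show "filterlim (\<lambda>n. inverse (q ^ Suc n)) at_infinity sequentially"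
    using q by (intro filterlim_compose[OF filterlim_inverse_at_infinity])
      (auto simp: filterlim_at)
  have "summable (\<lambda>n. r * norm q * norm q ^ n)" for r
    using q by (intro summable_mult summable_geometric) auto
  then show "summable (\<lambda>n. (r / norm (inverse (q ^ Suc n))) ^ Suc 0)" for r
    by (simp add: norm_inverse norm_power norm_mult divide_inverse mult_ac)
qed

lemma qprod_eq_weierstrass: "qprod q = wp.f"
  by (simp add: fun_eq_iff qprod_def wp.f_def weierstrass_factor_def divide_inverse mult_ac del: power_Suc)

lemma qprod_holomorphic: "qprod q holomorphic_on A"
  unfolding qprod_eq_weierstrass by (rule wp.holomorphic)

lemma qprod_eq_0_iff: "qprod q X = 0 \<longleftrightarrow> (\<exists>n. q ^ Suc n * X = 1)"
  unfolding qprod_eq_weierstrass wp.zero using q by (auto simp: image_iff field_simps)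

lemma qprod_rec: "qprod q X = (1 - q * X) * qprod q (q * X)"
proof -
  have c: "convergent_prod (\<lambda>n. 1 - q ^ Suc n * X)"
    using wp.convergent[of X] by (simp add: weierstrass_factor_def divide_inverse mult_ac)
  have "(\<lambda>n. 1 - q ^ Suc n * X) has_prod ((\<Prod>k<1. 1 - q ^ Suc k * X) * (\<Prod>k. 1 - q ^ Suc (k + 1) * X))"
    by (rule has_prod_ignore_initial_segment'[OF c])
  then show ?thesis
    unfolding qprod_def by (simp add: has_prod_iff mult_ac)
qed

end

text \<open>Stated for an abstract F in order to serve both the theta series and Jacobi's
  product.\<close>

lemma theta_multiplier_lattice:
  fixes F :: "complex \<Rightarrow> complex"
  assumes F1: "\<And>v. F (v + 1) = - F v"
    and F\<tau>: "\<And>v. F (v + \<tau>) = - exp (- (pi * \<i> * \<tau>) - 2 * pi * \<i> * v) * F v"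
  shows "F (v + of_int m + of_int n * \<tau>) =
    exp (pi * \<i> * of_int (m + n) - pi * \<i> * \<tau> * of_int n ^ 2 - 2 * pi * \<i> * of_int n * v) * F v"
proof -
  have 1: "F (v + of_int m) = exp (pi * \<i> * of_int m) * F v" for v
  proof (induction m rule: int_induct[where k = 0])
    case (step1 i)
    then show ?case using F1[of "v + of_int i"] by (simp add: algebra_simps exp_add)
  next
    case (step2 i)
    then show ?case using F1[of "v + of_int i - 1"]
      by (simp add: algebra_simps exp_diff)
  qed simp
  \<comment> \<open>The sign of each \<tau>-step is written as \<open>exp (pi * \<i>)\<close>, so
    that n steps give a single exponential; the term in \<open>n ^ 2\<close> is the sum of the
    arithmetic progression of exponents.\<close>
  define E where "E n v = pi * \<i> * of_int n - pi * \<i> * \<tau> * of_int n ^ 2 - 2 * pi * \<i> * of_int n * v" for n :: int and v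
  have step: "F (v + of_int (i + 1) * \<tau>) = exp (E (i + 1) v - E i v) * F (v + of_int i * \<tau>)" for i v
  proof -
    have "- exp (- (pi * \<i> * \<tau>) - 2 * pi * \<i> * (v + of_int i * \<tau>)) = exp (E (i + 1) v - E i v)"
    proof -
      have "E (i + 1) v - E i v = pi * \<i> + (- (pi * \<i> * \<tau>) - 2 * pi * \<i> * (v + of_int i * \<tau>))"
        by (simp add: E_def algebra_simps power2_eq_square)
      then show ?thesis by (simp add: exp_add)
    qed
    then show ?thesis using F\<tau>[of "v + of_int i * \<tau>"] by (simp add: algebra_simps)
  qed
  have 2: "F (v + of_int n * \<tau>) = exp (E n v) * F v" for v
  proof (induction n rule: int_induct[where k = 0])
    case (step1 i)
    then show ?case using step[of v i] by (simp add: exp_diff)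
  next
    case (step2 i)
    then show ?case using step[of v "i - 1"] by (simp add: exp_diff field_simps)
  qed (simp add: E_def)
  have "F (v + of_int m + of_int n * \<tau>) = exp (E n (v + of_int m)) * (exp (pi * \<i> * of_int m) * F v)"
    unfolding 2 1 ..
  \<comment> \<open>Moving v by m changes the exponent by \<open>- 2 * pi * \<i> * n * m\<close>, a
    period of exp.\<close>
  also have "exp (E n (v + of_int m)) = exp (E n v)"
  proof -
    have "E n (v + of_int m) = E n v + 2 * pi * \<i> * of_int (- n * m)" by (simp add: E_def algebra_simps)
    then show ?thesis by (simp only: exp_add exp_2pi_of_int mult_1_right)
  qed
  also have "exp (E n v) * (exp (pi * \<i> * of_int m) * F v) =
      exp (pi * \<i> * of_int (m + n) - pi * \<i> * \<tau> * of_int n ^ 2 - 2 * pi * \<i> * of_int n * v) * F v"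
    by (simp add: E_def exp_add exp_diff algebra_simps)
  finally show ?thesis .
qed

text \<open>Differentiating F(v + w) = E(v) F(v) at the zero v = 0 leaves F'(w) = E(0) F'(0), where
  E is an exponential.\<close>

lemma theta_multiplier_deriv_lattice:
  fixes F :: "complex \<Rightarrow> complex"
  assumes hol: "F holomorphic_on UNIV" and F1: "\<And>v. F (v + 1) = - F v"
    and F\<tau>: "\<And>v. F (v + \<tau>) = - exp (- (pi * \<i> * \<tau>) - 2 * pi * \<i> * v) * F v"
    and 0: "F 0 = 0" "deriv F 0 \<noteq> 0"
  shows "F (of_int m + of_int n * \<tau>) = 0" "deriv F (of_int m + of_int n * \<tau>) \<noteq> 0"
proof -
  let ?w = "of_int m + of_int n * \<tau>"
  define E where "E v = exp (pi * \<i> * of_int (m + n) - pi * \<i> * \<tau> * of_int n ^ 2 - 2 * pi * \<i> * of_int n * v)" for v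
  have E: "F (v + ?w) = E v * F v" for v
    using theta_multiplier_lattice[of F \<tau> v m n, OF F1 F\<tau>] by (simp add: E_def add_ac)
  show "F ?w = 0" using E[of 0] 0 by simp
  have dF: "(F has_field_derivative deriv F v) (at v)" for v
    using holomorphic_derivI[OF hol] by auto
  have "((\<lambda>v. F (v + ?w)) has_field_derivative deriv F ?w) (at 0)"
    using dF[of ?w] DERIV_shift[of F "deriv F ?w" 0 ?w] by simp
  moreover have "((\<lambda>v. E v * F v) has_field_derivative E 0 * deriv F 0) (at 0)"
    unfolding E_def by (auto intro!: derivative_eq_intros dF simp: 0)
  ultimately have "deriv F ?w = E 0 * deriv F 0"
    unfolding E by (rule DERIV_unique)
  then show "deriv F ?w \<noteq> 0" using 0 by (simp add: E_def)
qed

lemma vtheta_holomorphic_UNIV: "Im \<tau> > 0 \<Longrightarrow> vtheta \<tau> holomorphic_on UNIV"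
  using theta_char_holomorphic_UNIV[of \<tau> "1/2" "1/2"] by (simp add: vtheta_def[abs_def])

lemma vtheta_add_1: "vtheta \<tau> (v + 1) = - vtheta \<tau> v"
  using theta_char_add_int[of "1/2" "1/2" v 1 \<tau>] by (simp add: vtheta_def)

lemma vtheta_add_tau: "vtheta \<tau> (v + \<tau>) = - exp (- (pi * \<i> * \<tau>) - 2 * pi * \<i> * v) * vtheta \<tau> v"
proof -
  have "vtheta \<tau> (v + \<tau>) =
      exp (- (pi * \<i> * \<tau>) - 2 * pi * \<i> * (v + 1/2)) * theta_char (1/2 + of_int 1) (1/2) v \<tau>"
    unfolding vtheta_def using theta_char_add_tau[of "1/2" "1/2" v 1 \<tau>] by simp
  also have "exp (- (pi * \<i> * \<tau>) - 2 * pi * \<i> * (v + 1/2)) =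
      - exp (- (pi * \<i> * \<tau>) - 2 * pi * \<i> * v)"
    by (simp add: algebra_simps exp_diff exp_add)
  finally show ?thesis unfolding theta_char_a_add_int by (simp add: vtheta_def)
qed

lemma vtheta_0 [simp]: "vtheta \<tau> 0 = 0"
  using vtheta_minus[of \<tau> 0] by simp

lemma vtheta_lattice_shift:
  "vtheta \<tau> (v + of_int m + of_int n * \<tau>) =
    exp (pi * \<i> * of_int (m + n) - pi * \<i> * \<tau> * of_int n ^ 2 - 2 * pi * \<i> * of_int n * v) * vtheta \<tau> v"
  by (rule theta_multiplier_lattice[OF vtheta_add_1 vtheta_add_tau])

lemma vtheta_lattice [simp]: "vtheta \<tau> (of_int m + of_int n * \<tau>) = 0"
  using vtheta_lattice_shift[of \<tau> 0 m n] by simp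

text \<open>Jacobi's triple product up to a factor independent of v, with q =
  \<open>exp (2 * pi * \<i> * \<tau>)\<close>. The first factor is 2i sin(pi v).\<close>

definition theta_prod :: "complex \<Rightarrow> complex \<Rightarrow> complex" where
  "theta_prod \<tau> v = (exp (pi * \<i> * v) - exp (- (pi * \<i> * v))) *
     (qprod (exp (2 * pi * \<i> * \<tau>)) (exp (2 * pi * \<i> * v)) *
      qprod (exp (2 * pi * \<i> * \<tau>)) (exp (- (2 * pi * \<i> * v))))"

context
  fixes \<tau> :: complex
  assumes \<tau>: "Im \<tau> > 0"
begin

lemma nome: "exp (2 * pi * \<i> * \<tau>) \<noteq> 0" "norm (exp (2 * pi * \<i> * \<tau>)) < 1"
  using \<tau> by (auto simp: norm_exp_eq_Re)

lemma theta_prod_holomorphic: "theta_prod \<tau> holomorphic_on UNIV"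
proof -
  have h: "(\<lambda>v. qprod (exp (2 * pi * \<i> * \<tau>)) (g v)) holomorphic_on UNIV" if "g holomorphic_on UNIV" for g
    using holomorphic_on_compose_gen[OF that qprod_holomorphic[OF nome, of UNIV]] by (auto simp: o_def)
  show ?thesis unfolding theta_prod_def[abs_def] by (intro holomorphic_intros h)
qed

lemma theta_prod_add_1: "theta_prod \<tau> (v + 1) = - theta_prod \<tau> v"
proof -
  have "exp (2 * pi * \<i> * (v + 1)) = exp (2 * pi * \<i> * v)"
      "exp (- (2 * pi * \<i> * (v + 1))) = exp (- (2 * pi * \<i> * v))"
      "exp (pi * \<i> * (v + 1)) = - exp (pi * \<i> * v)" "exp (- (pi * \<i> * (v + 1))) = - exp (- (pi * \<i> * v))"
    by (simp_all add: distrib_left exp_add exp_minus exp_diff)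
  then show ?thesis unfolding theta_prod_def by (simp only:) (simp add: algebra_simps)
qed

text \<open>The shift multiplies X = \<open>exp (2 * pi * \<i> * v)\<close> by q. Thus one infinite
  product loses its first factor, the other gains one, and together with the sine factor they yield
  the multiplier.\<close>

lemma theta_prod_add_tau:
  "theta_prod \<tau> (v + \<tau>) = - exp (- (pi * \<i> * \<tau>) - 2 * pi * \<i> * v) * theta_prod \<tau> v"
proof -
  define q where "q = exp (2 * pi * \<i> * \<tau>)"
  define r where "r = exp (pi * \<i> * \<tau>)"
  define X where "X = exp (2 * pi * \<i> * v)"
  define Y where "Y = exp (pi * \<i> * v)"
  have Y: "X = Y * Y" "q = r * r" "Y \<noteq> 0" "r \<noteq> 0"
    unfolding X_def Y_def q_def r_def exp_add[symmetric]
    by (auto intro!: arg_cong[where f = exp])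
  have e: "exp (2 * pi * \<i> * (v + \<tau>)) = q * X" "exp (- (2 * pi * \<i> * (v + \<tau>))) = inverse (q * X)"
     "exp (pi * \<i> * (v + \<tau>)) = r * Y" "exp (- (pi * \<i> * (v + \<tau>))) = inverse (r * Y)"
     "exp (- (2 * pi * \<i> * v)) = inverse X" "exp (- (pi * \<i> * v)) = inverse Y"
     "exp (- (pi * \<i> * \<tau>) - 2 * pi * \<i> * v) = inverse (r * X)"
    unfolding q_def r_def X_def Y_def exp_add[symmetric] exp_minus[symmetric]
    by (auto intro!: arg_cong[where f = exp] simp: algebra_simps)
  have qX: "qprod q X = (1 - q * X) * qprod q (q * X)"
    unfolding q_def by (rule qprod_rec[OF nome])
  have "qprod q (inverse (q * X)) = (1 - q * inverse (q * X)) * qprod q (q * inverse (q * X))"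
    unfolding q_def by (rule qprod_rec[OF nome])
  also have "q * inverse (q * X) = inverse X" by (simp add: q_def field_simps)
  finally have qiX: "qprod q (inverse (q * X)) = (1 - inverse X) * qprod q (inverse X)" .
  have "theta_prod \<tau> (v + \<tau>) = (r * Y - inverse (r * Y)) * (qprod q (q * X) * ((1 - inverse X) * qprod q (inverse X)))"
    unfolding theta_prod_def e q_def[symmetric] qiX ..
  also have "\<dots> = - inverse (r * X) * ((Y - inverse Y) * (((1 - q * X) * qprod q (q * X)) * qprod q (inverse X)))"
  proof -
    \<comment> \<open>Naming the inverses turns the claim into a polynomial consequence of
      \<open>Y * y = 1\<close> and \<open>r * s = 1\<close>.\<close>
    define y where "y = inverse Y"
    define s where "s = inverse r"
    have "Y * y = 1" "r * s = 1" using Y(3,4) by (simp_all add: y_def s_def)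
    then have "(r * Y - s * y) * (1 - y * y) = - (s * (y * y)) * ((Y - y) * (1 - r * r * (Y * Y)))"
      by algebra
    then have *: "(r * Y - inverse (r * Y)) * (1 - inverse X) = - inverse (r * X) * ((Y - inverse Y) * (1 - q * X))"
      unfolding Y(1,2) inverse_mult_distrib y_def s_def .
    have "(r * Y - inverse (r * Y)) * (a * ((1 - inverse X) * b)) =
        - inverse (r * X) * ((Y - inverse Y) * (((1 - q * X) * a) * b))" for a b
      using arg_cong[OF *, of "\<lambda>t. t * (a * b)"] by (simp only: mult_ac)
    then show ?thesis .
  qed
  also have "\<dots> = - exp (- (pi * \<i> * \<tau>) - 2 * pi * \<i> * v) * theta_prod \<tau> v"
    unfolding theta_prod_def e q_def[symmetric] X_def[symmetric] Y_def[symmetric] qX ..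
  finally show ?thesis .
qed

text \<open>The sine factor accounts for the lattice points with n = 0, the two infinite products
  for those with n < 0 and n > 0.\<close>

lemma theta_prod_zeros:
  assumes "theta_prod \<tau> v = 0"
  obtains m n :: int where "v = of_int m + of_int n * \<tau>"
proof -
  have ex: "\<exists>m n :: int. v = of_int m + of_int n * \<tau>" if "exp (2 * pi * \<i> * (v - of_int n * \<tau>)) = 1" for n :: int
  proof -
    let ?w = "2 * pi * \<i> * (v - of_int n * \<tau>)"
    from that obtain m :: int where "Re ?w = 0" "Im ?w = of_int (2 * m) * pi"
      unfolding exp_eq_1 by blast
    then have "?w = of_int (2 * m) * pi * \<i>" by (subst complex_eq_iff) simp
    then have "2 * pi * \<i> * (v - (of_int m + of_int n * \<tau>)) = 0" by (simp add: algebra_simps)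
    then have "v = of_int m + of_int n * \<tau>" by simp
    then show ?thesis by blast
  qed
  consider "exp (pi * \<i> * v) = exp (- (pi * \<i> * v))"
    | n where "exp (2 * pi * \<i> * \<tau>) ^ Suc n * exp (2 * pi * \<i> * v) = 1"
    | n where "exp (2 * pi * \<i> * \<tau>) ^ Suc n * exp (- (2 * pi * \<i> * v)) = 1"
    using assms unfolding theta_prod_def mult_eq_0_iff qprod_eq_0_iff[OF nome] right_minus_eq by blast
  then show ?thesis
  proof cases
    case 1
    then have "exp (2 * pi * \<i> * (v - of_int 0 * \<tau>)) = 1"
      by (simp add: exp_minus field_simps flip: exp_add)
    from ex[OF this] that show ?thesis by blast
  next
    case (2 n)
    then have "exp (2 * pi * \<i> * (v - of_int (- int (Suc n)) * \<tau>)) = 1"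
      by (simp add: algebra_simps flip: exp_add exp_of_nat_mult)
    from ex[OF this] that show ?thesis by blast
  next
    case (3 n)
    then have "inverse (exp (2 * pi * \<i> * (v - of_int (int (Suc n)) * \<tau>))) = 1"
      by (simp add: algebra_simps flip: exp_minus exp_add exp_of_nat_mult)
    then have "exp (2 * pi * \<i> * (v - of_int (int (Suc n)) * \<tau>)) = 1" by simp
    from ex[OF this] that show ?thesis by blast
  qed
qed

text \<open>Only the sine factor vanishes at 0: both infinite products take the value
  \<open>qprod q 1\<close> there, which is nonzero because all powers of q have modulus below
  1.\<close>

lemma theta_prod_deriv_0: "theta_prod \<tau> 0 = 0" "deriv (theta_prod \<tau>) 0 \<noteq> 0"
proof -
  show "theta_prod \<tau> 0 = 0" by (simp add: theta_prod_def)
  let ?q = "exp (2 * pi * \<i> * \<tau>)"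
  define B where "B v = qprod ?q (exp (2 * pi * \<i> * v)) * qprod ?q (exp (- (2 * pi * \<i> * v)))" for v
  have "qprod ?q 1 \<noteq> 0"
  proof -
    have "norm (?q ^ Suc n * 1) < 1" for n
      using nome(2) power_Suc_less_one[of "norm ?q" n] by (simp add: norm_power norm_mult)
    then have "?q ^ Suc n * 1 \<noteq> 1" for n by (metis norm_one less_irrefl)
    then show ?thesis unfolding qprod_eq_0_iff[OF nome] by blast
  qed
  then have B0: "B 0 \<noteq> 0" by (simp add: B_def)
  have h: "(\<lambda>v. qprod ?q (g v)) holomorphic_on UNIV" if "g holomorphic_on UNIV" for g
    using holomorphic_on_compose_gen[OF that qprod_holomorphic[OF nome, of UNIV]] by (auto simp: o_def)
  have "B holomorphic_on UNIV" unfolding B_def[abs_def] by (intro holomorphic_intros h)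
  then have dB: "(B has_field_derivative deriv B 0) (at 0)"
    using holomorphic_derivI[of B UNIV 0] by auto
  have "((\<lambda>v. (exp (pi * \<i> * v) - exp (- (pi * \<i> * v))) * B v) has_field_derivative 2 * pi * \<i> * B 0) (at 0)"
    by (auto intro!: derivative_eq_intros dB)
  then have "(theta_prod \<tau> has_field_derivative 2 * pi * \<i> * B 0) (at 0)"
    by (simp add: theta_prod_def[abs_def] B_def)
  then show "deriv (theta_prod \<tau>) 0 \<noteq> 0" using B0 by (simp add: DERIV_imp_deriv)
qed

text \<open>No Fourier coefficients of the product are compared. The multipliers agree, so \<beta> =
  1, and the zeros of the product are lattice points, where the theta series vanishes by oddness and
  quasi-periodicity.\<close>

lemma vtheta_eq_theta_prod:
  obtains c where "c \<noteq> 0" "\<And>v. vtheta \<tau> v = c * theta_prod \<tau> v"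
proof -
  have z: "vtheta \<tau> v = 0 \<and> deriv (theta_prod \<tau>) v \<noteq> 0" if "theta_prod \<tau> v = 0" for v
    using theta_prod_zeros[OF that] theta_multiplier_deriv_lattice(2)[OF theta_prod_holomorphic
      theta_prod_add_1 theta_prod_add_tau theta_prod_deriv_0] vtheta_lattice by metis
  obtain c and k :: int where c: "\<And>v. vtheta \<tau> v = theta_prod \<tau> v * (c * exp (2 * pi * \<i> * of_int k * v))"
    and k: "c = 0 \<or> 1 = exp (2 * pi * \<i> * of_int k * \<tau>)"
  proof (rule quasiperiodic_ratio[OF \<tau> vtheta_holomorphic_UNIV[OF \<tau>] theta_prod_holomorphic])
    show "vtheta \<tau> (v + 1) = (\<lambda>_. - 1) v * vtheta \<tau> v"
      "theta_prod \<tau> (v + 1) = (\<lambda>_. - 1) v * theta_prod \<tau> v" for v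
      by (simp_all add: vtheta_add_1 theta_prod_add_1)
    show "vtheta \<tau> (v + \<tau>) = 1 * ((\<lambda>v. - exp (- (pi * \<i> * \<tau>) - 2 * pi * \<i> * v)) v * vtheta \<tau> v)"
      "theta_prod \<tau> (v + \<tau>) = (\<lambda>v. - exp (- (pi * \<i> * \<tau>) - 2 * pi * \<i> * v)) v * theta_prod \<tau> v" for v
      by (simp_all add: vtheta_add_tau theta_prod_add_tau)
  qed (use z in auto)
  have c0: "c \<noteq> 0"
    using theta_char_not_identically_0[OF \<tau>, of "1/2" "1/2"] c unfolding vtheta_def by force
  \<comment> \<open>The remaining exponential must have \<tau>-multiplier 1; the modulus of that
    multiplier already forces k = 0.\<close>
  then have "norm (exp (2 * pi * \<i> * of_int k * \<tau>)) = 1" using k by simp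
  then have "of_int k * Im \<tau> = 0" by (simp add: norm_exp_eq_Re)
  then have "k = 0" using \<tau> by simp
  then show ?thesis using c0 c that[of c] by (simp add: mult_ac)
qed

lemma vtheta_eq_0_iff: "vtheta \<tau> v = 0 \<longleftrightarrow> (\<exists>m n :: int. v = of_int m + of_int n * \<tau>)"
proof -
  obtain c where "c \<noteq> 0" "\<And>v. vtheta \<tau> v = c * theta_prod \<tau> v"
    using vtheta_eq_theta_prod by blast
  then show ?thesis using theta_prod_zeros vtheta_lattice by (metis mult_eq_0_iff)
qed

lemma deriv_vtheta_0: "deriv (vtheta \<tau>) 0 \<noteq> 0"
proof -
  obtain c where c: "c \<noteq> 0" "\<And>v. vtheta \<tau> v = c * theta_prod \<tau> v"
    using vtheta_eq_theta_prod by blast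
  then have "vtheta \<tau> = (\<lambda>v. c * theta_prod \<tau> v)" by auto
  moreover have "theta_prod \<tau> field_differentiable at 0"
    using holomorphic_on_imp_differentiable_at[OF theta_prod_holomorphic] by auto
  ultimately show ?thesis using c theta_prod_deriv_0 by (simp add: deriv_cmult)
qed

lemma vtheta_simple_zeros: "vtheta \<tau> v = 0 \<Longrightarrow> deriv (vtheta \<tau>) v \<noteq> 0"
  using theta_multiplier_deriv_lattice(2)[OF vtheta_holomorphic_UNIV[OF \<tau>] vtheta_add_1 vtheta_add_tau
      vtheta_0 deriv_vtheta_0] unfolding vtheta_eq_0_iff by blast

end

section \<open>Interpolation by theta functions\<close>

lemma vtheta_holomorphic_compose:
  assumes "Im \<tau> > 0" "g holomorphic_on A"
  shows "(\<lambda>v. vtheta \<tau> (g v)) holomorphic_on A"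
  using holomorphic_on_compose_gen[OF assms(2) vtheta_holomorphic_UNIV[OF assms(1)]] by (auto simp: o_def)

text \<open>Refutes the nonzero alternative left by \<open>quasiperiodic_ratio\<close>: a quotient
  with constant multiplier \<open>exp (2 * pi * \<i> * h)\<close> would place h in the
  lattice.\<close>

lemma vtheta_eq_0_of_exp_eq:
  assumes "exp (2 * pi * \<i> * h) = exp (2 * pi * \<i> * of_int k * \<tau>)"
  shows "vtheta \<tau> h = 0"
proof -
  obtain m :: int where "2 * pi * \<i> * h = 2 * pi * \<i> * of_int k * \<tau> + of_int (2 * m) * pi * \<i>"
    using assms unfolding exp_eq by blast
  then have "2 * pi * \<i> * (h - (of_int m + of_int k * \<tau>)) = 0" by (simp add: algebra_simps)
  then have "h = of_int m + of_int k * \<tau>" by simp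
  then show ?thesis using vtheta_lattice by metis
qed

lemma quasi_zero_lattice:
  fixes F :: "complex \<Rightarrow> complex"
  assumes "\<And>v. F (v + 1) = p v * F v" "\<And>v. F (v + \<tau>) = q v * F v"
    and "\<And>v. p v \<noteq> 0" "\<And>v. q v \<noteq> 0" and "F u = 0"
  shows "F (u + of_int m + of_int n * \<tau>) = 0"
proof -
  define f :: "complex \<Rightarrow> real" where "f v = (if F v = 0 then 0 else 1)" for v
  have "f (v + 1) = f v" "f (v + \<tau>) = f v" for v using assms by (auto simp: f_def)
  then have "f (v + of_int m * 1) = f v" "f (v + of_int n * \<tau>) = f v" for v
    by (intro int_quasi_invariant; blast)+
  then have "f (u + of_int m + of_int n * \<tau>) = f u" by simp
  with assms(5) show ?thesis by (auto simp: f_def split: if_splits)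
qed

lemma prod_vtheta_add_1:
  fixes w :: "'n::finite \<Rightarrow> complex"
  shows "(\<Prod>m\<in>UNIV. vtheta \<tau> (v + 1 - w m)) = (-1) ^ CARD('n) * (\<Prod>m\<in>UNIV. vtheta \<tau> (v - w m))"
proof -
  have "vtheta \<tau> (v + 1 - w m) = (-1) * vtheta \<tau> (v - w m)" for m
    using vtheta_add_1[of \<tau> "v - w m"] by (simp add: algebra_simps)
  then show ?thesis by (simp only: prod.distrib prod_constant)
qed

lemma prod_vtheta_add_tau:
  fixes w :: "'n::finite \<Rightarrow> complex"
  shows "(\<Prod>m\<in>UNIV. vtheta \<tau> (v + \<tau> - w m)) =
    ((-1) ^ CARD('n) * exp (of_nat CARD('n) * - (pi * \<i> * \<tau> + 2 * pi * \<i> * v) + 2 * pi * \<i> * (\<Sum>m\<in>UNIV. w m))) *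
      (\<Prod>m\<in>UNIV. vtheta \<tau> (v - w m))"
proof -
  have "vtheta \<tau> (v + \<tau> - w m) =
      (-1) * (exp (- (pi * \<i> * \<tau> + 2 * pi * \<i> * v) + 2 * pi * \<i> * w m) * vtheta \<tau> (v - w m))" for m
    using vtheta_add_tau[of \<tau> "v - w m"] by (simp add: algebra_simps)
  moreover have "(\<Prod>m\<in>UNIV. exp (- (pi * \<i> * \<tau> + 2 * pi * \<i> * v) + 2 * pi * \<i> * w m)) =
      exp (of_nat CARD('n) * - (pi * \<i> * \<tau> + 2 * pi * \<i> * v) + 2 * pi * \<i> * (\<Sum>m\<in>UNIV. w m))"
    unfolding exp_sum[OF finite, symmetric] sum.distrib sum_distrib_left[symmetric] sum_constant ..
  ultimately show ?thesis by (simp only: prod.distrib prod_constant mult_ac)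
qed

text \<open>The nodes are pairwise inequivalent modulo the lattice, so exactly one factor vanishes
  at v, and it does so simply.\<close>

lemma prod_vtheta_simple_zeros:
  fixes u :: "'n::finite \<Rightarrow> complex"
  assumes \<tau>: "Im \<tau> > 0" and u: "\<And>i j. i \<noteq> j \<Longrightarrow> vtheta \<tau> (u i - u j) \<noteq> 0"
    and 0: "(\<Prod>m\<in>UNIV. vtheta \<tau> (v - u m)) = 0"
  shows "deriv (\<lambda>v. \<Prod>m\<in>UNIV. vtheta \<tau> (v - u m)) v \<noteq> 0"
proof -
  obtain m where m: "vtheta \<tau> (v - u m) = 0" using 0 by auto
  define R where "R v = (\<Prod>k\<in>UNIV - {m}. vtheta \<tau> (v - u k))" for v
  have R: "R v \<noteq> 0"
  proof
    assume "R v = 0"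
    then obtain k where k: "k \<noteq> m" "vtheta \<tau> (v - u k) = 0" by (auto simp: R_def)
    then obtain a b c d :: int where "v - u m = of_int a + of_int b * \<tau>" "v - u k = of_int c + of_int d * \<tau>"
      using m unfolding vtheta_eq_0_iff[OF \<tau>] by blast
    then have "u m - u k = of_int (c - a) + of_int (d - b) * \<tau>" by (simp add: algebra_simps)
    then show False using u[of m k] k vtheta_lattice by metis
  qed
  have "R holomorphic_on UNIV"
    unfolding R_def[abs_def] by (intro holomorphic_intros vtheta_holomorphic_compose \<tau>)
  then have dR: "(R has_field_derivative deriv R v) (at v)" using holomorphic_derivI[of R UNIV v] by auto
  have "(vtheta \<tau> has_field_derivative deriv (vtheta \<tau>) (v - u m)) (at (v - u m))"
    using holomorphic_derivI[OF vtheta_holomorphic_UNIV[OF \<tau>]] by auto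
  then have "((\<lambda>v. vtheta \<tau> (v - u m)) has_field_derivative deriv (vtheta \<tau>) (v - u m)) (at v)"
    using DERIV_shift[of "vtheta \<tau>" "deriv (vtheta \<tau>) (v - u m)" v "- u m"] by simp
  from DERIV_mult[OF this dR]
  have "((\<lambda>v. vtheta \<tau> (v - u m) * R v) has_field_derivative deriv (vtheta \<tau>) (v - u m) * R v) (at v)"
    by (simp add: m)
  moreover have "(\<lambda>v. vtheta \<tau> (v - u m) * R v) = (\<lambda>v. \<Prod>m\<in>UNIV. vtheta \<tau> (v - u m))"
    by (simp add: fun_eq_iff R_def prod.remove[of UNIV m])
  ultimately show ?thesis
    using R vtheta_simple_zeros[OF \<tau> m] by (simp add: DERIV_imp_deriv)
qed

text \<open>The multipliers of f are those of a product of N odd theta functions with zeros summing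
  to the sum of the nodes minus z. The error of interpolation vanishes at all nodes, so its quotient
  by the product over the nodes is entire, and its multiplier
  \<open>exp (- (2 * pi * \<i> * z))\<close> forces it to be zero.\<close>

theorem theta_lagrange_interpolation:
  fixes u :: "'n::finite \<Rightarrow> complex"
  assumes \<tau>: "Im \<tau> > 0" and u: "\<And>i j. i \<noteq> j \<Longrightarrow> vtheta \<tau> (u i - u j) \<noteq> 0"
    and z: "vtheta \<tau> z \<noteq> 0" and f: "f holomorphic_on UNIV"
    and f1: "\<And>v. f (v + 1) = (-1) ^ CARD('n) * f v"
    and f\<tau>: "\<And>v. f (v + \<tau>) = (-1) ^ CARD('n) *
       exp (of_nat CARD('n) * - (pi * \<i> * \<tau> + 2 * pi * \<i> * v) + 2 * pi * \<i> * ((\<Sum>m\<in>UNIV. u m) - z)) * f v"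
  shows "f v = (\<Sum>i\<in>UNIV. f (u i) * (vtheta \<tau> (v - u i + z) * (\<Prod>m\<in>UNIV - {i}. vtheta \<tau> (v - u m))) /
      (vtheta \<tau> z * (\<Prod>m\<in>UNIV - {i}. vtheta \<tau> (u i - u m))))"
proof -
  \<comment> \<open>The i-th basis function has zeros at the nodes with \<open>u i\<close> replaced
    by \<open>u i - z\<close>, which gives the sum of zeros prescribed by the multipliers of
    f.\<close>
  define w where "w i m = u m - (if m = i then z else 0)" for i m
  define L where "L i v = (\<Prod>m\<in>UNIV. vtheta \<tau> (v - w i m))" for i v
  define D where "D i = vtheta \<tau> z * (\<Prod>m\<in>UNIV - {i}. vtheta \<tau> (u i - u m))" for i
  define F where "F v = f v - (\<Sum>i\<in>UNIV. f (u i) / D i * L i v)" for v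
  define G where "G v = (\<Prod>m\<in>UNIV. vtheta \<tau> (v - u m))" for v
  define q where "q v = (-1) ^ CARD('n) *
     exp (of_nat CARD('n) * - (pi * \<i> * \<tau> + 2 * pi * \<i> * v) + 2 * pi * \<i> * (\<Sum>m\<in>UNIV. u m))" for v
  have L: "L i v = vtheta \<tau> (v - u i + z) * (\<Prod>m\<in>UNIV - {i}. vtheta \<tau> (v - u m))" for i v
    unfolding L_def by (subst prod.remove[of UNIV i]) (auto simp: w_def algebra_simps intro!: prod.cong)
  have sw: "(\<Sum>m\<in>UNIV. w i m) = (\<Sum>m\<in>UNIV. u m) - z" for i
    by (simp add: w_def sum_subtractf)
  have D: "D i \<noteq> 0" for i using u z by (auto simp: D_def)
  have Fu: "F (u k) = 0" for k
  proof -
    have "L i (u k) = (if i = k then D k else 0)" for i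
    proof (cases "i = k")
      case False
      then have "(\<Prod>m\<in>UNIV - {i}. vtheta \<tau> (u k - u m)) = 0"
        by (intro prod_zero) (auto intro!: bexI[of _ k])
      with False show ?thesis unfolding L by simp
    qed (simp add: L D_def)
    then have "(\<Sum>i\<in>UNIV. f (u i) / D i * L i (u k)) = (\<Sum>i\<in>UNIV. if i = k then f (u i) else 0)"
      using D by (intro sum.cong) auto
    then show ?thesis by (simp add: F_def)
  qed
  have qz: "(-1) ^ CARD('n) * exp (of_nat CARD('n) * - (pi * \<i> * \<tau> + 2 * pi * \<i> * v)
      + 2 * pi * \<i> * ((\<Sum>m\<in>UNIV. u m) - z)) = exp (- (2 * pi * \<i> * z)) * q v" for v
    unfolding q_def mult.left_commute[of "exp (- (2 * pi * \<i> * z))"] exp_add[symmetric]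
    by (simp add: algebra_simps)
  have F1: "F (v + 1) = (\<lambda>_. (-1) ^ CARD('n)) v * F v" for v
    unfolding F_def L_def f1 prod_vtheta_add_1 by (simp add: algebra_simps sum_distrib_left)
  have F\<tau>: "F (v + \<tau>) = exp (- (2 * pi * \<i> * z)) * (q v * F v)" for v
    unfolding F_def L_def f\<tau> prod_vtheta_add_tau sw qz by (simp add: algebra_simps sum_distrib_left)
  have G1: "G (v + 1) = (\<lambda>_. (-1) ^ CARD('n)) v * G v" for v
    unfolding G_def prod_vtheta_add_1 ..
  have G\<tau>: "G (v + \<tau>) = q v * G v" for v
    unfolding G_def prod_vtheta_add_tau q_def ..
  have F: "F holomorphic_on UNIV" and G: "G holomorphic_on UNIV"
    unfolding F_def[abs_def] G_def[abs_def] L_def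
    by (intro holomorphic_intros vtheta_holomorphic_compose \<tau> f)+
  have q: "q v \<noteq> 0" for v by (simp add: q_def)
  have zero: "F v = 0" if Gv: "G v = 0" for v
  proof -
    obtain k where "vtheta \<tau> (v - u k) = 0" using Gv by (auto simp: G_def)
    then obtain m n :: int where "v - u k = of_int m + of_int n * \<tau>"
      unfolding vtheta_eq_0_iff[OF \<tau>] by blast
    then have "v = u k + of_int m + of_int n * \<tau>" by (simp add: algebra_simps)
    moreover have "F (u k + of_int m + of_int n * \<tau>) = 0"
      by (rule quasi_zero_lattice[where F = F and p = "\<lambda>_. (-1) ^ CARD('n)"
            and q = "\<lambda>v. exp (- (2 * pi * \<i> * z)) * q v"])
         (simp_all add: F1 F\<tau> q Fu)
    ultimately show ?thesis by simp
  qed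
  obtain c and k :: int where c: "\<And>v. F v = G v * (c * exp (2 * pi * \<i> * of_int k * v))"
    and k: "c = 0 \<or> exp (- (2 * pi * \<i> * z)) = exp (2 * pi * \<i> * of_int k * \<tau>)"
  proof (rule quasiperiodic_ratio[OF \<tau> F G zero _ F1 G1 F\<tau> G\<tau>])
    show "deriv G v \<noteq> 0" if "G v = 0" for v
      using prod_vtheta_simple_zeros[where u = u and v = v, OF \<tau> u] that unfolding G_def[abs_def] by blast
  qed (use q in auto)
  have "c = 0"
  proof (rule ccontr)
    assume "c \<noteq> 0"
    with k have "exp (2 * pi * \<i> * (- z)) = exp (2 * pi * \<i> * of_int k * \<tau>)" by simp
    from vtheta_eq_0_of_exp_eq[OF this] z show False by (simp add: vtheta_minus)
  qed
  then have "F v = 0" using c by simp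
  then show ?thesis by (simp add: F_def L D_def)
qed

section \<open>The vertex-IRF correspondence in components\<close>

text \<open>The numerators of the entries of g. The label is an integer, taken modulo N by
  \<open>btheta_period\<close>, because \<tau>-shifts and powers of \<open>Lambda_mat\<close> move
  it out of the range 1..N.\<close>

definition btheta :: "nat \<Rightarrow> complex \<Rightarrow> int \<Rightarrow> complex \<Rightarrow> complex" where
  "btheta N \<tau> i x = theta_char (1/2 - of_int i / of_nat N) (of_nat N / 2) x (of_nat N * \<tau>)"

text \<open>\<open>belavin_sum\<close> is \<open>N \<vartheta>(z) / \<vartheta>'(0)\<close> times a component of \<open>R\<^sup>B(h, z)\<close> applied to \<open>\<theta>(x) \<otimes> \<theta>(y)\<close>.\<close>

definition belavin_sum :: "complex \<Rightarrow> nat \<Rightarrow> complex \<Rightarrow> int \<Rightarrow> int \<Rightarrow> complex \<Rightarrow> complex \<Rightarrow> complex \<Rightarrow> complex" where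
  "belavin_sum \<tau> N h i j z x y = (\<Sum>a2 = 0..<int N. \<Sum>a1 = 0..<int N.
     exp (2 * pi * \<i> * of_int a2 * z / of_nat N) *
     (vtheta \<tau> (z + (h + of_int a1 + of_int a2 * \<tau>) / of_nat N) / vtheta \<tau> ((h + of_int a1 + of_int a2 * \<tau>) / of_nat N)) *
     (exp (2 * pi * \<i> * of_int (a1 * a2 + a1 * (i - j)) / of_nat N) *
      (btheta N \<tau> (i + a2) x * btheta N \<tau> (j - a2) y)))"

lemma exp_mult_exp_mult: "(exp a * x) * (exp b * y) = exp (a + b) * (x * y)" for x :: complex
  by (simp add: exp_add)

lemma sum_exp_roots_of_unity_int:
  assumes "N > 0"
  shows "(\<Sum>a = 0..<int N. exp (2 * pi * \<i> * of_int a * of_int j / of_nat N)) = (if int N dvd j then of_nat N else 0)"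
proof -
  have "(\<Sum>a = 0..<int N. exp (2 * pi * \<i> * of_int a * of_int j / of_nat N)) =
     (\<Sum>k<N. exp (2 * pi * \<i> * of_int j * of_nat k / of_nat N))"
    by (rule sum.reindex_bij_witness[of _ int nat]) (auto simp: mult_ac)
  then show ?thesis using sum_exp_roots_of_unity[OF assms, of j] by simp
qed

context
  fixes \<tau> :: complex and N :: nat
  assumes \<tau>: "Im \<tau> > 0" and N: "N > 0"
begin

lemma btheta_holomorphic: "btheta N \<tau> i holomorphic_on UNIV"
  unfolding btheta_def[abs_def] by (rule theta_char_holomorphic_UNIV) (use \<tau> N in simp)

lemma btheta_holomorphic_compose: "g holomorphic_on A \<Longrightarrow> (\<lambda>v. btheta N \<tau> i (g v)) holomorphic_on A"
  using holomorphic_on_compose_gen[OF _ btheta_holomorphic] by (auto simp: o_def)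

lemma btheta_add_int:
  "btheta N \<tau> i (x + of_int m) = exp (2 * pi * \<i> * (1/2 - of_int i / of_nat N) * of_int m) * btheta N \<tau> i x"
  unfolding btheta_def by (rule theta_char_add_int)

text \<open>A shift by n\<tau> is the fraction n/N of the quasi-period N\<tau>, hence changes the
  characteristic by n/N and lowers the label by n.\<close>

lemma btheta_add_tau:
  "btheta N \<tau> i (x + of_int n * \<tau>) =
    exp (- (pi * \<i> * \<tau> * of_int n ^ 2 / of_nat N) - 2 * pi * \<i> * of_int n * (x + of_nat N / 2) / of_nat N) *
      btheta N \<tau> (i - n) x"
proof -
  have "btheta N \<tau> i (x + of_int n * \<tau>) = theta_char (1/2 - of_int i / of_nat N) (of_nat N / 2)
      (x + (of_int n / of_nat N) * (of_nat N * \<tau>)) (of_nat N * \<tau>)"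
    using N by (simp add: btheta_def)
  also have "\<dots> = exp (- (pi * \<i> * (of_nat N * \<tau>) * (of_int n / of_nat N)\<^sup>2) - 2 * pi * \<i> * (of_int n / of_nat N) * (x + of_nat N / 2)) *
      theta_char (1/2 - of_int i / of_nat N + of_int n / of_nat N) (of_nat N / 2) x (of_nat N * \<tau>)"
    by (rule theta_char_add_tau)
  also have "1/2 - of_int i / of_nat N + of_int n / of_nat N = (1/2 - of_int (i - n) / of_nat N :: complex)"
    by (simp add: diff_divide_distrib)
  also have "- (pi * \<i> * (of_nat N * \<tau>) * (of_int n / of_nat N)\<^sup>2) - 2 * pi * \<i> * (of_int n / of_nat N) * (x + of_nat N / 2) =
      - (pi * \<i> * \<tau> * of_int n ^ 2 / of_nat N) - 2 * pi * \<i> * of_int n * (x + of_nat N / 2) / of_nat N"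
    using N by (simp add: power2_eq_square)
  finally show ?thesis by (simp only: btheta_def)
qed

lemma btheta_period: "btheta N \<tau> (i + int N * k) x = btheta N \<tau> i x"
proof -
  have "(1/2 - of_int (i + int N * k) / of_nat N :: complex) = (1/2 - of_int i / of_nat N) + of_int (- k)"
    using N by (simp add: field_simps)
  then show ?thesis unfolding btheta_def by (simp only: theta_char_a_add_int)
qed

lemma btheta_cong:
  assumes "int N dvd i - j"
  shows "btheta N \<tau> i x = btheta N \<tau> j x"
proof -
  obtain k where "i = j + int N * k" using assms by (auto simp: dvd_def algebra_simps)
  then show ?thesis by (simp add: btheta_period)
qed

lemma btheta_add_N: "btheta N \<tau> i (x + of_nat N * of_int k) = exp (pi * \<i> * of_nat N * of_int k) * btheta N \<tau> i x"
proof -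
  define r where "r = - i * k"
  have "2 * pi * \<i> * (1/2 - of_int i / of_nat N) * of_int (int N * k) = pi * \<i> * of_nat N * of_int k + 2 * pi * \<i> * of_int r"
    using N by (simp add: field_simps r_def)
  then show ?thesis using btheta_add_int[of i x "int N * k"] by (simp only: exp_add exp_2pi_of_int mult_1_right of_int_mult of_int_of_nat_eq)
qed

lemma btheta_add_N_tau:
  "btheta N \<tau> i (x + of_nat N * of_int k * \<tau>) =
     exp (- (pi * \<i> * \<tau> * of_nat N * of_int k ^ 2) - 2 * pi * \<i> * of_int k * x - pi * \<i> * of_nat N * of_int k) * btheta N \<tau> i x"
proof -
  have "btheta N \<tau> (i - int N * k) x = btheta N \<tau> i x" by (rule btheta_cong) simp
  moreover have "- (pi * \<i> * \<tau> * of_int (int N * k) ^ 2 / of_nat N) - 2 * pi * \<i> * of_int (int N * k) * (x + of_nat N / 2) / of_nat N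
     = - (pi * \<i> * \<tau> * of_nat N * of_int k ^ 2) - 2 * pi * \<i> * of_int k * x - pi * \<i> * of_nat N * of_int k"
    using N by (simp add: field_simps power2_eq_square)
  ultimately show ?thesis using btheta_add_tau[of i x "int N * k"] by (simp only: of_int_mult of_int_of_nat_eq)
qed

lemma belavin_sum_minus_N:
  "belavin_sum \<tau> N h i j (z - of_nat N) x y = exp (- (pi * \<i> * of_nat N)) * belavin_sum \<tau> N h i j z x y"
proof -
  have 1: "exp (2 * pi * \<i> * of_int a2 * (z - of_nat N) / of_nat N) = exp (2 * pi * \<i> * of_int a2 * z / of_nat N)" for a2
  proof -
    have "2 * pi * \<i> * of_int a2 * (z - of_nat N) / of_nat N =
      2 * pi * \<i> * of_int a2 * z / of_nat N + 2 * pi * \<i> * of_int (- a2)"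
      using N by (simp add: field_simps)
    then show ?thesis by (simp only: exp_add exp_2pi_of_int mult_1_right)
  qed
  have 2: "vtheta \<tau> (z - of_nat N + w) = exp (- (pi * \<i> * of_nat N)) * vtheta \<tau> (z + w)" for w
    using vtheta_lattice_shift[of \<tau> "z + w" "- int N" 0] by (simp add: algebra_simps)
  show ?thesis unfolding belavin_sum_def 1 2 by (simp add: sum_distrib_left mult_ac)
qed

text \<open>The theta factor contributes \<open>exp (2 * pi * \<i> * (h + a1 + a2 * \<tau>))\<close>
  beyond what depends on z alone. The part in a2 cancels against the exponential prefactor, the part
  in a1 is 1, and h remains: this is the origin of the constant multiplier in the Belavin
  identity.\<close>

lemma belavin_sum_minus_N_tau:
  "belavin_sum \<tau> N h i j (z - of_nat N * \<tau>) x y =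
    exp (- (pi * \<i> * of_nat N) - pi * \<i> * \<tau> * of_nat N ^ 2 + 2 * pi * \<i> * of_nat N * z + 2 * pi * \<i> * h) * belavin_sum \<tau> N h i j z x y"
proof -
  have "exp (2 * pi * \<i> * of_int a2 * (z - of_nat N * \<tau>) / of_nat N) * vtheta \<tau> (z - of_nat N * \<tau> + (h + of_int a1 + of_int a2 * \<tau>) / of_nat N) =
     exp (- (pi * \<i> * of_nat N) - pi * \<i> * \<tau> * of_nat N ^ 2 + 2 * pi * \<i> * of_nat N * z + 2 * pi * \<i> * h) *
     (exp (2 * pi * \<i> * of_int a2 * z / of_nat N) * vtheta \<tau> (z + (h + of_int a1 + of_int a2 * \<tau>) / of_nat N))" for a1 a2
  proof -
    let ?w = "(h + of_int a1 + of_int a2 * \<tau>) / of_nat N"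
    have "vtheta \<tau> (z - of_nat N * \<tau> + ?w) =
      exp (pi * \<i> * of_int (0 + - int N) - pi * \<i> * \<tau> * of_int (- int N) ^ 2 - 2 * pi * \<i> * of_int (- int N) * (z + ?w)) * vtheta \<tau> (z + ?w)"
      using vtheta_lattice_shift[of \<tau> "z + ?w" 0 "- int N"] by (simp add: algebra_simps)
    moreover have "2 * pi * \<i> * of_int a2 * (z - of_nat N * \<tau>) / of_nat N +
       (pi * \<i> * of_int (0 + - int N) - pi * \<i> * \<tau> * of_int (- int N) ^ 2 - 2 * pi * \<i> * of_int (- int N) * (z + ?w)) =
       (- (pi * \<i> * of_nat N) - pi * \<i> * \<tau> * of_nat N ^ 2 + 2 * pi * \<i> * of_nat N * z + 2 * pi * \<i> * h) +
       2 * pi * \<i> * of_int a2 * z / of_nat N + 2 * pi * \<i> * of_int a1"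
      using N by (simp add: field_simps)
    ultimately show ?thesis
      by (simp only: mult.assoc[symmetric] exp_add[symmetric]) (simp only: exp_add exp_2pi_of_int mult_1_right)
  qed
  then show ?thesis
    unfolding belavin_sum_def by (simp add: sum_distrib_left mult.assoc[symmetric] times_divide_eq_right)
qed

text \<open>At a lattice point the quotient of theta functions becomes an exponential, and the sum
  over a1 a character sum that selects one residue of a2. For m = n = 0 the labels i and j are
  exchanged: the residue of the R-matrix at z = 0 is a permutation.\<close>

lemma belavin_sum_at_lattice:
  assumes nz: "\<And>a1 a2. a1 \<in> {0..<int N} \<Longrightarrow> a2 \<in> {0..<int N} \<Longrightarrow>
      vtheta \<tau> ((h + of_int a1 + of_int a2 * \<tau>) / of_nat N) \<noteq> 0"
  shows "belavin_sum \<tau> N h i j (of_int m + of_int n * \<tau>) x y = of_nat N *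
    exp (pi * \<i> * of_int (m + n) - pi * \<i> * \<tau> * of_int n ^ 2 - 2 * pi * \<i> * of_int n * h / of_nat N
       + 2 * pi * \<i> * of_int ((j - i + n) * m) / of_nat N) *
    (btheta N \<tau> (j + n) x * btheta N \<tau> (i - n) y)"
proof -
  define E where "E = pi * \<i> * of_int (m + n) - pi * \<i> * \<tau> * of_int n ^ 2 - 2 * pi * \<i> * of_int n * h / of_nat N"
  have 1: "exp (2 * pi * \<i> * of_int a2 * (of_int m + of_int n * \<tau>) / of_nat N) *
     (vtheta \<tau> (of_int m + of_int n * \<tau> + (h + of_int a1 + of_int a2 * \<tau>) / of_nat N) / vtheta \<tau> ((h + of_int a1 + of_int a2 * \<tau>) / of_nat N)) *
     (exp (2 * pi * \<i> * of_int (a1 * a2 + a1 * (i - j)) / of_nat N) * B) =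
     exp (E + 2 * pi * \<i> * of_int (a2 * m) / of_nat N) * B * exp (2 * pi * \<i> * of_int a1 * of_int (a2 + i - j - n) / of_nat N)"
    if a: "a1 \<in> {0..<int N}" "a2 \<in> {0..<int N}" for a1 a2 B
  proof -
    let ?w = "(h + of_int a1 + of_int a2 * \<tau>) / of_nat N"
    have "vtheta \<tau> (of_int m + of_int n * \<tau> + ?w) =
      exp (pi * \<i> * of_int (m + n) - pi * \<i> * \<tau> * of_int n ^ 2 - 2 * pi * \<i> * of_int n * ?w) * vtheta \<tau> ?w"
      using vtheta_lattice_shift[of \<tau> ?w m n] by (simp only: add_ac)
    then have "vtheta \<tau> (of_int m + of_int n * \<tau> + ?w) / vtheta \<tau> ?w =
      exp (pi * \<i> * of_int (m + n) - pi * \<i> * \<tau> * of_int n ^ 2 - 2 * pi * \<i> * of_int n * ?w)"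
      using nz[OF a] by simp
    moreover have "2 * pi * \<i> * of_int a2 * (of_int m + of_int n * \<tau>) / of_nat N +
        (pi * \<i> * of_int (m + n) - pi * \<i> * \<tau> * of_int n ^ 2 - 2 * pi * \<i> * of_int n * ?w) +
        2 * pi * \<i> * of_int (a1 * a2 + a1 * (i - j)) / of_nat N =
        E + 2 * pi * \<i> * of_int (a2 * m) / of_nat N + 2 * pi * \<i> * of_int a1 * of_int (a2 + i - j - n) / of_nat N"
      unfolding E_def using N by (simp add: field_simps)
    ultimately show ?thesis
      by (simp only: mult.assoc[symmetric] exp_add[symmetric]) (simp only: exp_add mult_ac)
  qed
  \<comment> \<open>The representative in 0..N-1 of the only residue that survives the character
    sum.\<close>
  define a0 where "a0 = (j - i + n) mod int N"
  have a0: "a0 \<in> {0..<int N}" using N by (simp add: a0_def)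
  have dvd: "int N dvd a2 + i - j - n \<longleftrightarrow> a2 = a0" if "a2 \<in> {0..<int N}" for a2
  proof -
    have "int N dvd a2 + i - j - n \<longleftrightarrow> a2 mod int N = (j - i + n) mod int N"
      by (simp add: mod_eq_dvd_iff algebra_simps)
    then show ?thesis using that by (simp add: a0_def)
  qed
  have "belavin_sum \<tau> N h i j (of_int m + of_int n * \<tau>) x y =
     (\<Sum>a2 = 0..<int N. exp (E + 2 * pi * \<i> * of_int (a2 * m) / of_nat N) *
       (btheta N \<tau> (i + a2) x * btheta N \<tau> (j - a2) y) *
       (\<Sum>a1 = 0..<int N. exp (2 * pi * \<i> * of_int a1 * of_int (a2 + i - j - n) / of_nat N)))"
    unfolding belavin_sum_def sum_distrib_left by (intro sum.cong refl 1)
  also have "\<dots> = (\<Sum>a2 = 0..<int N. if a2 = a0 then exp (E + 2 * pi * \<i> * of_int (a0 * m) / of_nat N) *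
       (btheta N \<tau> (i + a0) x * btheta N \<tau> (j - a0) y) * of_nat N else 0)"
    unfolding sum_exp_roots_of_unity_int[OF N] by (intro sum.cong refl) (use dvd in auto)
  also have "\<dots> = exp (E + 2 * pi * \<i> * of_int (a0 * m) / of_nat N) *
       (btheta N \<tau> (i + a0) x * btheta N \<tau> (j - a0) y) * of_nat N"
    using a0 by simp
  also have "btheta N \<tau> (i + a0) x = btheta N \<tau> (j + n) x"
    by (rule btheta_cong) (use dvd[OF a0] in \<open>simp add: algebra_simps\<close>)
  also have "btheta N \<tau> (j - a0) y = btheta N \<tau> (i - n) y"
    by (rule btheta_cong) (use dvd[OF a0] in \<open>simp add: algebra_simps dvd_diff_commute\<close>)
  \<comment> \<open>Replacing \<open>a0\<close> by the unreduced j - i + n changes the exponent by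
    an integer multiple of \<open>2 * pi * \<i>\<close>.\<close>
  also have "exp (E + 2 * pi * \<i> * of_int (a0 * m) / of_nat N) = exp (E + 2 * pi * \<i> * of_int ((j - i + n) * m) / of_nat N)"
  proof -
    obtain k where k: "a0 = (j - i + n) + int N * k"
      using dvd[OF a0] by (auto simp: dvd_def algebra_simps)
    have "E + 2 * pi * \<i> * of_int (a0 * m) / of_nat N = E + 2 * pi * \<i> * of_int ((j - i + n) * m) / of_nat N + 2 * pi * \<i> * of_int (k * m)"
      unfolding k using N by (simp add: field_simps)
    then show ?thesis by (simp only: exp_add exp_2pi_of_int mult_1_right)
  qed
  finally show ?thesis unfolding E_def by (simp only: mult_ac)
qed

text \<open>Where x - y - Nv is a lattice point, the term carrying its theta value drops out. The
  arguments x + h - Nv and y + Nv are then lattice translates of y + h and x, and the translations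
  produce exactly the labels left by the character sum.\<close>

lemma belavin_identity_lattice:
  assumes nz: "\<And>a1 a2. a1 \<in> {0..<int N} \<Longrightarrow> a2 \<in> {0..<int N} \<Longrightarrow>
      vtheta \<tau> ((h + of_int a1 + of_int a2 * \<tau>) / of_nat N) \<noteq> 0"
    and z: "x - y - of_nat N * v = of_int m + of_int n * \<tau>"
  shows "vtheta \<tau> v * belavin_sum \<tau> N h i j (of_int m + of_int n * \<tau>) x (y + h) / of_nat N =
    vtheta \<tau> (of_int m + of_int n * \<tau> + v) * (btheta N \<tau> i (x + h - of_nat N * v) * btheta N \<tau> j (y + of_nat N * v))"
proof -
  have x: "x + h - of_nat N * v = (y + h + of_int n * \<tau>) + of_int m"
    "y + of_nat N * v = (x + of_int (- n) * \<tau>) + of_int (- m)"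
    using z by (simp_all add: algebra_simps)
  have Nv: "x = y + of_nat N * v + of_int m + of_int n * \<tau>"
    using z by (simp add: algebra_simps)
  have v: "vtheta \<tau> (of_int m + of_int n * \<tau> + v) =
     exp (pi * \<i> * of_int (m + n) - pi * \<i> * \<tau> * of_int n ^ 2 - 2 * pi * \<i> * of_int n * v) * vtheta \<tau> v"
    using vtheta_lattice_shift[of \<tau> v m n] by (simp only: add_ac)
  have "(pi * \<i> * of_int (m + n) - pi * \<i> * \<tau> * of_int n ^ 2 - 2 * pi * \<i> * of_int n * v) +
      (2 * pi * \<i> * (1/2 - of_int i / of_nat N) * of_int m +
       (- (pi * \<i> * \<tau> * of_int n ^ 2 / of_nat N) - 2 * pi * \<i> * of_int n * (y + h + of_nat N / 2) / of_nat N)) +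
      (2 * pi * \<i> * (1/2 - of_int j / of_nat N) * of_int (- m) +
       (- (pi * \<i> * \<tau> * of_int (- n) ^ 2 / of_nat N) - 2 * pi * \<i> * of_int (- n) * (x + of_nat N / 2) / of_nat N)) =
      pi * \<i> * of_int (m + n) - pi * \<i> * \<tau> * of_int n ^ 2 - 2 * pi * \<i> * of_int n * h / of_nat N
       + 2 * pi * \<i> * of_int ((j - i + n) * m) / of_nat N"
    unfolding Nv using N by (simp add: field_simps power2_eq_square)
  then have "exp (pi * \<i> * of_int (m + n) - pi * \<i> * \<tau> * of_int n ^ 2 - 2 * pi * \<i> * of_int n * v) *
      (exp (2 * pi * \<i> * (1/2 - of_int i / of_nat N) * of_int m) *
       exp (- (pi * \<i> * \<tau> * of_int n ^ 2 / of_nat N) - 2 * pi * \<i> * of_int n * (y + h + of_nat N / 2) / of_nat N)) *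
      (exp (2 * pi * \<i> * (1/2 - of_int j / of_nat N) * of_int (- m)) *
       exp (- (pi * \<i> * \<tau> * of_int (- n) ^ 2 / of_nat N) - 2 * pi * \<i> * of_int (- n) * (x + of_nat N / 2) / of_nat N)) =
      exp (pi * \<i> * of_int (m + n) - pi * \<i> * \<tau> * of_int n ^ 2 - 2 * pi * \<i> * of_int n * h / of_nat N
       + 2 * pi * \<i> * of_int ((j - i + n) * m) / of_nat N)" (is "?A * (?B * ?C) * (?D * ?E) = ?X")
    unfolding exp_add[symmetric] by (rule arg_cong)
  have l: "vtheta \<tau> v * belavin_sum \<tau> N h i j (of_int m + of_int n * \<tau>) x (y + h) / of_nat N =
      ?X * (vtheta \<tau> v * (btheta N \<tau> (j + n) x * btheta N \<tau> (i - n) (y + h)))"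
    by (subst belavin_sum_at_lattice) (use nz N in auto)
  show ?thesis
    unfolding l \<open>_ = ?X\<close>[symmetric] x v btheta_add_int btheta_add_tau diff_minus_eq_add
    by (simp only: mult_ac)
qed

text \<open>As functions of \<open>v\<close>, the three terms have the same multipliers; the difference vanishes at
  the zeros of \<open>\<vartheta>(v) \<vartheta>(x - y - N v)\<close>, and the quotient by this product has multipliers \<open>1\<close> and
  \<open>e\<^bsup>2\<pi>ih\<^esup>\<close>, hence is zero.\<close>

lemma belavin_identity_generic:
  assumes h: "vtheta \<tau> h \<noteq> 0"
    and nz: "\<And>a1 a2. a1 \<in> {0..<int N} \<Longrightarrow> a2 \<in> {0..<int N} \<Longrightarrow>
      vtheta \<tau> ((h + of_int a1 + of_int a2 * \<tau>) / of_nat N) \<noteq> 0"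
    and xy: "vtheta \<tau> (x - y) \<noteq> 0"
  shows "vtheta \<tau> v * belavin_sum \<tau> N h i j (x - y - of_nat N * v) x (y + h) / of_nat N =
    vtheta \<tau> (x - y - of_nat N * v + v) * (btheta N \<tau> i (x + h - of_nat N * v) * btheta N \<tau> j (y + of_nat N * v)) -
    vtheta \<tau> (x - y - of_nat N * v) * vtheta \<tau> (h - v) / vtheta \<tau> h * (btheta N \<tau> i (x + h) * btheta N \<tau> j y)"
proof -
  define z where "z v = x - y - of_nat N * v" for v
  define F where "F v = vtheta \<tau> v * belavin_sum \<tau> N h i j (z v) x (y + h) / of_nat N -
     (vtheta \<tau> (z v + v) * (btheta N \<tau> i (x + h - of_nat N * v) * btheta N \<tau> j (y + of_nat N * v)) -
      vtheta \<tau> (z v) * vtheta \<tau> (h - v) / vtheta \<tau> h * (btheta N \<tau> i (x + h) * btheta N \<tau> j y))" for v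
  define G where "G v = vtheta \<tau> v * vtheta \<tau> (z v)" for v
  define p where "p = - exp (- (pi * \<i> * of_nat N))"
  \<comment> \<open>\<open>p\<close> and \<open>q\<close> are the multipliers of G itself; the terms
    of F have in addition the constant \<open>exp (2 * pi * \<i> * h)\<close> under v +
    \<tau>.\<close>
  define q where "q v = - exp (- (pi * \<i> * \<tau>) - 2 * pi * \<i> * v) *
      exp (- (pi * \<i> * of_nat N) - pi * \<i> * \<tau> * of_nat N ^ 2 + 2 * pi * \<i> * of_nat N * z v)" for v
  have z1: "z (v + 1) = z v - of_nat N" and z\<tau>: "z (v + \<tau>) = z v - of_nat N * \<tau>" for v
    by (simp_all add: z_def algebra_simps)
  have tz1: "vtheta \<tau> (z v - of_nat N) = exp (- (pi * \<i> * of_nat N)) * vtheta \<tau> (z v)" for v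
    using vtheta_lattice_shift[of \<tau> "z v" "- int N" 0] by simp
  have tz\<tau>: "vtheta \<tau> (z v - of_nat N * \<tau>) =
      exp (- (pi * \<i> * of_nat N) - pi * \<i> * \<tau> * of_nat N ^ 2 + 2 * pi * \<i> * of_nat N * z v) * vtheta \<tau> (z v)" for v
    using vtheta_lattice_shift[of \<tau> "z v" 0 "- int N"] by simp
  have F1: "F (v + 1) = p * F v" for v
  proof -
    have 1: "vtheta \<tau> (z v - of_nat N + (v + 1)) = p * vtheta \<tau> (z v + v)"
      using vtheta_lattice_shift[of \<tau> "z v + v" "1 - int N" 0]
      by (simp add: p_def algebra_simps exp_diff exp_minus divide_inverse)
    have 2: "btheta N \<tau> i (x + h - of_nat N * (v + 1)) * btheta N \<tau> j (y + of_nat N * (v + 1)) =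
       btheta N \<tau> i (x + h - of_nat N * v) * btheta N \<tau> j (y + of_nat N * v)"
      using btheta_add_N[of i "x + h - of_nat N * v" "-1"] btheta_add_N[of j "y + of_nat N * v" 1]
      by (simp add: algebra_simps exp_minus)
    have 3: "vtheta \<tau> (h - (v + 1)) = - vtheta \<tau> (h - v)"
      using vtheta_add_1[of \<tau> "h - (v + 1)"] by simp
    show ?thesis
      unfolding F_def z1 belavin_sum_minus_N tz1 1 2 3 vtheta_add_1 by (simp add: p_def algebra_simps)
  qed
  have F\<tau>: "F (v + \<tau>) = exp (2 * pi * \<i> * h) * (q v * F v)" for v
  proof -
    have e: "vtheta \<tau> (z v - of_nat N * \<tau> + (v + \<tau>)) = exp (pi * \<i> * of_int (1 - int N)
        - pi * \<i> * \<tau> * of_int (1 - int N) ^ 2 - 2 * pi * \<i> * of_int (1 - int N) * (z v + v)) * vtheta \<tau> (z v + v)"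
      using vtheta_lattice_shift[of \<tau> "z v + v" 0 "1 - int N"] by (simp add: algebra_simps)
    have b: "btheta N \<tau> i (x + h - of_nat N * (v + \<tau>)) * btheta N \<tau> j (y + of_nat N * (v + \<tau>)) =
        exp (- (2 * pi * \<i> * \<tau> * of_nat N) + 2 * pi * \<i> * (z v - of_nat N * v + h)) *
        (btheta N \<tau> i (x + h - of_nat N * v) * btheta N \<tau> j (y + of_nat N * v))"
    proof -
      have "x + h - of_nat N * (v + \<tau>) = (x + h - of_nat N * v) + of_nat N * of_int (-1) * \<tau>"
        "y + of_nat N * (v + \<tau>) = (y + of_nat N * v) + of_nat N * of_int 1 * \<tau>"
        by (simp_all add: algebra_simps)
      moreover have "(- (pi * \<i> * \<tau> * of_nat N * of_int (-1) ^ 2) - 2 * pi * \<i> * of_int (-1) * (x + h - of_nat N * v) - pi * \<i> * of_nat N * of_int (-1)) +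
         (- (pi * \<i> * \<tau> * of_nat N * of_int 1 ^ 2) - 2 * pi * \<i> * of_int 1 * (y + of_nat N * v) - pi * \<i> * of_nat N * of_int 1) =
         - (2 * pi * \<i> * \<tau> * of_nat N) + 2 * pi * \<i> * (z v - of_nat N * v + h)"
        by (simp add: z_def algebra_simps)
      ultimately show ?thesis
        by (simp only: btheta_add_N_tau exp_mult_exp_mult)
    qed
    have qe: "exp (2 * pi * \<i> * h) * q v = exp (pi * \<i> + (- (pi * \<i> * \<tau>) - 2 * pi * \<i> * v) +
        (- (pi * \<i> * of_nat N) - pi * \<i> * \<tau> * of_nat N ^ 2 + 2 * pi * \<i> * of_nat N * z v) + 2 * pi * \<i> * h)"
      by (simp add: q_def exp_add)
    have "(pi * \<i> * of_int (1 - int N) - pi * \<i> * \<tau> * of_int (1 - int N) ^ 2 - 2 * pi * \<i> * of_int (1 - int N) * (z v + v)) +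
       (- (2 * pi * \<i> * \<tau> * of_nat N) + 2 * pi * \<i> * (z v - of_nat N * v + h)) =
       pi * \<i> + (- (pi * \<i> * \<tau>) - 2 * pi * \<i> * v) +
        (- (pi * \<i> * of_nat N) - pi * \<i> * \<tau> * of_nat N ^ 2 + 2 * pi * \<i> * of_nat N * z v) + 2 * pi * \<i> * h"
      by (simp add: algebra_simps power2_eq_square)
    then have T3: "vtheta \<tau> (z v - of_nat N * \<tau> + (v + \<tau>)) *
       (btheta N \<tau> i (x + h - of_nat N * (v + \<tau>)) * btheta N \<tau> j (y + of_nat N * (v + \<tau>))) =
       (exp (2 * pi * \<i> * h) * q v) * (vtheta \<tau> (z v + v) * (btheta N \<tau> i (x + h - of_nat N * v) * btheta N \<tau> j (y + of_nat N * v)))"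
      unfolding e b qe exp_mult_exp_mult by (simp only:)
    have h\<tau>: "vtheta \<tau> (h - (v + \<tau>)) = - exp (- (pi * \<i> * \<tau>) - 2 * pi * \<i> * v) * exp (2 * pi * \<i> * h) * vtheta \<tau> (h - v)"
    proof -
      have "vtheta \<tau> (h - v) = - exp (- (pi * \<i> * \<tau>) - 2 * pi * \<i> * (h - (v + \<tau>))) * vtheta \<tau> (h - (v + \<tau>))"
        using vtheta_add_tau[of \<tau> "h - (v + \<tau>)"] by simp
      moreover have "exp (- (pi * \<i> * \<tau>) - 2 * pi * \<i> * v) * exp (2 * pi * \<i> * h) *
         exp (- (pi * \<i> * \<tau>) - 2 * pi * \<i> * (h - (v + \<tau>))) = 1"
        unfolding exp_add[symmetric] by (simp add: algebra_simps)
      ultimately show ?thesis by (simp add: mult.assoc[symmetric])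
    qed
    have T1: "vtheta \<tau> (v + \<tau>) * belavin_sum \<tau> N h i j (z v - of_nat N * \<tau>) x (y + h) =
        (exp (2 * pi * \<i> * h) * q v) * (vtheta \<tau> v * belavin_sum \<tau> N h i j (z v) x (y + h))"
      unfolding vtheta_add_tau belavin_sum_minus_N_tau q_def by (simp add: exp_add)
    have T2: "vtheta \<tau> (z v - of_nat N * \<tau>) * vtheta \<tau> (h - (v + \<tau>)) =
        (exp (2 * pi * \<i> * h) * q v) * (vtheta \<tau> (z v) * vtheta \<tau> (h - v))"
      unfolding tz\<tau> h\<tau> q_def by (simp only: mult_ac mult_minus_left mult_minus_right)
    show ?thesis
      unfolding F_def z\<tau> T1 T2 T3 by (simp add: algebra_simps)
  qed
  have G1: "G (v + 1) = p * G v" for v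
    unfolding G_def z1 tz1 vtheta_add_1 by (simp add: p_def)
  have G\<tau>: "G (v + \<tau>) = q v * G v" for v
    unfolding G_def z\<tau> tz\<tau> vtheta_add_tau q_def by (simp only: mult_ac mult_minus_left mult_minus_right)
  have zh: "z holomorphic_on UNIV" unfolding z_def[abs_def] by (intro holomorphic_intros)
  have F: "F holomorphic_on UNIV"
    unfolding F_def[abs_def] belavin_sum_def
    by (intro holomorphic_intros vtheta_holomorphic_compose btheta_holomorphic_compose zh \<tau>) (use h nz N in auto)
  have G: "G holomorphic_on UNIV"
    unfolding G_def[abs_def] by (intro holomorphic_intros vtheta_holomorphic_compose zh \<tau>)
  have pq: "p \<noteq> 0" "q v \<noteq> 0" for v by (auto simp: p_def q_def)
  \<comment> \<open>A common zero of the two factors of G would put x - y into the lattice. This is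
    where the genericity of x - y makes the zeros of G simple.\<close>
  have nl: "vtheta \<tau> v \<noteq> 0 \<or> vtheta \<tau> (z v) \<noteq> 0" for v
  proof (rule ccontr)
    assume "\<not> ?thesis"
    then obtain a b c d :: int where "v = of_int a + of_int b * \<tau>" "z v = of_int c + of_int d * \<tau>"
      unfolding vtheta_eq_0_iff[OF \<tau>] by blast
    then have "x - y = of_int (c + int N * a) + of_int (d + int N * b) * \<tau>"
      by (simp add: z_def algebra_simps)
    then show False using xy vtheta_lattice by metis
  qed
  have zero: "F v = 0" if Gv: "G v = 0" for v
  proof (cases "vtheta \<tau> v = 0")
    case True
    \<comment> \<open>At v = 0 the Belavin sum is multiplied by zero and the other two terms
      coincide; quasi-periodicity carries the zero to the whole lattice.\<close>
    have "F 0 = 0" using h by (simp add: F_def)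
    obtain m n :: int where v: "v = 0 + of_int m + of_int n * \<tau>"
      using True unfolding vtheta_eq_0_iff[OF \<tau>] by auto
    show ?thesis unfolding v
      by (rule quasi_zero_lattice[where F = F and p = "\<lambda>_. p" and q = "\<lambda>v. exp (2 * pi * \<i> * h) * q v"])
        (simp_all add: F1 F\<tau> pq \<open>F 0 = 0\<close>)
  next
    case False
    then have zv: "vtheta \<tau> (z v) = 0" using Gv by (simp add: G_def)
    then obtain m n :: int where mn: "z v = of_int m + of_int n * \<tau>"
      unfolding vtheta_eq_0_iff[OF \<tau>] by blast
    show ?thesis
      using belavin_identity_lattice[OF nz mn[unfolded z_def], of i j] zv unfolding F_def mn by simp
  qed
  have simple: "deriv G v \<noteq> 0" if Gv: "G v = 0" for v
  proof -
    have d: "(vtheta \<tau> has_field_derivative deriv (vtheta \<tau>) w) (at w)" for w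
      using holomorphic_derivI[OF vtheta_holomorphic_UNIV[OF \<tau>]] by auto
    have "(z has_field_derivative - of_nat N) (at v)"
      unfolding z_def[abs_def] by (auto intro!: derivative_eq_intros)
    from DERIV_mult[OF d DERIV_chain2[OF d this]]
    have "deriv G v = deriv (vtheta \<tau>) v * vtheta \<tau> (z v) + deriv (vtheta \<tau>) (z v) * (- of_nat N) * vtheta \<tau> v"
      unfolding G_def[abs_def] by (rule DERIV_imp_deriv)
    moreover have "vtheta \<tau> v = 0 \<or> vtheta \<tau> (z v) = 0" using Gv by (simp add: G_def)
    ultimately show ?thesis
      using nl[of v] vtheta_simple_zeros[OF \<tau>, of v] vtheta_simple_zeros[OF \<tau>, of "z v"] N by auto
  qed
  obtain c and k :: int where c: "\<And>v. F v = G v * (c * exp (2 * pi * \<i> * of_int k * v))"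
    and k: "c = 0 \<or> exp (2 * pi * \<i> * h) = exp (2 * pi * \<i> * of_int k * \<tau>)"
  proof (rule quasiperiodic_ratio[where p = "\<lambda>_. p", OF \<tau> F G zero simple F1 G1 F\<tau> G\<tau>])
  qed (use pq in auto)
  then have "c = 0" using vtheta_eq_0_of_exp_eq[of h k \<tau>] h by blast
  then have "F v = 0" using c by simp
  then show ?thesis by (simp add: F_def z_def)
qed

end

section \<open>The Belavin identity for all arguments, and its derivative at v = 0\<close>

lemma vtheta_has_field_derivative:
  assumes "Im \<tau> > 0" "(g has_field_derivative g') (at v)"
  shows "((\<lambda>v. vtheta \<tau> (g v)) has_field_derivative deriv (vtheta \<tau>) (g v) * g') (at v)"
  by (rule DERIV_chain2[OF _ assms(2)]) (use holomorphic_derivI[OF vtheta_holomorphic_UNIV[OF assms(1)]] in auto)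

lemma closure_vtheta_affine_nonzero:
  assumes \<tau>: "Im \<tau> > 0" and a: "a \<noteq> 0"
  shows "closure {x. vtheta \<tau> (a * x + b) \<noteq> 0} = UNIV"
proof (rule dense_nonzero_of_simple_zeros)
  show "(\<lambda>x. vtheta \<tau> (a * x + b)) holomorphic_on UNIV"
    by (intro holomorphic_intros vtheta_holomorphic_compose \<tau>)
  fix x assume 0: "vtheta \<tau> (a * x + b) = 0"
  have "((\<lambda>x. vtheta \<tau> (a * x + b)) has_field_derivative deriv (vtheta \<tau>) (a * x + b) * a) (at x)"
    by (rule vtheta_has_field_derivative[OF \<tau>]) (auto intro!: derivative_eq_intros)
  then show "deriv (\<lambda>x. vtheta \<tau> (a * x + b)) x \<noteq> 0"
    using a vtheta_simple_zeros[OF \<tau> 0] by (simp add: DERIV_imp_deriv)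
qed

context
  fixes \<tau> :: complex and N :: nat
  assumes \<tau>: "Im \<tau> > 0" and N: "N > 0"
begin

lemma btheta_has_field_derivative:
  assumes "(g has_field_derivative g') (at v)"
  shows "((\<lambda>v. btheta N \<tau> i (g v)) has_field_derivative deriv (btheta N \<tau> i) (g v) * g') (at v)"
  by (rule DERIV_chain2[OF _ assms]) (use holomorphic_derivI[OF btheta_holomorphic[OF \<tau> N]] in auto)

text \<open>Both sides are continuous in x, and the values of x with x - y off the lattice are
  dense.\<close>

lemma belavin_identity:
  assumes h: "vtheta \<tau> h \<noteq> 0"
    and nz: "\<And>a1 a2. a1 \<in> {0..<int N} \<Longrightarrow> a2 \<in> {0..<int N} \<Longrightarrow>
      vtheta \<tau> ((h + of_int a1 + of_int a2 * \<tau>) / of_nat N) \<noteq> 0"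
  shows "vtheta \<tau> v * belavin_sum \<tau> N h i j (x - y - of_nat N * v) x (y + h) / of_nat N =
    vtheta \<tau> (x - y - of_nat N * v + v) * (btheta N \<tau> i (x + h - of_nat N * v) * btheta N \<tau> j (y + of_nat N * v)) -
    vtheta \<tau> (x - y - of_nat N * v) * vtheta \<tau> (h - v) / vtheta \<tau> h * (btheta N \<tau> i (x + h) * btheta N \<tau> j y)"
    (is "?A x = ?B x")
proof (rule continuous_eq_on_dense[where A = ?A and B = ?B and S = "{x. vtheta \<tau> (1 * x + (- y)) \<noteq> 0}"])
  show "continuous_on UNIV ?A" "continuous_on UNIV ?B"
    unfolding belavin_sum_def
    by (intro holomorphic_on_imp_continuous_on holomorphic_intros vtheta_holomorphic_compose
        btheta_holomorphic_compose[OF \<tau> N] \<tau>; use h nz N in auto)+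
  show "closure {x. vtheta \<tau> (1 * x + (- y)) \<noteq> 0} = UNIV"
    by (rule closure_vtheta_affine_nonzero[OF \<tau>]) simp
  show "?A x = ?B x" if "x \<in> {x. vtheta \<tau> (1 * x + (- y)) \<noteq> 0}" for x
    by (rule belavin_identity_generic[OF \<tau> N h nz]) (use that in auto)
qed

text \<open>Replacing y by y - Nv keeps the spectral argument equal to x - y. As the factor
  \<open>vtheta \<tau> v\<close> vanishes at 0, only the value of the Belavin sum at v = 0 enters
  the derivative, not its own derivative.\<close>

lemma belavin_identity_deriv:
  assumes h: "vtheta \<tau> h \<noteq> 0"
    and nz: "\<And>a1 a2. a1 \<in> {0..<int N} \<Longrightarrow> a2 \<in> {0..<int N} \<Longrightarrow>
      vtheta \<tau> ((h + of_int a1 + of_int a2 * \<tau>) / of_nat N) \<noteq> 0"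
  shows "deriv (vtheta \<tau>) 0 * belavin_sum \<tau> N h i j (x - y) x (y + h) / of_nat N =
    (deriv (vtheta \<tau>) (x - y) + vtheta \<tau> (x - y) * deriv (vtheta \<tau>) h / vtheta \<tau> h) * (btheta N \<tau> i (x + h) * btheta N \<tau> j y)
    - vtheta \<tau> (x - y) * (of_nat N * deriv (btheta N \<tau> i) (x + h) * btheta N \<tau> j y)
    + vtheta \<tau> (x - y) * (of_nat N * btheta N \<tau> i (x + h) * deriv (btheta N \<tau> j) y)"
proof -
  let ?z = "x - y"
  define S where "S v = belavin_sum \<tau> N h i j ?z x (y - of_nat N * v + h)" for v
  have "S holomorphic_on UNIV"
    unfolding S_def[abs_def] belavin_sum_def
    by (intro holomorphic_intros vtheta_holomorphic_compose btheta_holomorphic_compose[OF \<tau> N] \<tau>) (use nz N in auto)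
  then have dS: "(S has_field_derivative deriv S 0) (at 0)" using holomorphic_derivI[of S UNIV 0] by auto
  have eq: "vtheta \<tau> v * S v / of_nat N =
    vtheta \<tau> (?z + v) * (btheta N \<tau> i (x + h - of_nat N * v) * btheta N \<tau> j y) -
    vtheta \<tau> ?z * vtheta \<tau> (h - v) / vtheta \<tau> h * (btheta N \<tau> i (x + h) * btheta N \<tau> j (y - of_nat N * v))" for v
    using belavin_identity[OF h nz, of v i j x "y - of_nat N * v"] by (simp add: S_def)
  have dv: "((\<lambda>v. vtheta \<tau> v) has_field_derivative deriv (vtheta \<tau>) 0 * 1) (at 0)"
    by (rule vtheta_has_field_derivative[OF \<tau>]) (auto intro!: derivative_eq_intros)
  have L: "((\<lambda>v. vtheta \<tau> v * S v / of_nat N) has_field_derivative deriv (vtheta \<tau>) 0 * S 0 / of_nat N) (at 0)"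
    by (rule DERIV_cong[OF DERIV_cdivide[OF DERIV_mult[OF dv dS]]]) simp
  have a: "((\<lambda>v. vtheta \<tau> (?z + v)) has_field_derivative deriv (vtheta \<tau>) (?z + 0) * 1) (at 0)"
    "((\<lambda>v. vtheta \<tau> (h - v)) has_field_derivative deriv (vtheta \<tau>) (h - 0) * (- 1)) (at 0)"
    by (rule vtheta_has_field_derivative[OF \<tau>]; auto intro!: derivative_eq_intros)+
  have b: "((\<lambda>v. btheta N \<tau> i (x + h - of_nat N * v)) has_field_derivative deriv (btheta N \<tau> i) (x + h - of_nat N * 0) * (- of_nat N)) (at 0)"
    "((\<lambda>v. btheta N \<tau> j (y - of_nat N * v)) has_field_derivative deriv (btheta N \<tau> j) (y - of_nat N * 0) * (- of_nat N)) (at 0)"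
    by (rule btheta_has_field_derivative; auto intro!: derivative_eq_intros)+
  have "((\<lambda>v. vtheta \<tau> (?z + v) * (btheta N \<tau> i (x + h - of_nat N * v) * btheta N \<tau> j y) -
    vtheta \<tau> ?z * vtheta \<tau> (h - v) / vtheta \<tau> h * (btheta N \<tau> i (x + h) * btheta N \<tau> j (y - of_nat N * v)))
    has_field_derivative
    (deriv (vtheta \<tau>) ?z * (btheta N \<tau> i (x + h) * btheta N \<tau> j y)
      + vtheta \<tau> ?z * ((deriv (btheta N \<tau> i) (x + h) * (- of_nat N)) * btheta N \<tau> j y)
     - (vtheta \<tau> ?z * (- deriv (vtheta \<tau>) h) / vtheta \<tau> h * (btheta N \<tau> i (x + h) * btheta N \<tau> j y)
       + vtheta \<tau> ?z * (btheta N \<tau> i (x + h) * (deriv (btheta N \<tau> j) y * (- of_nat N)))))) (at 0)"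
    by (rule DERIV_cong[OF DERIV_diff[OF DERIV_mult[OF a(1) DERIV_cmult_right[OF b(1)]]
          DERIV_mult[OF DERIV_cdivide[OF DERIV_cmult[OF a(2)]] DERIV_cmult[OF b(2)]]]])
      (use h in \<open>simp add: mult_ac\<close>)
  from DERIV_unique[OF L[unfolded eq] this] show ?thesis
    unfolding S_def by (simp add: algebra_simps)
qed

end

text \<open>At the node \<open>u k\<close> the k-th basis function contributes logarithmic
  derivatives. Every other one vanishes there, so just its factor with the zero at
  \<open>u k\<close> is differentiated, which yields the Kronecker function.\<close>

lemma theta_lagrange_interpolation_deriv:
  fixes u :: "'n::finite \<Rightarrow> complex"
  assumes \<tau>: "Im \<tau> > 0" and u: "\<And>i j. i \<noteq> j \<Longrightarrow> vtheta \<tau> (u i - u j) \<noteq> 0"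
    and z: "vtheta \<tau> z \<noteq> 0" and f: "f holomorphic_on UNIV"
    and f1: "\<And>v. f (v + 1) = (-1) ^ CARD('n) * f v"
    and f\<tau>: "\<And>v. f (v + \<tau>) = (-1) ^ CARD('n) *
       exp (of_nat CARD('n) * - (pi * \<i> * \<tau> + 2 * pi * \<i> * v) + 2 * pi * \<i> * ((\<Sum>m\<in>UNIV. u m) - z)) * f v"
  shows "deriv f (u k) =
     (eisenstein_E1 \<tau> z + deriv (\<lambda>v. \<Prod>m\<in>UNIV - {k}. vtheta \<tau> (v - u m)) (u k) / (\<Prod>m\<in>UNIV - {k}. vtheta \<tau> (u k - u m))) * f (u k)
     + (\<Sum>i\<in>UNIV - {k}. kronecker_phi \<tau> z (u k - u i) *
         ((\<Prod>m\<in>UNIV - {k}. vtheta \<tau> (u m - u k)) / (\<Prod>m\<in>UNIV - {i}. vtheta \<tau> (u m - u i))) * f (u i))"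
proof -
  define P where "P i v = (\<Prod>m\<in>UNIV - {i}. vtheta \<tau> (v - u m))" for i v
  define d where "d i = (if i = k then deriv (vtheta \<tau>) z * P k (u k) + vtheta \<tau> z * deriv (P k) (u k)
      else vtheta \<tau> (u k - u i + z) * (deriv (vtheta \<tau>) 0 * P k (u k) / vtheta \<tau> (u k - u i)))" for i
  have Ph: "P i holomorphic_on UNIV" for i
    unfolding P_def[abs_def] by (intro holomorphic_intros vtheta_holomorphic_compose \<tau>)
  have dP: "(P i has_field_derivative deriv (P i) v) (at v)" for i v
    using holomorphic_derivI[OF Ph] by auto
  have Pnz: "P i (u i) \<noteq> 0" for i using u by (auto simp: P_def)
  \<comment> \<open>The normalisation of g has the differences in the opposite order; the resulting
    signs cancel in the ratio of two such products.\<close>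
  have Pneg: "(\<Prod>m\<in>UNIV - {i}. vtheta \<tau> (u m - u i)) = (-1) ^ (CARD('n) - 1) * P i (u i)" for i
  proof -
    have "vtheta \<tau> (u m - u i) = (-1) * vtheta \<tau> (u i - u m)" for m
      using vtheta_minus[of \<tau> "u i - u m"] by simp
    then show ?thesis by (simp only: P_def prod.distrib prod_constant) (simp add: card_Diff_singleton)
  qed
  have dt: "((\<lambda>v. vtheta \<tau> (v - u i + z)) has_field_derivative deriv (vtheta \<tau>) (u k - u i + z) * 1) (at (u k))" for i
    by (rule vtheta_has_field_derivative[OF \<tau>]) (auto intro!: derivative_eq_intros)
  have dterm: "((\<lambda>v. vtheta \<tau> (v - u i + z) * P i v) has_field_derivative d i) (at (u k))" for i
  proof (cases "i = k")
    case True
    show ?thesis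
      by (rule DERIV_cong[OF DERIV_mult[OF dt dP]]) (simp add: True d_def algebra_simps)
  next
    case False
    have Pk0: "P i (u k) = 0" unfolding P_def using False by (intro prod_zero) (auto intro!: bexI[of _ k])
    define R where "R v = (\<Prod>m\<in>UNIV - {i} - {k}. vtheta \<tau> (v - u m))" for v
    have PR: "P i v = vtheta \<tau> (v - u k) * R v" for v
      unfolding P_def R_def using False by (subst prod.remove[of _ k]) auto
    have "UNIV - {k} - {i} = UNIV - {i} - {k}" by blast
    then have "P k (u k) = vtheta \<tau> (u k - u i) * R (u k)"
      unfolding P_def R_def using False by (subst prod.remove[of _ i]) auto
    then have Rk: "R (u k) = P k (u k) / vtheta \<tau> (u k - u i)" using u[of k i] False by auto
    have "R holomorphic_on UNIV"
      unfolding R_def[abs_def] by (intro holomorphic_intros vtheta_holomorphic_compose \<tau>)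
    then have dR: "(R has_field_derivative deriv R (u k)) (at (u k))" using holomorphic_derivI[of R UNIV] by auto
    have dk: "((\<lambda>v. vtheta \<tau> (v - u k)) has_field_derivative deriv (vtheta \<tau>) (u k - u k) * 1) (at (u k))"
      by (rule vtheta_has_field_derivative[OF \<tau>]) (auto intro!: derivative_eq_intros)
    have dPi: "(P i has_field_derivative deriv (vtheta \<tau>) 0 * R (u k)) (at (u k))"
      unfolding PR[abs_def] by (rule DERIV_cong[OF DERIV_mult[OF dk dR]]) simp
    show ?thesis
      by (rule DERIV_cong[OF DERIV_mult[OF dt dPi]]) (simp add: Pk0 d_def False Rk)
  qed
  have fterm: "((\<lambda>v. f (u i) * (vtheta \<tau> (v - u i + z) * P i v) / (vtheta \<tau> z * P i (u i)))
     has_field_derivative f (u i) * d i / (vtheta \<tau> z * P i (u i))) (at (u k))" for i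
    using DERIV_cdivide[OF DERIV_cmult[where c = "f (u i)", OF dterm[of i]], where c = "vtheta \<tau> z * P i (u i)"] .
  have "((\<lambda>v. \<Sum>i\<in>UNIV. f (u i) * (vtheta \<tau> (v - u i + z) * P i v) / (vtheta \<tau> z * P i (u i)))
     has_field_derivative (\<Sum>i\<in>UNIV. f (u i) * d i / (vtheta \<tau> z * P i (u i)))) (at (u k))"
    by (rule DERIV_sum) (rule fterm)
  moreover have "(\<lambda>v. \<Sum>i\<in>UNIV. f (u i) * (vtheta \<tau> (v - u i + z) * P i v) / (vtheta \<tau> z * P i (u i))) = f"
    unfolding P_def by (rule ext) (rule theta_lagrange_interpolation[OF \<tau> u z f f1 f\<tau>, symmetric])
  ultimately have "deriv f (u k) = (\<Sum>i\<in>UNIV. f (u i) * d i / (vtheta \<tau> z * P i (u i)))"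
    by (simp only: DERIV_imp_deriv)
  also have "\<dots> = f (u k) * d k / (vtheta \<tau> z * P k (u k)) + (\<Sum>i\<in>UNIV - {k}. f (u i) * d i / (vtheta \<tau> z * P i (u i)))"
    by (simp add: sum.remove[of UNIV k])
  also have "f (u k) * d k / (vtheta \<tau> z * P k (u k)) = (eisenstein_E1 \<tau> z + deriv (P k) (u k) / P k (u k)) * f (u k)"
    using z Pnz[of k] by (simp add: d_def eisenstein_E1_def field_simps)
  also have "(\<Sum>i\<in>UNIV - {k}. f (u i) * d i / (vtheta \<tau> z * P i (u i))) =
     (\<Sum>i\<in>UNIV - {k}. kronecker_phi \<tau> z (u k - u i) *
         ((\<Prod>m\<in>UNIV - {k}. vtheta \<tau> (u m - u k)) / (\<Prod>m\<in>UNIV - {i}. vtheta \<tau> (u m - u i))) * f (u i))"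
    unfolding Pneg
  proof (intro sum.cong refl)
    fix i assume "i \<in> UNIV - {k}"
    then show "f (u i) * d i / (vtheta \<tau> z * P i (u i)) = kronecker_phi \<tau> z (u k - u i) *
       ((-1) ^ (CARD('n) - 1) * P k (u k) / ((-1) ^ (CARD('n) - 1) * P i (u i))) * f (u i)"
      by (simp add: d_def kronecker_phi_def add.commute mult_ac)
  qed
  finally show ?thesis by (simp only: P_def[abs_def])
qed

section \<open>Interpolation applied to the entries of g\<close>

context
  fixes \<tau> :: complex and u :: "'n::finite \<Rightarrow> complex"
  assumes \<tau>: "Im \<tau> > 0" and u: "\<And>i j. i \<noteq> j \<Longrightarrow> vtheta \<tau> (u i - u j) \<noteq> 0"
begin

text \<open>Because of the factor N in front of v, unit steps of v move the argument by N and by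
  N\<tau>, both of which preserve the label. All N functions thus have the same multipliers, with
  the constant required by interpolation at the nodes u.\<close>

lemma btheta_dilated_multipliers:
  fixes z :: complex and i :: int
  defines "f \<equiv> \<lambda>v. btheta CARD('n) \<tau> i (z + of_nat CARD('n) * v - (\<Sum>m\<in>UNIV. u m))"
  shows "f holomorphic_on UNIV" "f (v + 1) = (-1) ^ CARD('n) * f v"
    "f (v + \<tau>) = (-1) ^ CARD('n) *
       exp (of_nat CARD('n) * - (pi * \<i> * \<tau> + 2 * pi * \<i> * v) + 2 * pi * \<i> * ((\<Sum>m\<in>UNIV. u m) - z)) * f v"
proof -
  have N: "CARD('n) > 0" by simp
  let ?N = "of_nat CARD('n) :: complex"
  have p: "exp (pi * \<i> * ?N) = (-1) ^ CARD('n)" 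
    using exp_of_nat_mult[of "CARD('n)" "pi * \<i>"] by (simp add: mult_ac)
  then have p': "exp (- (pi * \<i> * ?N)) = (-1) ^ CARD('n)"
    by (simp add: exp_minus power_inverse[symmetric])
  show "f holomorphic_on UNIV"
    unfolding f_def by (intro btheta_holomorphic_compose[OF \<tau> N] holomorphic_intros)
  show "f (v + 1) = (-1) ^ CARD('n) * f v"
    using btheta_add_N[OF \<tau> N, of i "z + ?N * v - (\<Sum>m\<in>UNIV. u m)" 1] p
    by (simp add: f_def algebra_simps)
  have "f (v + \<tau>) = btheta CARD('n) \<tau> i (z + ?N * v - (\<Sum>m\<in>UNIV. u m) + ?N * of_int 1 * \<tau>)"
    by (simp add: f_def algebra_simps)
  also have "\<dots> = exp (- (pi * \<i> * \<tau> * ?N * of_int 1 ^ 2) - 2 * pi * \<i> * of_int 1 * (z + ?N * v - (\<Sum>m\<in>UNIV. u m)) - pi * \<i> * ?N * of_int 1) * f v"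
    unfolding btheta_add_N_tau[OF \<tau> N] f_def ..
  also have "- (pi * \<i> * \<tau> * ?N * of_int 1 ^ 2) - 2 * pi * \<i> * of_int 1 * (z + ?N * v - (\<Sum>m\<in>UNIV. u m)) - pi * \<i> * ?N * of_int 1 =
     - (pi * \<i> * ?N) + (?N * - (pi * \<i> * \<tau> + 2 * pi * \<i> * v) + 2 * pi * \<i> * ((\<Sum>m\<in>UNIV. u m) - z))"
    by (simp add: algebra_simps)
  finally show "f (v + \<tau>) = (-1) ^ CARD('n) *
       exp (?N * - (pi * \<i> * \<tau> + 2 * pi * \<i> * v) + 2 * pi * \<i> * ((\<Sum>m\<in>UNIV. u m) - z)) * f v"
    unfolding exp_add p' .
qed

lemma btheta_interpolation:
  assumes "vtheta \<tau> z \<noteq> 0"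
  shows "btheta CARD('n) \<tau> i (z + of_nat CARD('n) * v - (\<Sum>m\<in>UNIV. u m)) =
    (\<Sum>k\<in>UNIV. btheta CARD('n) \<tau> i (z + of_nat CARD('n) * u k - (\<Sum>m\<in>UNIV. u m)) *
      (vtheta \<tau> (v - u k + z) * (\<Prod>m\<in>UNIV - {k}. vtheta \<tau> (v - u m))) /
      (vtheta \<tau> z * (\<Prod>m\<in>UNIV - {k}. vtheta \<tau> (u k - u m))))"
  by (rule theta_lagrange_interpolation[OF \<tau> u assms btheta_dilated_multipliers])

lemma btheta_interpolation_deriv:
  assumes "vtheta \<tau> z \<noteq> 0"
  shows "of_nat CARD('n) * deriv (btheta CARD('n) \<tau> i) (z + of_nat CARD('n) * u k - (\<Sum>m\<in>UNIV. u m)) =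
     (eisenstein_E1 \<tau> z + deriv (\<lambda>v. \<Prod>m\<in>UNIV - {k}. vtheta \<tau> (v - u m)) (u k) / (\<Prod>m\<in>UNIV - {k}. vtheta \<tau> (u k - u m)))
       * btheta CARD('n) \<tau> i (z + of_nat CARD('n) * u k - (\<Sum>m\<in>UNIV. u m))
     + (\<Sum>l\<in>UNIV - {k}. kronecker_phi \<tau> z (u k - u l) *
         ((\<Prod>m\<in>UNIV - {k}. vtheta \<tau> (u m - u k)) / (\<Prod>m\<in>UNIV - {l}. vtheta \<tau> (u m - u l))) *
         btheta CARD('n) \<tau> i (z + of_nat CARD('n) * u l - (\<Sum>m\<in>UNIV. u m)))"
proof -
  have "((\<lambda>v. btheta CARD('n) \<tau> i (z + of_nat CARD('n) * v - (\<Sum>m\<in>UNIV. u m))) has_field_derivative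
     deriv (btheta CARD('n) \<tau> i) (z + of_nat CARD('n) * u k - (\<Sum>m\<in>UNIV. u m)) * of_nat CARD('n)) (at (u k))"
    by (rule btheta_has_field_derivative[OF \<tau>]) (auto intro!: derivative_eq_intros)
  note d = DERIV_imp_deriv[OF this, symmetric]
  show ?thesis
    unfolding mult.commute[of "of_nat CARD('n)" "deriv _ _"] d
    by (rule theta_lagrange_interpolation_deriv[OF \<tau> u assms btheta_dilated_multipliers])
qed

end

section \<open>Matrices\<close>

lemma matrix_inv_mult:
  fixes A :: "complex^'n^'n"
  assumes "invertible A"
  shows "matrix_inv A ** A = mat 1" "A ** matrix_inv A = mat 1"
  using assms someI_ex[of "\<lambda>B. A ** B = mat 1 \<and> B ** A = mat 1"]
  by (auto simp: invertible_def matrix_inv_def)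

lemma matrix_inv_eqI:
  fixes A B :: "complex^'n^'n"
  assumes "A ** B = mat 1"
  shows "matrix_inv A = B"
proof -
  have BA: "B ** A = mat 1" using assms by (simp add: matrix_left_right_inverse)
  then have "invertible A" using assms by (auto simp: invertible_def)
  then have "matrix_inv A ** A = mat 1" by (rule matrix_inv_mult)
  then have "matrix_inv A ** A ** B = B" by simp
  then show ?thesis using assms by (simp add: matrix_mul_assoc[symmetric])
qed

text \<open>A family with the group law also contains the inverse as \<open>M (-1)\<close>, so
  negative powers come without a separate computation of \<open>matrix_inv\<close>.\<close>

lemma mat_powi_eqI:
  fixes M :: "int \<Rightarrow> complex^'n^'n"
  assumes 0: "M 0 = mat 1" and add: "\<And>a b. M a ** M b = M (a + b)"
  shows "mat_powi (M 1) a = M a"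
proof -
  have pow: "mat_pow (M b) n = M (b * int n)" for b n
    by (induction n) (simp_all add: 0 add algebra_simps)
  have "matrix_inv (M 1) = M (-1)" by (rule matrix_inv_eqI) (simp add: add 0)
  then show ?thesis by (simp add: mat_powi_def pow)
qed

lemma tensor_nth [simp]: "(A \<otimes>\<^sub>M B) $ (i, j) $ (k, l) = A $ i $ k * B $ j $ l"
  by (simp add: tensor_def)

lemma cscale_nth [simp]: "(c *\<^sub>M A) $ i $ j = c * A $ i $ j"
  by (simp add: cscale_def)

lemma sum_UNIV_prod: "(\<Sum>p\<in>UNIV. f p) = (\<Sum>i\<in>UNIV. \<Sum>j\<in>UNIV. f (i, j))"
  by (simp add: sum.cartesian_product)

lemma tensor_mult: "(A \<otimes>\<^sub>M B) ** (C \<otimes>\<^sub>M D) = (A ** C) \<otimes>\<^sub>M (B ** D)"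
  by (simp add: vec_eq_iff matrix_matrix_mult_def sum_UNIV_prod sum_product mult_ac)

lemma tensor_mat_1: "mat 1 \<otimes>\<^sub>M mat 1 = mat 1"
  by (simp add: vec_eq_iff mat_def)

lemma mat_unit_nth [simp]: "mat_unit a b $ i $ j = (if i = a \<and> j = b then 1 else 0)"
  by (simp add: mat_unit_def)

section \<open>The matrices T acting on vectors of theta functions\<close>

context
  fixes \<nu> :: "'n::finite \<Rightarrow> nat"
  assumes \<nu>: "bij_betw \<nu> UNIV {1..CARD('n)}"
begin

lemma label_eq_iff: "int CARD('n) dvd int (\<nu> i) - int (\<nu> k) \<longleftrightarrow> i = k"
proof
  assume *: "int CARD('n) dvd int (\<nu> i) - int (\<nu> k)"
  have "\<nu> i \<in> {1..CARD('n)}" "\<nu> k \<in> {1..CARD('n)}" using \<nu> by (auto simp: bij_betw_def)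
  then have "\<bar>int (\<nu> i) - int (\<nu> k)\<bar> < int CARD('n)" by auto
  with * have "\<nu> i = \<nu> k" using dvd_imp_le_int[of "int (\<nu> i) - int (\<nu> k)" "int CARD('n)"] by fastforce
  then show "i = k" using \<nu> by (auto simp: bij_betw_def inj_on_def)
qed simp

lemma ex_label: "\<exists>k. int CARD('n) dvd int (\<nu> k) - x"
proof -
  \<comment> \<open>The shift by one is due to labels running from 1 to N, so that residue 0 is
    represented by N.\<close>
  define r where "r = nat ((x - 1) mod int CARD('n)) + 1"
  have "(x - 1) mod int CARD('n) \<ge> 0" "nat ((x - 1) mod int CARD('n)) < CARD('n)"
    by (simp_all add: nat_less_iff)
  then have "r \<in> {1..CARD('n)}" "int r = (x - 1) mod int CARD('n) + 1" by (auto simp: r_def)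
  moreover from this obtain k where "r = \<nu> k" using \<nu> unfolding bij_betw_def by (metis rangeE)
  ultimately have "int (\<nu> k) - x = (x - 1) mod int CARD('n) - (x - 1)" by simp
  then have "int CARD('n) dvd int (\<nu> k) - x"
    by (metis dvd_minus_mod dvd_diff_commute)
  then show ?thesis ..
qed

lemma sum_label:
  assumes "int CARD('n) dvd int (\<nu> k0) - x"
  shows "(\<Sum>k\<in>UNIV. if int CARD('n) dvd x - int (\<nu> k) then f k else 0) = f k0"
proof -
  have "int CARD('n) dvd x - int (\<nu> k) \<longleftrightarrow> k = k0" for k
  proof -
    have "int CARD('n) dvd x - int (\<nu> k) \<longleftrightarrow> int CARD('n) dvd int (\<nu> k0) - int (\<nu> k)"
      using dvd_add_right_iff[OF assms, of "x - int (\<nu> k)"] by simp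
    then show ?thesis by (auto simp: label_eq_iff)
  qed
  then show ?thesis by simp
qed

lemma mat_powi_Q:
  "mat_powi (Q_mat \<nu>) a = (\<chi> i k. if i = k then exp (2 * pi * \<i> * of_int a * of_nat (\<nu> i) / of_nat CARD('n)) else 0)"
  (is "_ = ?M a")
proof -
  have "?M a ** ?M b = ?M (a + b)" for a b
  proof -
    have "(\<Sum>m\<in>UNIV. (if i = m then exp (2 * pi * \<i> * of_int a * of_nat (\<nu> i) / of_nat CARD('n)) else 0) *
        (if m = k then exp (2 * pi * \<i> * of_int b * of_nat (\<nu> m) / of_nat CARD('n)) else 0)) =
       (if i = k then exp (2 * pi * \<i> * of_int (a + b) * of_nat (\<nu> i) / of_nat CARD('n)) else 0)" for i k
      by (subst sum.remove[of UNIV i]) (auto simp: exp_add[symmetric] add_divide_distrib[symmetric] algebra_simps)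
    then show ?thesis by (simp only: vec_eq_iff matrix_matrix_mult_def vec_lambda_beta) simp
  qed
  moreover have "?M 0 = mat 1" by (simp add: vec_eq_iff mat_def)
  moreover have "Q_mat \<nu> = ?M 1" by (simp add: Q_mat_def vec_eq_iff)
  ultimately show ?thesis using mat_powi_eqI[of ?M a] by simp
qed

lemma mat_powi_Lambda:
  "mat_powi (Lambda_mat \<nu>) a = (\<chi> i k. if int CARD('n) dvd int (\<nu> i) + a - int (\<nu> k) then 1 else 0)"
  (is "_ = ?M a")
proof -
  have "?M a ** ?M b = ?M (a + b)" for a b
  proof -
    have "(\<Sum>m\<in>UNIV. (if int CARD('n) dvd int (\<nu> i) + a - int (\<nu> m) then 1 else 0) *
        (if int CARD('n) dvd int (\<nu> m) + b - int (\<nu> k) then 1 else 0)) =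
        (if int CARD('n) dvd int (\<nu> i) + (a + b) - int (\<nu> k) then 1 else (0::complex))" for i k
    proof -
      obtain k0 where k0: "int CARD('n) dvd int (\<nu> k0) - (int (\<nu> i) + a)" using ex_label by blast
      have "int CARD('n) dvd int (\<nu> k0) + b - int (\<nu> k) \<longleftrightarrow> int CARD('n) dvd int (\<nu> i) + (a + b) - int (\<nu> k)"
        using dvd_add_right_iff[OF k0, of "int (\<nu> i) + (a + b) - int (\<nu> k)"] by (simp add: algebra_simps)
      then show ?thesis
        using sum_label[OF k0, of "\<lambda>m. if int CARD('n) dvd int (\<nu> m) + b - int (\<nu> k) then 1 else (0::complex)"]
        by (simp add: if_distrib[of "\<lambda>t. t * _"] cong: if_cong)
    qed
    then show ?thesis by (simp only: vec_eq_iff matrix_matrix_mult_def vec_lambda_beta) simp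
  qed
  moreover have "?M 0 = mat 1" by (simp add: vec_eq_iff mat_def label_eq_iff)
  moreover have "Lambda_mat \<nu> = ?M 1"
    by (simp add: Lambda_mat_def vec_eq_iff dvd_eq_mod_eq_0 algebra_simps)
  ultimately show ?thesis using mat_powi_eqI[of ?M a] by simp
qed

lemma T_mat_nth:
  "T_mat \<nu> a1 a2 $ i $ k = exp (pi * \<i> * of_int a1 * of_int a2 / of_nat CARD('n)) *
     exp (2 * pi * \<i> * of_int a1 * of_nat (\<nu> i) / of_nat CARD('n)) *
     (if int CARD('n) dvd int (\<nu> i) + a2 - int (\<nu> k) then 1 else 0)"
proof -
  have "(mat_powi (Q_mat \<nu>) a1 ** mat_powi (Lambda_mat \<nu>) a2) $ i $ k =
     (\<Sum>m\<in>UNIV. if m = i then exp (2 * pi * \<i> * of_int a1 * of_nat (\<nu> i) / of_nat CARD('n)) *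
        (if int CARD('n) dvd int (\<nu> i) + a2 - int (\<nu> k) then 1 else 0) else 0)"
    unfolding mat_powi_Q mat_powi_Lambda matrix_matrix_mult_def
    by (simp only: vec_lambda_beta, intro sum.cong) auto
  then show ?thesis by (simp add: T_mat_def)
qed

context
  fixes \<tau> :: complex
  assumes \<tau>: "Im \<tau> > 0"
begin

text \<open>The power of \<open>Lambda_mat\<close> shifts the label by a2 and the power of
  \<open>Q_mat\<close> multiplies by a phase; the shifted label may leave 1..N and is read modulo
  N.\<close>

lemma T_mat_btheta:
  "(\<Sum>k\<in>UNIV. T_mat \<nu> a1 a2 $ i $ k * btheta CARD('n) \<tau> (int (\<nu> k)) x) =
    exp (pi * \<i> * of_int a1 * of_int a2 / of_nat CARD('n)) *
     exp (2 * pi * \<i> * of_int a1 * of_nat (\<nu> i) / of_nat CARD('n)) * btheta CARD('n) \<tau> (int (\<nu> i) + a2) x"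
proof -
  have N: "CARD('n) > 0" by simp
  obtain k0 where k0: "int CARD('n) dvd int (\<nu> k0) - (int (\<nu> i) + a2)" using ex_label by blast
  have "(\<Sum>k\<in>UNIV. T_mat \<nu> a1 a2 $ i $ k * btheta CARD('n) \<tau> (int (\<nu> k)) x) =
     (\<Sum>k\<in>UNIV. if int CARD('n) dvd int (\<nu> i) + a2 - int (\<nu> k) then
       exp (pi * \<i> * of_int a1 * of_int a2 / of_nat CARD('n)) *
     exp (2 * pi * \<i> * of_int a1 * of_nat (\<nu> i) / of_nat CARD('n)) * btheta CARD('n) \<tau> (int (\<nu> k)) x else 0)"
    unfolding T_mat_nth by (intro sum.cong) auto
  also have "\<dots> = exp (pi * \<i> * of_int a1 * of_int a2 / of_nat CARD('n)) *
     exp (2 * pi * \<i> * of_int a1 * of_nat (\<nu> i) / of_nat CARD('n)) * btheta CARD('n) \<tau> (int (\<nu> k0)) x"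
    by (rule sum_label[OF k0])
  also have "btheta CARD('n) \<tau> (int (\<nu> k0)) x = btheta CARD('n) \<tau> (int (\<nu> i) + a2) x"
    by (rule btheta_cong[OF \<tau> N k0])
  finally show ?thesis .
qed

lemma R_BB_btheta:
  "(\<Sum>k\<in>UNIV. \<Sum>l\<in>UNIV. R_BB \<tau> \<nu> h z $ (i, j) $ (k, l) *
      (btheta CARD('n) \<tau> (int (\<nu> k)) x * btheta CARD('n) \<tau> (int (\<nu> l)) y)) =
    deriv (vtheta \<tau>) 0 * belavin_sum \<tau> CARD('n) h (int (\<nu> i)) (int (\<nu> j)) z x y / (of_nat CARD('n) * vtheta \<tau> z)"
proof -
  let ?N = "CARD('n)"
  let ?b = "btheta ?N \<tau>"
  have R: "R_BB \<tau> \<nu> h z $ (i, j) $ (k, l) = (\<Sum>a2 = 0..<int ?N. \<Sum>a1 = 0..<int ?N. 1 / of_nat ?N *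
      phi_char ?N \<tau> h a1 a2 z * (T_mat \<nu> a1 a2 $ i $ k * T_mat \<nu> (- a1) (- a2) $ j $ l))" for k l
    unfolding R_BB_def by (subst sum.swap) (simp add: sum_distrib_left mult.assoc)
  have "(\<Sum>k\<in>UNIV. \<Sum>l\<in>UNIV. R_BB \<tau> \<nu> h z $ (i, j) $ (k, l) * (?b (int (\<nu> k)) x * ?b (int (\<nu> l)) y)) =
    (\<Sum>k\<in>UNIV. \<Sum>l\<in>UNIV. \<Sum>a2 = 0..<int ?N. \<Sum>a1 = 0..<int ?N. 1 / of_nat ?N * phi_char ?N \<tau> h a1 a2 z *
      ((T_mat \<nu> a1 a2 $ i $ k * ?b (int (\<nu> k)) x) * (T_mat \<nu> (- a1) (- a2) $ j $ l * ?b (int (\<nu> l)) y)))"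
    unfolding R sum_distrib_right by (simp only: mult_ac)
  also have "\<dots> = (\<Sum>a2 = 0..<int ?N. \<Sum>a1 = 0..<int ?N. \<Sum>k\<in>UNIV. \<Sum>l\<in>UNIV. 1 / of_nat ?N * phi_char ?N \<tau> h a1 a2 z *
      ((T_mat \<nu> a1 a2 $ i $ k * ?b (int (\<nu> k)) x) * (T_mat \<nu> (- a1) (- a2) $ j $ l * ?b (int (\<nu> l)) y)))"
    by (simp only: sum.swap[of _ "{0..<int ?N}" "UNIV :: 'n set"])
  also have "\<dots> = (\<Sum>a2 = 0..<int ?N. \<Sum>a1 = 0..<int ?N. 1 / of_nat ?N * phi_char ?N \<tau> h a1 a2 z *
      ((\<Sum>k\<in>UNIV. T_mat \<nu> a1 a2 $ i $ k * ?b (int (\<nu> k)) x) * (\<Sum>l\<in>UNIV. T_mat \<nu> (- a1) (- a2) $ j $ l * ?b (int (\<nu> l)) y)))"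
    by (simp only: sum_product) (simp only: sum_distrib_left)
  also have "\<dots> = (\<Sum>a2 = 0..<int ?N. \<Sum>a1 = 0..<int ?N. (deriv (vtheta \<tau>) 0 / (of_nat ?N * vtheta \<tau> z)) *
     (exp (2 * pi * \<i> * of_int a2 * z / of_nat ?N) *
     (vtheta \<tau> (z + (h + of_int a1 + of_int a2 * \<tau>) / of_nat ?N) / vtheta \<tau> ((h + of_int a1 + of_int a2 * \<tau>) / of_nat ?N)) *
     (exp (2 * pi * \<i> * of_int (a1 * a2 + a1 * (int (\<nu> i) - int (\<nu> j))) / of_nat ?N) *
      (?b (int (\<nu> i) + a2) x * ?b (int (\<nu> j) - a2) y))))"
  proof (intro sum.cong refl)
    fix a1 a2 :: int
    \<comment> \<open>The half-integral phases of \<open>T_mat\<close> at a and -a are equal, so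
      they add up to the integral phase a1 a2, while the diagonal phases leave the difference of the
      labels.\<close>
    have e: "exp (2 * pi * \<i> * of_int (a1 * a2 + a1 * (int (\<nu> i) - int (\<nu> j))) / of_nat ?N) =
       (exp (pi * \<i> * of_int a1 * of_int a2 / of_nat ?N) * exp (2 * pi * \<i> * of_int a1 * of_nat (\<nu> i) / of_nat ?N)) *
       (exp (pi * \<i> * of_int (- a1) * of_int (- a2) / of_nat ?N) * exp (2 * pi * \<i> * of_int (- a1) * of_nat (\<nu> j) / of_nat ?N))"
      unfolding exp_add[symmetric] by (rule arg_cong[where f = exp]) (simp add: field_simps)
    show "1 / of_nat ?N * phi_char ?N \<tau> h a1 a2 z *
      ((\<Sum>k\<in>UNIV. T_mat \<nu> a1 a2 $ i $ k * ?b (int (\<nu> k)) x) * (\<Sum>l\<in>UNIV. T_mat \<nu> (- a1) (- a2) $ j $ l * ?b (int (\<nu> l)) y)) =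
      (deriv (vtheta \<tau>) 0 / (of_nat ?N * vtheta \<tau> z)) *
     (exp (2 * pi * \<i> * of_int a2 * z / of_nat ?N) *
     (vtheta \<tau> (z + (h + of_int a1 + of_int a2 * \<tau>) / of_nat ?N) / vtheta \<tau> ((h + of_int a1 + of_int a2 * \<tau>) / of_nat ?N)) *
     (exp (2 * pi * \<i> * of_int (a1 * a2 + a1 * (int (\<nu> i) - int (\<nu> j))) / of_nat ?N) *
      (?b (int (\<nu> i) + a2) x * ?b (int (\<nu> j) - a2) y)))"
      unfolding T_mat_btheta phi_char_def kronecker_phi_def e
      by (simp add: mult_ac)
  qed
  also have "\<dots> = (deriv (vtheta \<tau>) 0 / (of_nat ?N * vtheta \<tau> z)) * belavin_sum \<tau> ?N h (int (\<nu> i)) (int (\<nu> j)) z x y"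
    unfolding belavin_sum_def sum_distrib_left ..
  finally show ?thesis by simp
qed

end

end

section \<open>Entries of the ACF matrix and of the twist matrix\<close>

lemma sum_nth2: "(\<Sum>i\<in>S. A i) $ p $ q = (\<Sum>i\<in>S. A i $ p $ q)"
  by (induction S rule: infinite_finite_induct) auto

lemma sum_off_diagonal_nth:
  fixes X :: "'n::finite \<Rightarrow> 'n \<Rightarrow> complex^'m^'k"
  assumes "\<And>i j. (i, j) \<noteq> (a, b) \<Longrightarrow> X i j $ P $ Q = 0"
  shows "(\<Sum>(i, j) | i \<noteq> j. f i j *\<^sub>M X i j) $ P $ Q = (if a \<noteq> b then f a b * X a b $ P $ Q else 0)"
proof -
  have "(\<Sum>(i, j) | i \<noteq> j. f i j *\<^sub>M X i j) $ P $ Q =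
     (\<Sum>t\<in>{(i, j). i \<noteq> j}. if t = (a, b) then f a b * X a b $ P $ Q else 0)"
    unfolding sum_nth2
  proof (intro sum.cong refl)
    fix t :: "'n \<times> 'n"
    obtain i j where "t = (i, j)" by force
    then show "(case t of (i, j) \<Rightarrow> f i j *\<^sub>M X i j) $ P $ Q = (if t = (a, b) then f a b * X a b $ P $ Q else 0)"
      using assms[of i j] by (auto simp: cscale_def)
  qed
  then show ?thesis by simp
qed

lemma sum_mat_unit_tensor_nth:
  "(\<Sum>(i, j) | i \<noteq> j. f i j *\<^sub>M (mat_unit i i \<otimes>\<^sub>M mat_unit j j)) $ (p, q) $ (k, l) =
     (if p \<noteq> q \<and> k = p \<and> l = q then f p q else 0)"
  "(\<Sum>(i, j) | i \<noteq> j. f i j *\<^sub>M (mat_unit i j \<otimes>\<^sub>M mat_unit j i)) $ (p, q) $ (k, l) =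
     (if p \<noteq> q \<and> k = q \<and> l = p then f p q else 0)"
  "(\<Sum>(i, j) | i \<noteq> j. f i j *\<^sub>M (mat_unit i j \<otimes>\<^sub>M mat_unit j j)) $ (p, q) $ (k, l) =
     (if p \<noteq> q \<and> k = q \<and> l = q then f p q else 0)"
  "(\<Sum>(i, j) | i \<noteq> j. f i j *\<^sub>M (mat_unit j j \<otimes>\<^sub>M mat_unit i j)) $ (p, q) $ (k, l) =
     (if p \<noteq> q \<and> k = p \<and> l = p then f q p else 0)"
proof -
  show "(\<Sum>(i, j) | i \<noteq> j. f i j *\<^sub>M (mat_unit i i \<otimes>\<^sub>M mat_unit j j)) $ (p, q) $ (k, l) =
     (if p \<noteq> q \<and> k = p \<and> l = q then f p q else 0)"
    by (rule trans[OF sum_off_diagonal_nth[where a = p and b = q]]) auto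
  show "(\<Sum>(i, j) | i \<noteq> j. f i j *\<^sub>M (mat_unit i j \<otimes>\<^sub>M mat_unit j i)) $ (p, q) $ (k, l) =
     (if p \<noteq> q \<and> k = q \<and> l = p then f p q else 0)"
    by (rule trans[OF sum_off_diagonal_nth[where a = p and b = q]]) auto
  show "(\<Sum>(i, j) | i \<noteq> j. f i j *\<^sub>M (mat_unit i j \<otimes>\<^sub>M mat_unit j j)) $ (p, q) $ (k, l) =
     (if p \<noteq> q \<and> k = q \<and> l = q then f p q else 0)"
    by (rule trans[OF sum_off_diagonal_nth[where a = p and b = q]]) auto
  show "(\<Sum>(i, j) | i \<noteq> j. f i j *\<^sub>M (mat_unit j j \<otimes>\<^sub>M mat_unit i j)) $ (p, q) $ (k, l) =
     (if p \<noteq> q \<and> k = p \<and> l = p then f q p else 0)"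
    by (rule trans[OF sum_off_diagonal_nth[where a = q and b = p]]) auto
qed

lemma sum_mat_unit_diagonal_nth:
  "(\<Sum>i\<in>UNIV. mat_unit i i \<otimes>\<^sub>M mat_unit i i) $ (p, q) $ (k, l) = (if p = q \<and> k = p \<and> l = p then 1 else 0)"
proof -
  have "(\<Sum>i\<in>UNIV. mat_unit i i \<otimes>\<^sub>M mat_unit i i) $ (p, q) $ (k, l) =
      (\<Sum>i\<in>UNIV. if i = p then (if p = q \<and> k = p \<and> l = p then 1 else 0) else 0)"
    unfolding sum_nth2 by (intro sum.cong) auto
  then show ?thesis by simp
qed

lemma R_ACF_nth:
  "R_ACF \<tau> h z1 z2 u $ (p, q) $ (k, l) =
    (if p \<noteq> q \<and> k = p \<and> l = q then kronecker_phi \<tau> h (u $ q - u $ p) else 0)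
  + (if p \<noteq> q \<and> k = q \<and> l = p then kronecker_phi \<tau> (z1 - z2) (u $ q - u $ p) else 0)
  - (if p \<noteq> q \<and> k = q \<and> l = q then kronecker_phi \<tau> (z1 + h) (u $ q - u $ p) else 0)
  + (if p \<noteq> q \<and> k = p \<and> l = p then kronecker_phi \<tau> z2 (u $ p - u $ q) else 0)
  + (if p = q \<and> k = p \<and> l = p then eisenstein_E1 \<tau> h + eisenstein_E1 \<tau> (z1 - z2) + eisenstein_E1 \<tau> z2
          - eisenstein_E1 \<tau> (z1 + h) else 0)"
  unfolding R_ACF_def vector_add_component vector_minus_component cscale_nth sum_mat_unit_tensor_nth
    sum_mat_unit_diagonal_nth by simp

lemma R_bar_nth:
  "R_bar \<tau> h z u $ (p, q) $ (k, l) = vtheta \<tau> h / deriv (vtheta \<tau>) 0 *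
    ((if p \<noteq> q \<and> k = p \<and> l = q then kronecker_phi \<tau> h (u $ q - u $ p) else 0)
   - (if p \<noteq> q \<and> k = q \<and> l = q then kronecker_phi \<tau> (z + h) (u $ q - u $ p) else 0)
   - (if p = q \<and> k = p \<and> l = p then kronecker_phi \<tau> (z + h) (- h) else 0))"
  unfolding R_bar_def vector_add_component vector_minus_component cscale_nth sum_mat_unit_tensor_nth
    sum_mat_unit_diagonal_nth by simp

lemma g_mat_nth:
  fixes \<nu> :: "'n::finite \<Rightarrow> nat"
  shows "g_mat \<tau> \<nu> z u $ i $ k = btheta CARD('n) \<tau> (int (\<nu> i)) (z + of_nat CARD('n) * u $ k - (\<Sum>m\<in>UNIV. u $ m)) /
     (\<Prod>m\<in>UNIV - {k}. vtheta \<tau> (u $ m - u $ k))"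
  by (simp add: g_mat_def btheta_def)

text \<open>The weight has the five-term shape of \<open>R_ACF_nth\<close>. In a column with k
  distinct from l only the diagonal and the exchange term survive.\<close>

lemma sum_two_indices:
  fixes F :: "'n::finite \<Rightarrow> 'n \<Rightarrow> complex"
  assumes "k \<noteq> l"
  shows "(\<Sum>p\<in>UNIV. \<Sum>q\<in>UNIV. F p q * ((if p \<noteq> q \<and> k = p \<and> l = q then a p q else 0) + (if p \<noteq> q \<and> k = q \<and> l = p then b p q else 0)
     - (if p \<noteq> q \<and> k = q \<and> l = q then c p q else 0) + (if p \<noteq> q \<and> k = p \<and> l = p then d p q else 0)
     + (if p = q \<and> k = p \<and> l = p then e else 0))) = F k l * a k l + F l k * b l k"
proof -
  have "(\<Sum>p\<in>UNIV. \<Sum>q\<in>UNIV. F p q * ((if p \<noteq> q \<and> k = p \<and> l = q then a p q else 0) + (if p \<noteq> q \<and> k = q \<and> l = p then b p q else 0)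
     - (if p \<noteq> q \<and> k = q \<and> l = q then c p q else 0) + (if p \<noteq> q \<and> k = p \<and> l = p then d p q else 0)
     + (if p = q \<and> k = p \<and> l = p then e else 0))) =
     (\<Sum>p\<in>UNIV. \<Sum>q\<in>UNIV. (if q = l then (if p = k then F k l * a k l else 0) else 0) + (if q = k then (if p = l then F l k * b l k else 0) else 0))"
    using assms by (intro sum.cong refl) auto
  then show ?thesis by (simp add: sum.distrib)
qed

text \<open>The complementary case of a column with equal indices: the two families moving one index
  survive, together with the diagonal coefficient e.\<close>

lemma sum_one_index:
  fixes F :: "'n::finite \<Rightarrow> 'n \<Rightarrow> complex"
  shows "(\<Sum>p\<in>UNIV. \<Sum>q\<in>UNIV. F p q * ((if p \<noteq> q \<and> k = p \<and> k = q then a p q else 0) + (if p \<noteq> q \<and> k = q \<and> k = p then b p q else 0)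
     - (if p \<noteq> q \<and> k = q \<and> k = q then c p q else 0) + (if p \<noteq> q \<and> k = p \<and> k = p then d p q else 0)
     + (if p = q \<and> k = p \<and> k = p then e else 0))) =
     F k k * e - (\<Sum>p\<in>UNIV - {k}. F p k * c p k) + (\<Sum>q\<in>UNIV - {k}. F k q * d k q)"
proof -
  have "(\<Sum>p\<in>UNIV. \<Sum>q\<in>UNIV. F p q * ((if p \<noteq> q \<and> k = p \<and> k = q then a p q else 0) + (if p \<noteq> q \<and> k = q \<and> k = p then b p q else 0)
     - (if p \<noteq> q \<and> k = q \<and> k = q then c p q else 0) + (if p \<noteq> q \<and> k = p \<and> k = p then d p q else 0)
     + (if p = q \<and> k = p \<and> k = p then e else 0))) =
     (\<Sum>p\<in>UNIV. \<Sum>q\<in>UNIV. (if q = k then (if p = k then F k k * e else - (F p k * c p k)) else 0)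
        + (if p = k then (if q = k then 0 else F k q * d k q) else 0))"
    by (intro sum.cong refl) auto
  also have "\<dots> = (\<Sum>p\<in>UNIV. if p = k then F k k * e else - (F p k * c p k)) + (\<Sum>q\<in>UNIV. if q = k then 0 else F k q * d k q)"
    by (simp add: sum.distrib if_distrib[of "\<lambda>f. sum f UNIV"] sum.swap[of "\<lambda>p q. if p = k then _ q else 0"])
  also have "\<dots> = F k k * e + (\<Sum>p\<in>UNIV - {k}. - (F p k * c p k)) + (\<Sum>q\<in>UNIV - {k}. F k q * d k q)"
    by (simp add: sum.remove[of UNIV k])
  finally show ?thesis by (simp add: sum_negf)
qed

section \<open>The intertwining relation between the two R-matrices\<close>

context
  fixes \<nu> :: "'n::finite \<Rightarrow> nat" and \<tau> :: complex and u :: "complex^'n"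
  assumes \<nu>: "bij_betw \<nu> UNIV {1..CARD('n)}" and \<tau>: "Im \<tau> > 0" and u: "u_regular \<tau> u"
begin

lemma u_nz: "i \<noteq> j \<Longrightarrow> vtheta \<tau> (u $ i - u $ j) \<noteq> 0"
  using u by (simp add: u_regular_def)

lemma R_BB_intertwines:
  assumes h: "vtheta \<tau> h \<noteq> 0" and z12: "vtheta \<tau> (z1 - z2) \<noteq> 0" and z1h: "vtheta \<tau> (z1 + h) \<noteq> 0" and z2: "vtheta \<tau> z2 \<noteq> 0"
    and nz: "\<And>a1 a2. a1 \<in> {0..<int CARD('n)} \<Longrightarrow> a2 \<in> {0..<int CARD('n)} \<Longrightarrow>
      vtheta \<tau> ((h + of_int a1 + of_int a2 * \<tau>) / of_nat CARD('n)) \<noteq> 0"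
  shows "R_BB \<tau> \<nu> h (z1 - z2) ** (g_mat \<tau> \<nu> z1 u \<otimes>\<^sub>M g_mat \<tau> \<nu> (z2 + h) u) =
    (g_mat \<tau> \<nu> (z1 + h) u \<otimes>\<^sub>M g_mat \<tau> \<nu> z2 u) ** R_ACF \<tau> h z1 z2 u"
proof -
  have N: "CARD('n) > 0" by simp
  let ?N = "of_nat CARD('n) :: complex"
  let ?b = "\<lambda>i. btheta CARD('n) \<tau> (int (\<nu> i))"
  define x where "x z k = z + ?N * u $ k - (\<Sum>m\<in>UNIV. u $ m)" for z k
  define P where "P k = (\<Prod>m\<in>UNIV - {k}. vtheta \<tau> (u $ m - u $ k))" for k
  define B where "B i j = belavin_sum \<tau> CARD('n) h (int (\<nu> i)) (int (\<nu> j)) (z1 - z2)" for i j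
  define c where "c = deriv (vtheta \<tau>) 0"
  have P: "P k \<noteq> 0" for k using u_nz by (auto simp: P_def)
  have g: "g_mat \<tau> \<nu> z u $ i $ k = ?b i (x z k) / P k" for z i k
    by (simp add: g_mat_nth x_def P_def)
  have L: "(R_BB \<tau> \<nu> h (z1 - z2) ** (g_mat \<tau> \<nu> z1 u \<otimes>\<^sub>M g_mat \<tau> \<nu> (z2 + h) u)) $ (i, j) $ (k, l) =
     c * B i j (x z1 k) (x (z2 + h) l) / (?N * vtheta \<tau> (z1 - z2)) / (P k * P l)" for i j k l
  proof -
    have "(R_BB \<tau> \<nu> h (z1 - z2) ** (g_mat \<tau> \<nu> z1 u \<otimes>\<^sub>M g_mat \<tau> \<nu> (z2 + h) u)) $ (i, j) $ (k, l) =
      (\<Sum>p\<in>UNIV. \<Sum>q\<in>UNIV. R_BB \<tau> \<nu> h (z1 - z2) $ (i, j) $ (p, q) * (?b p (x z1 k) * ?b q (x (z2 + h) l))) / (P k * P l)"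
      by (simp add: matrix_matrix_mult_def sum_UNIV_prod g sum_divide_distrib)
    then show ?thesis unfolding R_BB_btheta[OF \<nu> \<tau>] B_def c_def .
  qed
  have R: "((g_mat \<tau> \<nu> (z1 + h) u \<otimes>\<^sub>M g_mat \<tau> \<nu> z2 u) ** R_ACF \<tau> h z1 z2 u) $ (i, j) $ (k, l) =
     (\<Sum>p\<in>UNIV. \<Sum>q\<in>UNIV. (?b i (x (z1 + h) p) / P p * (?b j (x z2 q) / P q)) * R_ACF \<tau> h z1 z2 u $ (p, q) $ (k, l))" for i j k l
    by (simp add: matrix_matrix_mult_def sum_UNIV_prod g)
  have "(R_BB \<tau> \<nu> h (z1 - z2) ** (g_mat \<tau> \<nu> z1 u \<otimes>\<^sub>M g_mat \<tau> \<nu> (z2 + h) u)) $ (i, j) $ (k, l) =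
    ((g_mat \<tau> \<nu> (z1 + h) u \<otimes>\<^sub>M g_mat \<tau> \<nu> z2 u) ** R_ACF \<tau> h z1 z2 u) $ (i, j) $ (k, l)" for i j k l
  proof (cases "k = l")
    case False
    define v where "v = u $ k - u $ l"
    have v: "vtheta \<tau> v \<noteq> 0" using u_nz False by (simp add: v_def)
    \<comment> \<open>For v the difference of the coordinates, translation by Nv exchanges the
      columns k and l, and the spectral argument of the Belavin identity becomes z1 - z2.\<close>
    have e: "x z1 k - x z2 l - ?N * v = z1 - z2" "x z2 l + h = x (z2 + h) l" "x z1 k + h = x (z1 + h) k"
      "x (z1 + h) k - ?N * v = x (z1 + h) l" "x z2 l + ?N * v = x z2 k"
      by (simp_all add: x_def v_def algebra_simps)
    have id: "vtheta \<tau> v * B i j (x z1 k) (x (z2 + h) l) / ?N =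
      vtheta \<tau> (z1 - z2 + v) * (?b i (x (z1 + h) l) * ?b j (x z2 k)) -
      vtheta \<tau> (z1 - z2) * vtheta \<tau> (h - v) / vtheta \<tau> h * (?b i (x (z1 + h) k) * ?b j (x z2 l))"
      using belavin_identity[OF \<tau> N h nz, of v "int (\<nu> i)" "int (\<nu> j)" "x z1 k" "x z2 l"]
      unfolding e B_def by simp
    have "c * B i j (x z1 k) (x (z2 + h) l) / (?N * vtheta \<tau> (z1 - z2)) =
      c / (vtheta \<tau> v * vtheta \<tau> (z1 - z2)) * (vtheta \<tau> v * B i j (x z1 k) (x (z2 + h) l) / ?N)"
      using v by simp
    also have "\<dots> = kronecker_phi \<tau> h (- v) * (?b i (x (z1 + h) k) * ?b j (x z2 l)) +
        kronecker_phi \<tau> (z1 - z2) v * (?b i (x (z1 + h) l) * ?b j (x z2 k))"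
      unfolding id kronecker_phi_def c_def[symmetric] vtheta_minus using v z12 h by (simp add: field_simps)
    finally have "c * B i j (x z1 k) (x (z2 + h) l) / (?N * vtheta \<tau> (z1 - z2)) / (P k * P l) =
       (?b i (x (z1 + h) k) / P k * (?b j (x z2 l) / P l)) * kronecker_phi \<tau> h (u $ l - u $ k) +
       (?b i (x (z1 + h) l) / P l * (?b j (x z2 k) / P k)) * kronecker_phi \<tau> (z1 - z2) (u $ k - u $ l)"
      using P[of k] P[of l] by (simp add: v_def field_simps)
    then show ?thesis unfolding L R R_ACF_nth sum_two_indices[OF False] .
  next
    case True
    let ?z = "z1 - z2"
    let ?t = "vtheta \<tau>"
    have e: "x z1 k - x z2 k = ?z" "x z2 k + h = x (z2 + h) k" "x z1 k + h = x (z1 + h) k"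
      by (simp_all add: x_def algebra_simps)
    \<comment> \<open>\<open>K\<close> enters both derivatives below with the same coefficient 1 and
      disappears from their difference.\<close>
    define K where "K = deriv (\<lambda>v. \<Prod>m\<in>UNIV - {k}. ?t (v - u $ m)) (u $ k) / (\<Prod>m\<in>UNIV - {k}. ?t (u $ k - u $ m))"
    define S1 where "S1 = (\<Sum>p\<in>UNIV - {k}. kronecker_phi \<tau> (z1 + h) (u $ k - u $ p) * (P k / P p) * ?b i (x (z1 + h) p))"
    define S2 where "S2 = (\<Sum>q\<in>UNIV - {k}. kronecker_phi \<tau> z2 (u $ k - u $ q) * (P k / P q) * ?b j (x z2 q))"
    have d1: "?N * deriv (?b i) (x (z1 + h) k) = (eisenstein_E1 \<tau> (z1 + h) + K) * ?b i (x (z1 + h) k) + S1"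
      using btheta_interpolation_deriv[where u = "\<lambda>m. u $ m" and k = k and i = "int (\<nu> i)", OF \<tau> u_nz z1h]
      by (simp add: x_def P_def K_def S1_def)
    have d2: "?N * deriv (?b j) (x z2 k) = (eisenstein_E1 \<tau> z2 + K) * ?b j (x z2 k) + S2"
      using btheta_interpolation_deriv[where u = "\<lambda>m. u $ m" and k = k and i = "int (\<nu> j)", OF \<tau> u_nz z2]
      by (simp add: x_def P_def K_def S2_def)
    have id: "c * B i j (x z1 k) (x (z2 + h) k) / ?N =
       (deriv ?t ?z + ?t ?z * deriv ?t h / ?t h) * (?b i (x (z1 + h) k) * ?b j (x z2 k))
      - ?t ?z * ((?N * deriv (?b i) (x (z1 + h) k)) * ?b j (x z2 k))
      + ?t ?z * (?b i (x (z1 + h) k) * (?N * deriv (?b j) (x z2 k)))"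
      using belavin_identity_deriv[OF \<tau> N h nz, of "int (\<nu> i)" "int (\<nu> j)" "x z1 k" "x z2 k"]
      unfolding e B_def c_def by (simp add: mult_ac)
    have "c * B i j (x z1 k) (x (z2 + h) k) / (?N * ?t ?z) = (c * B i j (x z1 k) (x (z2 + h) k) / ?N) / ?t ?z"
      by simp
    also have "\<dots> = (eisenstein_E1 \<tau> h + eisenstein_E1 \<tau> ?z + eisenstein_E1 \<tau> z2 - eisenstein_E1 \<tau> (z1 + h)) *
        (?b i (x (z1 + h) k) * ?b j (x z2 k)) - S1 * ?b j (x z2 k) + ?b i (x (z1 + h) k) * S2"
    proof -
      have r: "deriv ?t ?z + ?t ?z * deriv ?t h / ?t h = ?t ?z * (eisenstein_E1 \<tau> ?z + eisenstein_E1 \<tau> h)"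
        using z12 h by (simp add: eisenstein_E1_def field_simps)
      have "c * B i j (x z1 k) (x (z2 + h) k) / ?N = ?t ?z *
         ((eisenstein_E1 \<tau> h + eisenstein_E1 \<tau> ?z + eisenstein_E1 \<tau> z2 - eisenstein_E1 \<tau> (z1 + h)) *
          (?b i (x (z1 + h) k) * ?b j (x z2 k)) - S1 * ?b j (x z2 k) + ?b i (x (z1 + h) k) * S2)"
        unfolding id r d1 d2 by (simp add: algebra_simps)
      then show ?thesis using z12 by simp
    qed
    finally have main: "c * B i j (x z1 k) (x (z2 + h) k) / (?N * ?t ?z) / (P k * P k) =
       ((eisenstein_E1 \<tau> h + eisenstein_E1 \<tau> ?z + eisenstein_E1 \<tau> z2 - eisenstein_E1 \<tau> (z1 + h)) *
        (?b i (x (z1 + h) k) * ?b j (x z2 k)) - S1 * ?b j (x z2 k) + ?b i (x (z1 + h) k) * S2) / (P k * P k)"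
      by simp
    have S1: "(\<Sum>p\<in>UNIV - {k}. ?b i (x (z1 + h) p) / P p * (?b j (x z2 k) / P k) * kronecker_phi \<tau> (z1 + h) (u $ k - u $ p)) =
       S1 * ?b j (x z2 k) / (P k * P k)"
      unfolding S1_def sum_distrib_right sum_divide_distrib using P by (intro sum.cong refl) (simp add: field_simps)
    have S2: "(\<Sum>q\<in>UNIV - {k}. ?b i (x (z1 + h) k) / P k * (?b j (x z2 q) / P q) * kronecker_phi \<tau> z2 (u $ k - u $ q)) =
       ?b i (x (z1 + h) k) * S2 / (P k * P k)"
      unfolding S2_def sum_distrib_left sum_divide_distrib using P by (intro sum.cong refl) (simp add: field_simps)
    show ?thesis
      unfolding L R R_ACF_nth True[symmetric] sum_one_index S1 S2 main
      using P[of k] by (simp add: add_divide_distrib diff_divide_distrib mult_ac)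
  qed
  then show ?thesis by (simp add: vec_eq_iff split_paired_all)
qed

end

section \<open>The twist identity\<close>

lemma g_inv1_shift2_nth:
  "g_inv1_shift2 \<tau> \<nu> h z u $ (p, q) $ (r, s) =
     (if s = q then matrix_inv (g_mat \<tau> \<nu> z (u + axis q h)) $ p $ r else 0)"
proof -
  have "g_inv1_shift2 \<tau> \<nu> h z u $ (p, q) $ (r, s) =
    (\<Sum>k\<in>UNIV. if k = q then (if s = q then matrix_inv (g_mat \<tau> \<nu> z (u + axis q h)) $ p $ r else 0) else 0)"
    unfolding g_inv1_shift2_def sum_nth2 by (intro sum.cong) auto
  then show ?thesis by simp
qed

context
  fixes \<nu> :: "'n::finite \<Rightarrow> nat" and \<tau> :: complex
  assumes \<nu>: "bij_betw \<nu> UNIV {1..CARD('n)}" and \<tau>: "Im \<tau> > 0"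
begin

text \<open>The twist matrix preserves the index q of the second factor, so it splits into N blocks.
  The block for q is compared with g at the nodes where only the q-th coordinate is moved by
  h.\<close>

lemma g_mat_shift_R_bar:
  fixes u :: "complex^'n"
  assumes u: "u_regular \<tau> u" and u': "u_regular \<tau> (u + axis q h)"
    and h: "vtheta \<tau> h \<noteq> 0" and zh: "vtheta \<tau> (z + h) \<noteq> 0"
  shows "g_mat \<tau> \<nu> (z + h) (u + axis q h) ** (\<chi> p k. R_bar \<tau> h z u $ (p, q) $ (k, q)) = g_mat \<tau> \<nu> z u"
proof -
  let ?N = "of_nat CARD('n) :: complex"
  let ?t = "vtheta \<tau>"
  let ?b = "\<lambda>i. btheta CARD('n) \<tau> (int (\<nu> i))"
  define w where "w m = (u + axis q h) $ m" for m
  have w: "w m = (if m = q then u $ q + h else u $ m)" for m by (simp add: w_def axis_def)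
  have sw: "(\<Sum>m\<in>UNIV. w m) = (\<Sum>m\<in>UNIV. u $ m) + h"
    by (simp add: w_def axis_def sum.distrib)
  have dw: "?t (w i - w j) \<noteq> 0" if "i \<noteq> j" for i j
    using u' that unfolding w_def u_regular_def by blast
  have du: "?t (u $ i - u $ j) \<noteq> 0" if "i \<noteq> j" for i j
    using u that unfolding u_regular_def by blast
  define P where "P k = (\<Prod>m\<in>UNIV - {k}. ?t (u $ m - u $ k))" for k
  define W where "W k = (\<Prod>m\<in>UNIV - {k}. ?t (w m - w k))" for k
  have P: "P k \<noteq> 0" and W: "W k \<noteq> 0" for k using du dw by (auto simp: P_def W_def)
  define c where "c = deriv ?t 0"
  have c: "c \<noteq> 0" unfolding c_def by (rule deriv_vtheta_0[OF \<tau>])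
  define x where "x k = z + ?N * u $ k - (\<Sum>m\<in>UNIV. u $ m)" for k
  define y where "y k = z + h + ?N * w k - (\<Sum>m\<in>UNIV. w m)" for k
  have g: "g_mat \<tau> \<nu> z u $ i $ k = ?b i (x k) / P k" for i k
    by (simp add: g_mat_nth x_def P_def)
  have gw: "g_mat \<tau> \<nu> (z + h) (u + axis q h) $ i $ k = ?b i (y k) / W k" for i k
    unfolding g_mat_nth w_def[symmetric] y_def W_def ..
  \<comment> \<open>Accounts for reversing the N - 1 differences in a product.\<close>
  define sgn where "sgn = (-1 :: complex) ^ (CARD('n) - 1)"
  have sgn: "sgn \<noteq> 0" by (simp add: sgn_def)
  have neg: "(\<Prod>m\<in>UNIV - {k}. ?t (f m - a)) = sgn * (\<Prod>m\<in>UNIV - {k}. ?t (a - f m))" for f :: "'n \<Rightarrow> complex" and a k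
  proof -
    have "?t (f m - a) = (-1) * ?t (a - f m)" for m
      using vtheta_minus[of \<tau> "a - f m"] by simp
    then show ?thesis by (simp only: sgn_def prod.distrib prod_constant) (simp add: card_Diff_singleton)
  qed
  have "(\<Sum>p\<in>UNIV. ?b i (y p) / W p * R_bar \<tau> h z u $ (p, q) $ (k, q)) = ?b i (x k) / P k" for i k
  proof (cases "k = q")
    case False
    have "(\<Sum>p\<in>UNIV. ?b i (y p) / W p * R_bar \<tau> h z u $ (p, q) $ (k, q)) =
      (\<Sum>p\<in>UNIV. if p = k then ?b i (y k) / W k * (?t h / c * kronecker_phi \<tau> h (u $ q - u $ k)) else 0)"
      unfolding R_bar_nth c_def using False by (intro sum.cong refl) auto
    also have "\<dots> = ?b i (y k) / W k * (?t h / c * kronecker_phi \<tau> h (u $ q - u $ k))" by simp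
    \<comment> \<open>The h added to z cancels the h added to the sum of the coordinates, so off the
      column q only the denominators of g change.\<close>
    also have "y k = x k" unfolding y_def x_def sw w using False by simp
    also have "W k = ?t (u $ q + h - u $ k) * (\<Prod>m\<in>UNIV - {k} - {q}. ?t (u $ m - u $ k))"
      unfolding W_def w using False by (subst prod.remove[of _ q]) auto
    also have "?t h / c * kronecker_phi \<tau> h (u $ q - u $ k) = ?t (u $ q + h - u $ k) / ?t (u $ q - u $ k)"
      using h c by (simp add: kronecker_phi_def c_def[symmetric] algebra_simps)
    also have "?b i (x k) / (?t (u $ q + h - u $ k) * (\<Prod>m\<in>UNIV - {k} - {q}. ?t (u $ m - u $ k))) * (?t (u $ q + h - u $ k) / ?t (u $ q - u $ k))
        = ?b i (x k) / (?t (u $ q - u $ k) * (\<Prod>m\<in>UNIV - {k} - {q}. ?t (u $ m - u $ k)))"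
      using dw[of q k] False by (simp add: w)
    also have "?t (u $ q - u $ k) * (\<Prod>m\<in>UNIV - {k} - {q}. ?t (u $ m - u $ k)) = P k"
      unfolding P_def using False by (subst prod.remove[of "UNIV - {k}" q]) auto
    finally show ?thesis .
  next
    case True
    \<comment> \<open>In column q the unshifted coordinate is no longer a node; its theta value is
      expanded by interpolation at the shifted nodes, and the coefficients turn out to be the
      entries of the twist matrix.\<close>
    have "?b i (x q) = ?b i (z + h + ?N * u $ q - (\<Sum>m\<in>UNIV. w m))"
      unfolding sw x_def by (simp add: algebra_simps)
    also have "\<dots> = (\<Sum>p\<in>UNIV. ?b i (y p) * (?t (u $ q - w p + (z + h)) * (\<Prod>m\<in>UNIV - {p}. ?t (u $ q - w m))) /
       (?t (z + h) * (\<Prod>m\<in>UNIV - {p}. ?t (w p - w m))))"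
      unfolding y_def by (rule btheta_interpolation[OF \<tau> dw zh])
    finally have id: "?b i (x q) / P q = (\<Sum>p\<in>UNIV. ?b i (y p) * (?t (u $ q - w p + (z + h)) * (\<Prod>m\<in>UNIV - {p}. ?t (u $ q - w m))) /
       (?t (z + h) * (\<Prod>m\<in>UNIV - {p}. ?t (w p - w m))) / P q)"
      by (simp add: sum_divide_distrib)
    also have "\<dots> = (\<Sum>p\<in>UNIV. ?b i (y p) / W p * R_bar \<tau> h z u $ (p, q) $ (q, q))"
    proof (intro sum.cong refl)
      fix p
      have Wp: "W p = sgn * (\<Prod>m\<in>UNIV - {p}. ?t (w p - w m))" unfolding W_def by (rule neg)
      have Pq: "P q = sgn * (\<Prod>m\<in>UNIV - {q}. ?t (u $ q - u $ m))" unfolding P_def by (rule neg)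
      have "?t (u $ q - w p + (z + h)) * (\<Prod>m\<in>UNIV - {p}. ?t (u $ q - w m)) / ?t (z + h) =
         R_bar \<tau> h z u $ (p, q) $ (q, q) * (\<Prod>m\<in>UNIV - {q}. ?t (u $ q - u $ m))"
      proof (cases "p = q")
        case True
        have e1: "(\<Prod>m\<in>UNIV - {q}. ?t (u $ q - w m)) = (\<Prod>m\<in>UNIV - {q}. ?t (u $ q - u $ m))"
          by (intro prod.cong) (auto simp: w)
        have e2: "R_bar \<tau> h z u $ (q, q) $ (q, q) = ?t z / ?t (z + h)"
          unfolding R_bar_nth kronecker_phi_def c_def[symmetric] vtheta_minus using h c by simp
        have e3: "u $ q - w q + (z + h) = z" by (simp add: w)
        show ?thesis unfolding True e1 e2 e3 by simp
      next
        case False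
        have set: "UNIV - {q} - {p} = UNIV - {p} - {q}" by blast
        have e1: "(\<Prod>m\<in>UNIV - {p}. ?t (u $ q - w m)) = ?t (- h) * (\<Prod>m\<in>UNIV - {p} - {q}. ?t (u $ q - u $ m))"
          using False by (subst prod.remove[of _ q]) (auto simp: w intro!: prod.cong)
        have e2: "(\<Prod>m\<in>UNIV - {q}. ?t (u $ q - u $ m)) = ?t (u $ q - u $ p) * (\<Prod>m\<in>UNIV - {p} - {q}. ?t (u $ q - u $ m))"
          using False by (subst prod.remove[of _ p]) (auto simp: set)
        have e3: "R_bar \<tau> h z u $ (p, q) $ (q, q) = - ?t h * ?t (z + h + (u $ q - u $ p)) / (?t (z + h) * ?t (u $ q - u $ p))"
          unfolding R_bar_nth kronecker_phi_def c_def[symmetric] using c False by simp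
        have e4: "u $ q - w p + (z + h) = z + h + (u $ q - u $ p)" using False by (simp add: w)
        show ?thesis unfolding e1 e2 e3 e4 vtheta_minus using du[of q p] False by simp
      qed
      then have "?b i (y p) * (?t (u $ q - w p + (z + h)) * (\<Prod>m\<in>UNIV - {p}. ?t (u $ q - w m))) / (?t (z + h) * A) / P q =
          ?b i (y p) / A * (R_bar \<tau> h z u $ (p, q) $ (q, q) * (P q / sgn)) / P q" for A
        unfolding Pq using sgn zh by (simp add: field_simps)
      then show "?b i (y p) * (?t (u $ q - w p + (z + h)) * (\<Prod>m\<in>UNIV - {p}. ?t (u $ q - w m))) /
         (?t (z + h) * (\<Prod>m\<in>UNIV - {p}. ?t (w p - w m))) / P q = ?b i (y p) / W p * R_bar \<tau> h z u $ (p, q) $ (q, q)"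
        unfolding Wp using sgn P[of q] by simp
    qed
    finally show ?thesis using True by simp
  qed
  then show ?thesis
    by (simp add: vec_eq_iff matrix_matrix_mult_def g gw)
qed

text \<open>The dynamical shift is governed by the second index, which both sides preserve, so the
  identity is assembled block by block.\<close>

lemma R_bar_twist:
  fixes u :: "complex^'n"
  assumes u: "u_regular \<tau> u" and u': "\<And>k. u_regular \<tau> (u + axis k h)"
    and h: "vtheta \<tau> h \<noteq> 0" and zh: "vtheta \<tau> (z + h) \<noteq> 0"
    and inv: "\<And>k. invertible (g_mat \<tau> \<nu> (z + h) (u + axis k h))"
  shows "R_bar \<tau> h z u = g_inv1_shift2 \<tau> \<nu> h (z + h) u ** leg1 (g_mat \<tau> \<nu> z u)"
proof -
  have "R_bar \<tau> h z u $ (p, q) $ (k, l) = (g_inv1_shift2 \<tau> \<nu> h (z + h) u ** leg1 (g_mat \<tau> \<nu> z u)) $ (p, q) $ (k, l)" for p q k l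
  proof -
    let ?G = "g_mat \<tau> \<nu> (z + h) (u + axis q h)"
    have "matrix_inv ?G ** g_mat \<tau> \<nu> z u = (\<chi> p k. R_bar \<tau> h z u $ (p, q) $ (k, q))"
      unfolding g_mat_shift_R_bar[OF u u' h zh, of q, symmetric] matrix_mul_assoc matrix_inv_mult(1)[OF inv] by simp
    then have "(\<Sum>r\<in>UNIV. matrix_inv ?G $ p $ r * g_mat \<tau> \<nu> z u $ r $ k) = R_bar \<tau> h z u $ (p, q) $ (k, q)"
      by (simp add: vec_eq_iff matrix_matrix_mult_def)
    moreover have "(g_inv1_shift2 \<tau> \<nu> h (z + h) u ** leg1 (g_mat \<tau> \<nu> z u)) $ (p, q) $ (k, l) =
       (\<Sum>r\<in>UNIV. \<Sum>s\<in>UNIV. if s = q then (if q = l then matrix_inv ?G $ p $ r * g_mat \<tau> \<nu> z u $ r $ k else 0) else 0)"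
      unfolding matrix_matrix_mult_def vec_lambda_beta sum_UNIV_prod leg1_def
      by (intro sum.cong refl) (auto simp: g_inv1_shift2_nth mat_def)
    moreover have "R_bar \<tau> h z u $ (p, q) $ (k, l) = 0" if "q \<noteq> l"
      using that unfolding R_bar_nth by auto
    ultimately show ?thesis by (cases "q = l") auto
  qed
  then show ?thesis by (simp add: vec_eq_iff split_paired_all)
qed

text \<open>The functions are eigenfunctions of x \<mapsto> x + 1 with distinct eigenvalues, since
  their labels are incongruent modulo N. A character sum over N translates projects onto the k-th
  one.\<close>

lemma btheta_linear_independent:
  assumes "\<And>x. (\<Sum>i\<in>UNIV. c i * btheta CARD('n) \<tau> (int (\<nu> i)) x) = 0"
  shows "c k = 0"
proof -
  let ?N = "of_nat CARD('n) :: complex"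
  let ?b = "\<lambda>i. btheta CARD('n) \<tau> (int (\<nu> i))"
  have N: "CARD('n) > 0" by simp
  have zero: "?N * c k * ?b k x = 0" for x
  proof -
    have "0 = (\<Sum>m = 0..<int CARD('n). exp (- (2 * pi * \<i> * (1/2 - of_int (int (\<nu> k)) / ?N) * of_int m)) *
        (\<Sum>i\<in>UNIV. c i * ?b i (x + of_int m)))"
      unfolding assms by simp
    also have "\<dots> = (\<Sum>m = 0..<int CARD('n). \<Sum>i\<in>UNIV. c i * ?b i x * exp (2 * pi * \<i> * of_int m * of_int (int (\<nu> k) - int (\<nu> i)) / ?N))"
    proof (intro sum.cong refl)
      fix m
      have "exp (- (2 * pi * \<i> * (1/2 - of_int (int (\<nu> k)) / ?N) * of_int m)) * (c i * ?b i (x + of_int m)) =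
         c i * ?b i x * exp (2 * pi * \<i> * of_int m * of_int (int (\<nu> k) - int (\<nu> i)) / ?N)" for i
      proof -
        have "exp (2 * pi * \<i> * of_int m * of_int (int (\<nu> k) - int (\<nu> i)) / ?N) =
          exp (- (2 * pi * \<i> * (1/2 - of_int (int (\<nu> k)) / ?N) * of_int m)) * exp (2 * pi * \<i> * (1/2 - of_int (int (\<nu> i)) / ?N) * of_int m)"
          unfolding exp_add[symmetric] by (rule arg_cong[where f = exp]) (simp add: field_simps)
        then show ?thesis unfolding btheta_add_int[OF \<tau> N] by (simp only: mult_ac)
      qed
      then show "exp (- (2 * pi * \<i> * (1/2 - of_int (int (\<nu> k)) / ?N) * of_int m)) * (\<Sum>i\<in>UNIV. c i * ?b i (x + of_int m)) =
        (\<Sum>i\<in>UNIV. c i * ?b i x * exp (2 * pi * \<i> * of_int m * of_int (int (\<nu> k) - int (\<nu> i)) / ?N))"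
        unfolding sum_distrib_left by (intro sum.cong refl)
    qed
    also have "\<dots> = (\<Sum>i\<in>UNIV. c i * ?b i x * (\<Sum>m = 0..<int CARD('n). exp (2 * pi * \<i> * of_int m * of_int (int (\<nu> k) - int (\<nu> i)) / ?N)))"
      by (subst sum.swap) (simp only: sum_distrib_left)
    also have "\<dots> = (\<Sum>i\<in>UNIV. if i = k then ?N * c k * ?b k x else 0)"
      unfolding sum_exp_roots_of_unity_int[OF N] label_eq_iff[OF \<nu>] by (intro sum.cong refl) auto
    finally show ?thesis by simp
  qed
  obtain x where "?b k x \<noteq> 0"
    unfolding btheta_def by (rule theta_char_not_identically_0[of "?N * \<tau>" "1/2 - of_int (int (\<nu> k)) / ?N" "?N / 2"])
      (use \<tau> in auto)
  then show ?thesis using zero[of x] by simp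
qed

text \<open>A vanishing combination of the rows is a combination of theta functions that is zero at
  the N arguments given by the nodes. Interpolation makes it zero identically, and independence
  makes its coefficients zero.\<close>

lemma g_mat_invertible:
  fixes u :: "complex^'n"
  assumes u: "u_regular \<tau> u" and z: "vtheta \<tau> z \<noteq> 0"
  shows "invertible (g_mat \<tau> \<nu> z u)"
  unfolding invertible_right_inverse matrix_right_invertible_independent_rows
proof (intro allI impI)
  fix c and k :: 'n
  let ?N = "of_nat CARD('n) :: complex"
  let ?b = "\<lambda>i. btheta CARD('n) \<tau> (int (\<nu> i))"
  define x where "x k = z + ?N * u $ k - (\<Sum>m\<in>UNIV. u $ m)" for k
  have du: "vtheta \<tau> (u $ i - u $ j) \<noteq> 0" if "i \<noteq> j" for i j
    using u that unfolding u_regular_def by blast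
  assume "(\<Sum>i\<in>UNIV. c i *s row i (g_mat \<tau> \<nu> z u)) = 0"
  then have "(\<Sum>i\<in>UNIV. c i * g_mat \<tau> \<nu> z u $ i $ j) = 0" for j
    by (simp add: vec_eq_iff row_def)
  then have "(\<Sum>i\<in>UNIV. c i * ?b i (x j)) / (\<Prod>m\<in>UNIV - {j}. vtheta \<tau> (u $ m - u $ j)) = 0" for j
    by (simp add: g_mat_nth x_def sum_divide_distrib)
  moreover have "(\<Prod>m\<in>UNIV - {j}. vtheta \<tau> (u $ m - u $ j)) \<noteq> 0" for j
    using du by auto
  ultimately have 0: "(\<Sum>i\<in>UNIV. c i * ?b i (x j)) = 0" for j
    by (metis divide_eq_0_iff)
  have "(\<Sum>i\<in>UNIV. c i * ?b i y) = 0" for y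
  proof -
    \<comment> \<open>Every argument y is reached by v since N is nonzero, so interpolation covers
      the whole plane.\<close>
    define v where "v = (y - z + (\<Sum>m\<in>UNIV. u $ m)) / ?N"
    have y: "y = z + ?N * v - (\<Sum>m\<in>UNIV. u $ m)" by (simp add: v_def)
    define C where "C j = vtheta \<tau> (v - u $ j + z) * (\<Prod>m\<in>UNIV - {j}. vtheta \<tau> (v - u $ m)) /
        (vtheta \<tau> z * (\<Prod>m\<in>UNIV - {j}. vtheta \<tau> (u $ j - u $ m)))" for j
    have "?b i y = (\<Sum>j\<in>UNIV. ?b i (x j) * C j)" for i
      using btheta_interpolation[where u = "\<lambda>m. u $ m", OF \<tau> du z, of "int (\<nu> i)" v]
      by (simp add: y x_def C_def)
    then have "(\<Sum>i\<in>UNIV. c i * ?b i y) = (\<Sum>i\<in>UNIV. \<Sum>j\<in>UNIV. c i * ?b i (x j) * C j)"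
      by (simp add: sum_distrib_left mult.assoc)
    also have "\<dots> = (\<Sum>j\<in>UNIV. (\<Sum>i\<in>UNIV. c i * ?b i (x j)) * C j)"
      by (subst sum.swap) (simp only: sum_distrib_right)
    finally show ?thesis by (simp add: 0)
  qed
  then show "c k = 0" by (rule btheta_linear_independent)
qed

end

section \<open>The domains of the identities\<close>

lemma dense_open_Int:
  fixes A B :: "'a::topological_space set"
  assumes "open A" "closure A = UNIV" "open B" "closure B = UNIV"
  shows "open (A \<inter> B)" "closure (A \<inter> B) = UNIV"
proof -
  show "open (A \<inter> B)" using assms by blast
  have "A \<subseteq> closure (A \<inter> B)"
    using open_Int_closure_subset[OF assms(1), of B] assms(4) by simp
  then have "closure A \<subseteq> closure (A \<inter> B)" by (rule closure_minimal) simp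
  then show "closure (A \<inter> B) = UNIV" using assms(2) by auto
qed

lemma dense_open_INT:
  fixes A :: "'i \<Rightarrow> 'a::topological_space set"
  assumes "finite I" "\<And>i. i \<in> I \<Longrightarrow> open (A i)" "\<And>i. i \<in> I \<Longrightarrow> closure (A i) = UNIV"
  shows "open (\<Inter>i\<in>I. A i)" "closure (\<Inter>i\<in>I. A i) = UNIV"
proof -
  have "open (\<Inter>i\<in>I. A i) \<and> closure (\<Inter>i\<in>I. A i) = UNIV"
    using assms
  proof (induction I rule: finite_induct)
    case (insert i I)
    then have "open (A i)" "closure (A i) = UNIV" "open (\<Inter>i\<in>I. A i)" "closure (\<Inter>i\<in>I. A i) = UNIV" by auto
    from dense_open_Int[OF this] show ?case by simp
  qed simp
  then show "open (\<Inter>i\<in>I. A i)" "closure (\<Inter>i\<in>I. A i) = UNIV" by auto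
qed

lemma continuous_on_vtheta:
  assumes "Im \<tau> > 0" "continuous_on S f"
  shows "continuous_on S (\<lambda>p. vtheta \<tau> (f p))"
  by (rule continuous_on_compose2[OF holomorphic_on_imp_continuous_on[OF vtheta_holomorphic_UNIV[OF assms(1)]] assms(2)]) simp

lemma open_vtheta_nonzero:
  assumes "Im \<tau> > 0" "continuous_on UNIV f"
  shows "open {p. vtheta \<tau> (f p) \<noteq> 0}"
  by (rule open_Collect_neq) (auto intro!: continuous_on_vtheta assms)

text \<open>\<open>d p\<close> is a complex line through p on which f is affine of nonzero slope k.
  Density of the non-zeros in one variable is carried to p along this line.\<close>

lemma dense_vtheta_nonzero:
  fixes f :: "'a::topological_space \<Rightarrow> complex"
  assumes \<tau>: "Im \<tau> > 0" and k: "k \<noteq> 0"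
    and d: "\<And>p. continuous_on UNIV (d p)" "\<And>p. d p 0 = p" "\<And>p s. f (d p s) = k * s + f p"
  shows "closure {p. vtheta \<tau> (f p) \<noteq> 0} = UNIV"
proof -
  have "p \<in> closure {p. vtheta \<tau> (f p) \<noteq> 0}" for p
  proof -
    have "d p ` closure {s. vtheta \<tau> (k * s + f p) \<noteq> 0} \<subseteq> closure {p. vtheta \<tau> (f p) \<noteq> 0}"
      by (rule image_closure_subset) (use d closure_subset in \<open>force intro: continuous_on_subset\<close>)+
    then have "d p 0 \<in> closure {p. vtheta \<tau> (f p) \<noteq> 0}"
      unfolding closure_vtheta_affine_nonzero[OF \<tau> k] by blast
    then show ?thesis by (simp add: d)
  qed
  then show ?thesis by auto
qed

lemma continuous_on_det_g_mat:
  fixes \<nu> :: "'n::finite \<Rightarrow> nat" and w :: "'a::topological_space \<Rightarrow> complex^'n"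
  assumes \<tau>: "Im \<tau> > 0" and a: "continuous_on S a" and w: "continuous_on S w"
    and reg: "\<And>p. p \<in> S \<Longrightarrow> u_regular \<tau> (w p)"
  shows "continuous_on S (\<lambda>p. det (g_mat \<tau> \<nu> (a p) (w p)))"
proof -
  have N: "CARD('n) > 0" by simp
  have b: "continuous_on S (\<lambda>p. btheta CARD('n) \<tau> i (f p))" if "continuous_on S f" for i f
    by (rule continuous_on_compose2[OF holomorphic_on_imp_continuous_on[OF btheta_holomorphic[OF \<tau> N]] that]) simp
  have "continuous_on S (\<lambda>p. g_mat \<tau> \<nu> (a p) (w p) $ i $ k)" for i k
    unfolding g_mat_nth
    by (intro continuous_intros b continuous_on_vtheta[OF \<tau>] a w) (use reg in \<open>auto simp: u_regular_def\<close>)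
  then show ?thesis unfolding det_def
    by (intro continuous_on_sum continuous_on_mult continuous_on_const continuous_on_prod)
qed

text \<open>The entries of g have denominators, so the determinant is handled as a continuous
  function on an open set S of regular points rather than on the whole space.\<close>

lemma open_g_mat_invertible:
  fixes \<nu> :: "'n::finite \<Rightarrow> nat" and w :: "'a::topological_space \<Rightarrow> complex^'n"
  assumes \<tau>: "Im \<tau> > 0" and S: "open S" and a: "continuous_on UNIV a" and w: "continuous_on UNIV w"
    and reg: "\<And>p. p \<in> S \<Longrightarrow> u_regular \<tau> (w p)"
  shows "open {p \<in> S. invertible (g_mat \<tau> \<nu> (a p) (w p))}"
proof -
  have "continuous_on S (\<lambda>p. det (g_mat \<tau> \<nu> (a p) (w p)))"
    by (rule continuous_on_det_g_mat[OF \<tau>]) (use a w reg in \<open>auto intro: continuous_on_subset\<close>)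
  then have "open (S \<inter> (\<lambda>p. det (g_mat \<tau> \<nu> (a p) (w p))) -` (- {0}))"
    by (rule continuous_open_preimage[OF _ S]) auto
  moreover have "S \<inter> (\<lambda>p. det (g_mat \<tau> \<nu> (a p) (w p))) -` (- {0}) = {p \<in> S. invertible (g_mat \<tau> \<nu> (a p) (w p))}"
    by (auto simp: invertible_det_nz)
  ultimately show ?thesis by simp
qed

text \<open>A finite intersection over the pairs i, j. Moving the i-th coordinate alone changes the
  difference with slope 1.\<close>

lemma dense_open_u_regular:
  fixes w :: "'a::topological_space \<Rightarrow> complex^'n"
  assumes \<tau>: "Im \<tau> > 0" and w: "continuous_on UNIV w"
    and d: "\<And>i p. continuous_on UNIV (d i p)" "\<And>i p. d i p 0 = p"
      "\<And>i j p s. w (d i p s) $ j = w p $ j + (if j = i then s else 0)"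
  shows "open {p. u_regular \<tau> (w p)}" "closure {p. u_regular \<tau> (w p)} = UNIV"
proof -
  have eq: "{p. u_regular \<tau> (w p)} = (\<Inter>(i, j)\<in>{(i, j). i \<noteq> j}. {p. vtheta \<tau> (w p $ i - w p $ j) \<noteq> 0})"
    by (auto simp: u_regular_def)
  have "open {p. vtheta \<tau> (w p $ i - w p $ j) \<noteq> 0}" for i j
    by (intro open_vtheta_nonzero[OF \<tau>] continuous_intros w)
  moreover have "closure {p. vtheta \<tau> (w p $ i - w p $ j) \<noteq> 0} = UNIV" if "i \<noteq> j" for i j
    by (rule dense_vtheta_nonzero[OF \<tau>, of 1 "d i"]) (use d that in auto)
  ultimately show "open {p. u_regular \<tau> (w p)}" "closure {p. u_regular \<tau> (w p)} = UNIV"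
    unfolding eq by (intro dense_open_INT; auto)+
qed

lemma continuous_on_add_coordinate: "continuous_on UNIV (\<lambda>s. (\<chi> j. u $ j + (if j = i then s else 0)) :: complex^'n)"
proof (rule continuous_on_vec_lambda)
  show "continuous_on UNIV (\<lambda>s. u $ j + (if j = i then s else 0))" for j
    by (cases "j = i") (auto intro!: continuous_intros)
qed

context
  fixes \<nu> :: "'n::finite \<Rightarrow> nat" and \<tau> :: complex
  assumes \<nu>: "bij_betw \<nu> UNIV {1..CARD('n)}" and \<tau>: "Im \<tau> > 0"
begin

lemma dom_vertex_open_dense: "open (dom_vertex \<tau> \<nu>)" "closure (dom_vertex \<tau> \<nu>) = UNIV"
proof -
  let ?h = "\<lambda>p::complex \<times> complex \<times> complex \<times> (complex^'n). fst p"
  let ?z1 = "\<lambda>p::complex \<times> complex \<times> complex \<times> (complex^'n). fst (snd p)"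
  let ?z2 = "\<lambda>p::complex \<times> complex \<times> complex \<times> (complex^'n). fst (snd (snd p))"
  let ?u = "\<lambda>p::complex \<times> complex \<times> complex \<times> (complex^'n). snd (snd (snd p))"
  define Z where "Z f = {p. vtheta \<tau> (f p) \<noteq> 0}" for f :: "complex \<times> complex \<times> complex \<times> (complex^'n) \<Rightarrow> complex"
  define R where "R = {p. u_regular \<tau> (?u p)}"
  define C where "C = (\<Inter>a\<in>{0..<int CARD('n)} \<times> {0..<int CARD('n)}.
     Z (\<lambda>p. (?h p + of_int (fst a) + of_int (snd a) * \<tau>) / of_nat CARD('n)))"
  have h: "open (Z f) \<and> closure (Z f) = UNIV"
    if "continuous_on UNIV f" "k \<noteq> 0" "\<And>p s. f (fst p + s, snd p) = k * s + f p" for f k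
    unfolding Z_def
    by (intro conjI open_vtheta_nonzero[OF \<tau> that(1)] dense_vtheta_nonzero[OF \<tau> that(2), where d = "\<lambda>p s. (fst p + s, snd p)"])
      (use that(3) in \<open>auto intro!: continuous_intros\<close>)
  have z1: "open (Z f) \<and> closure (Z f) = UNIV"
    if "continuous_on UNIV f" "\<And>p s. f (fst p, fst (snd p) + s, snd (snd p)) = 1 * s + f p" for f
    unfolding Z_def
    by (intro conjI open_vtheta_nonzero[OF \<tau> that(1)] dense_vtheta_nonzero[OF \<tau>, where k = 1 and d = "\<lambda>p s. (fst p, fst (snd p) + s, snd (snd p))"])
      (use that(2) in \<open>auto intro!: continuous_intros\<close>)
  have z2: "open (Z f) \<and> closure (Z f) = UNIV"
    if "continuous_on UNIV f" "\<And>p s. f (fst p, fst (snd p), fst (snd (snd p)) + s, snd (snd (snd p))) = 1 * s + f p" for f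
    unfolding Z_def
    by (intro conjI open_vtheta_nonzero[OF \<tau> that(1)] dense_vtheta_nonzero[OF \<tau>, where k = 1 and d = "\<lambda>p s. (fst p, fst (snd p), fst (snd (snd p)) + s, snd (snd (snd p)))"])
      (use that(2) in \<open>auto intro!: continuous_intros\<close>)
  have R: "open R \<and> closure R = UNIV"
    unfolding R_def
    by (intro conjI dense_open_u_regular[OF \<tau>, where
          d = "\<lambda>i p s. (fst p, fst (snd p), fst (snd (snd p)), (\<chi> j. ?u p $ j + (if j = i then s else 0)))"])
      (auto intro!: continuous_intros continuous_on_add_coordinate simp: vec_eq_iff prod_eq_iff)
  \<comment> \<open>The slope is 1/N because these functions contain h/N.\<close>
  have C: "open C \<and> closure C = UNIV"
    unfolding C_def
    by (intro conjI dense_open_INT; (rule h[THEN conjunct1, of _ "1 / of_nat CARD('n)"] h[THEN conjunct2, of _ "1 / of_nat CARD('n)"])?)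
       (auto intro!: continuous_intros simp: field_simps)
  define D where "D = Z ?h \<inter> (Z (\<lambda>p. ?z1 p - ?z2 p) \<inter> (Z (\<lambda>p. ?z1 p + ?h p) \<inter> (Z ?z2 \<inter> (C \<inter> R))))"
  have Int: "open (A \<inter> B) \<and> closure (A \<inter> B) = UNIV"
    if "open A \<and> closure A = UNIV" "open B \<and> closure B = UNIV" for A B :: "(complex \<times> complex \<times> complex \<times> (complex^'n)) set"
    using dense_open_Int that by blast
  have D: "open D \<and> closure D = UNIV"
    unfolding D_def
    by (intro Int R C h[of _ 1] z1 z2) (auto intro!: continuous_intros)
  have eq: "dom_vertex \<tau> \<nu> = {p \<in> D. invertible (g_mat \<tau> \<nu> (?z2 p + ?h p) (?u p))} \<inter> {p \<in> D. invertible (g_mat \<tau> \<nu> (?z1 p) (?u p))}"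
    unfolding dom_vertex_def D_def Z_def C_def R_def by auto
  have reg: "u_regular \<tau> (?u p)" if "p \<in> D" for p using that by (simp add: D_def R_def)
  show "open (dom_vertex \<tau> \<nu>)"
    unfolding eq using D reg by (intro open_Int open_g_mat_invertible[OF \<tau>]) (auto intro!: continuous_intros)
  \<comment> \<open>Density is obtained on the part of the domain where \<open>vtheta\<close> is
    nonzero at z2 + h and at z1, since there \<open>g_mat_invertible\<close> supplies both
    inverses.\<close>
  have sub: "D \<inter> (Z (\<lambda>p. ?z2 p + ?h p) \<inter> Z ?z1) \<subseteq> dom_vertex \<tau> \<nu>"
    unfolding eq using reg by (auto simp: Z_def intro!: g_mat_invertible[OF \<nu> \<tau>])
  have "open (Z (\<lambda>p. ?z2 p + ?h p) \<inter> Z ?z1) \<and> closure (Z (\<lambda>p. ?z2 p + ?h p) \<inter> Z ?z1) = UNIV"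
    by (intro Int z1 z2) (auto intro!: continuous_intros)
  then have "closure (D \<inter> (Z (\<lambda>p. ?z2 p + ?h p) \<inter> Z ?z1)) = UNIV"
    using Int[OF D] by blast
  with closure_mono[OF sub] show "closure (dom_vertex \<tau> \<nu>) = UNIV" by auto
qed

lemma dom_twist_open_dense: "open (dom_twist \<tau> \<nu>)" "closure (dom_twist \<tau> \<nu>) = UNIV"
proof -
  let ?h = "\<lambda>p::complex \<times> complex \<times> (complex^'n). fst p"
  let ?z = "\<lambda>p::complex \<times> complex \<times> (complex^'n). fst (snd p)"
  let ?u = "\<lambda>p::complex \<times> complex \<times> (complex^'n). snd (snd p)"
  let ?w = "\<lambda>k p. ?u p + axis k (?h p)"
  define Z where "Z f = {p. vtheta \<tau> (f p) \<noteq> 0}" for f :: "complex \<times> complex \<times> (complex^'n) \<Rightarrow> complex"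
  define R where "R w = {p. u_regular \<tau> (w p)}" for w :: "complex \<times> complex \<times> (complex^'n) \<Rightarrow> complex^'n"
  have ax: "continuous_on UNIV (\<lambda>p. axis k (?h p) :: complex^'n)" for k
    unfolding axis_def
  proof (rule continuous_on_vec_lambda)
    show "continuous_on UNIV (\<lambda>p. if j = k then ?h p else 0)" for j
      by (cases "j = k") (auto intro!: continuous_intros)
  qed
  have h: "open (Z ?h) \<and> closure (Z ?h) = UNIV"
    unfolding Z_def
    by (intro conjI open_vtheta_nonzero[OF \<tau>] dense_vtheta_nonzero[OF \<tau>, where k = 1 and d = "\<lambda>p s. (fst p + s, snd p)"])
      (auto intro!: continuous_intros)
  have z: "open (Z (\<lambda>p. ?z p + ?h p)) \<and> closure (Z (\<lambda>p. ?z p + ?h p)) = UNIV"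
    unfolding Z_def
    by (intro conjI open_vtheta_nonzero[OF \<tau>] dense_vtheta_nonzero[OF \<tau>, where k = 1 and d = "\<lambda>p s. (fst p, fst (snd p) + s, snd (snd p))"])
      (auto intro!: continuous_intros)
  have R: "open (R w) \<and> closure (R w) = UNIV"
    if "continuous_on UNIV w" "\<And>i j p s. w (fst p, fst (snd p), (\<chi> j. ?u p $ j + (if j = i then s else 0))) $ j = w p $ j + (if j = i then s else 0)" for w
    unfolding R_def
    by (intro conjI dense_open_u_regular[OF \<tau> that(1), where
          d = "\<lambda>i p s. (fst p, fst (snd p), (\<chi> j. ?u p $ j + (if j = i then s else 0)))"])
      (use that(2) in \<open>auto intro!: continuous_intros continuous_on_add_coordinate simp: vec_eq_iff prod_eq_iff\<close>)
  have Ru: "open (R ?u) \<and> closure (R ?u) = UNIV"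
    by (rule R) (auto intro!: continuous_intros)
  have Rw: "open (R (?w k)) \<and> closure (R (?w k)) = UNIV" for k
    by (rule R) (auto intro!: continuous_intros ax)
  have RW: "open (\<Inter>k\<in>UNIV. R (?w k)) \<and> closure (\<Inter>k\<in>UNIV. R (?w k)) = UNIV"
    by (intro conjI dense_open_INT) (use Rw in auto)
  define D where "D = Z ?h \<inter> (Z (\<lambda>p. ?z p + ?h p) \<inter> (R ?u \<inter> (\<Inter>k\<in>UNIV. R (?w k))))"
  have Int: "open (A \<inter> B) \<and> closure (A \<inter> B) = UNIV"
    if "open A \<and> closure A = UNIV" "open B \<and> closure B = UNIV" for A B :: "(complex \<times> complex \<times> (complex^'n)) set"
    using dense_open_Int that by blast
  have D: "open D \<and> closure D = UNIV"
    unfolding D_def by (intro Int h z Ru RW)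
  \<comment> \<open>\<open>g_mat_invertible\<close> applies at every shifted u, its spectral
    argument being the same z + h whose theta value is nonzero on D.\<close>
  have eq: "dom_twist \<tau> \<nu> = D"
    unfolding dom_twist_def D_def Z_def R_def by (auto intro!: g_mat_invertible[OF \<nu> \<tau>])
  show "open (dom_twist \<tau> \<nu>)" "closure (dom_twist \<tau> \<nu>) = UNIV" using D by (auto simp: eq)
qed

end

theorem theorem2:
  fixes \<tau> :: complex and \<nu> :: "'n::finite \<Rightarrow> nat"
  assumes "Im \<tau> > 0" and "bij_betw \<nu> UNIV {1..CARD('n)}"
  shows "open (dom_vertex \<tau> \<nu>) \<and> closure (dom_vertex \<tau> \<nu>) = UNIV \<and>
    (\<forall>(h, z1, z2, u) \<in> dom_vertex \<tau> \<nu>.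
       R_BB \<tau> \<nu> h (z1 - z2) =
         leg1 (g_mat \<tau> \<nu> (z1 + h) u) ** leg2 (g_mat \<tau> \<nu> z2 u) ** R_ACF \<tau> h z1 z2 u **
         leg2 (matrix_inv (g_mat \<tau> \<nu> (z2 + h) u)) ** leg1 (matrix_inv (g_mat \<tau> \<nu> z1 u))) \<and>
    open (dom_twist \<tau> \<nu>) \<and> closure (dom_twist \<tau> \<nu>) = UNIV \<and>
    (\<forall>(h, z, u) \<in> dom_twist \<tau> \<nu>.
       R_bar \<tau> h z u = g_inv1_shift2 \<tau> \<nu> h (z + h) u ** leg1 (g_mat \<tau> \<nu> z u))"
proof -
  note \<tau> = assms(1) and \<nu> = assms(2)
  have 1: "R_BB \<tau> \<nu> h (z1 - z2) =
         leg1 (g_mat \<tau> \<nu> (z1 + h) u) ** leg2 (g_mat \<tau> \<nu> z2 u) ** R_ACF \<tau> h z1 z2 u **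
         leg2 (matrix_inv (g_mat \<tau> \<nu> (z2 + h) u)) ** leg1 (matrix_inv (g_mat \<tau> \<nu> z1 u))"
    if "(h, z1, z2, u) \<in> dom_vertex \<tau> \<nu>" for h z1 z2 u
  proof -
    let ?A = "g_mat \<tau> \<nu> z1 u" and ?B = "g_mat \<tau> \<nu> (z2 + h) u"
    let ?A' = "g_mat \<tau> \<nu> (z1 + h) u" and ?B' = "g_mat \<tau> \<nu> z2 u"
    have dom: "vtheta \<tau> h \<noteq> 0" "vtheta \<tau> (z1 - z2) \<noteq> 0" "vtheta \<tau> (z1 + h) \<noteq> 0" "vtheta \<tau> z2 \<noteq> 0"
      "\<And>a1 a2. a1 \<in> {0..<int CARD('n)} \<Longrightarrow> a2 \<in> {0..<int CARD('n)} \<Longrightarrow>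
        vtheta \<tau> ((h + of_int a1 + of_int a2 * \<tau>) / of_nat CARD('n)) \<noteq> 0"
      "u_regular \<tau> u" "invertible ?B" "invertible ?A"
      using that unfolding dom_vertex_def by blast+
    have "R_BB \<tau> \<nu> h (z1 - z2) ** (?A \<otimes>\<^sub>M ?B) = (?A' \<otimes>\<^sub>M ?B') ** R_ACF \<tau> h z1 z2 u"
      by (rule R_BB_intertwines[OF \<nu> \<tau> dom(6) dom(1-5)])
    then have "R_BB \<tau> \<nu> h (z1 - z2) ** (?A \<otimes>\<^sub>M ?B) ** (matrix_inv ?A \<otimes>\<^sub>M matrix_inv ?B) =
       (?A' \<otimes>\<^sub>M ?B') ** R_ACF \<tau> h z1 z2 u ** (matrix_inv ?A \<otimes>\<^sub>M matrix_inv ?B)" by simp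
    then have "R_BB \<tau> \<nu> h (z1 - z2) = (?A' \<otimes>\<^sub>M ?B') ** R_ACF \<tau> h z1 z2 u ** (matrix_inv ?A \<otimes>\<^sub>M matrix_inv ?B)"
      by (simp add: matrix_mul_assoc[symmetric] tensor_mult matrix_inv_mult dom tensor_mat_1)
    \<comment> \<open>Matrices acting on different tensor factors commute, so the two inverse legs
      in this order form the inverse of the tensor product of \<open>?A\<close> and
      \<open>?B\<close>.\<close>
    moreover have "leg1 ?A' ** leg2 ?B' = ?A' \<otimes>\<^sub>M ?B'" "leg2 (matrix_inv ?B) ** leg1 (matrix_inv ?A) = matrix_inv ?A \<otimes>\<^sub>M matrix_inv ?B"
      by (simp_all add: leg1_def leg2_def tensor_mult)
    ultimately show ?thesis by (simp add: matrix_mul_assoc[symmetric])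
  qed
  have 2: "R_bar \<tau> h z u = g_inv1_shift2 \<tau> \<nu> h (z + h) u ** leg1 (g_mat \<tau> \<nu> z u)"
    if "(h, z, u) \<in> dom_twist \<tau> \<nu>" for h z u
    using that unfolding dom_twist_def by (intro R_bar_twist[OF \<nu> \<tau>]) auto
  show ?thesis
    using dom_vertex_open_dense[OF \<nu> \<tau>] dom_twist_open_dense[OF \<nu> \<tau>] 1 2 by blast
qed

end
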